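(* Let $f(z)$ be a non-constant entire function of finite order, let $\eta$ be a nonzero complex number, and let $\Delta_{\eta}f(z)=f(z+\eta)-f(z)$. Let $a_{1},a_{2},b_{1},b_{2}$ be finite complex numbers with $a_{1}\neq b_{1}$ and $a_{2}\neq b_{2}$, and define $$\varphi(z)=\frac{f'(z)\big((a_{2}-b_{2})f(z)-(a_{1}-b_{1})\Delta_{\eta}f(z)- a_{2}b_{1}+a_{1}b_{2}\big)}{(f(z)-a_{1})(f(z)-b_{1})}.$$ If $f(z)$ and $\Delta_{\eta}f(z)$ share the pairs $(a_{1},a_{2})$ and $(b_{1},b_{2})$ IM, then either $$(a_{2}-b_{2})f(z)-(a_{1}-b_{1})\Delta_{\eta}f(z)\equiv a_{2}b_{1}-a_{1}b_{2},$$ or $\varphi(z)$ is a periodic entire function with period $\eta$.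
   Context: For complex numbers $a,b$, two non-constant meromorphic functions $f$ and $g$ are said to share the pair $(a,b)$ IM if $f-a$ and $g-b$ have the same zeros, ignoring multiplicities. The order of a meromorphic function $f$ is $\rho(f)=\limsup_{r\to\infty}\frac{\log^{+}T(r,f)}{\log r}$, where $T(r,f)$ is the Nevanlinna characteristic function. *)

theory Defs
  imports "HOL-Complex_Analysis.Complex_Analysis" "HOL-Library.Liminf_Limsup"
begin

definition log_plus :: "real \<Rightarrow> real" where
  "log_plus x = max 0 (ln x)"

text \<open>Nevanlinna characteristic of an entire function (no poles, so N(r,f)=0 and T(r,f)=m(r,f)).\<close>
definition nev_char :: "(complex \<Rightarrow> complex) \<Rightarrow> real \<Rightarrow> real" where
  "nev_char f r = integral {0..2*pi} (\<lambda>\<theta>. log_plus (cmod (f (of_real r * cis \<theta>)))) / (2*pi)"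

definition order_of :: "(complex \<Rightarrow> complex) \<Rightarrow> ereal" where
  "order_of f = Limsup at_top (\<lambda>r::real. ereal (log_plus (nev_char f r) / ln r))"

definition share_pair_IM :: "(complex \<Rightarrow> complex) \<Rightarrow> (complex \<Rightarrow> complex) \<Rightarrow> complex \<Rightarrow> complex \<Rightarrow> bool" where
  "share_pair_IM f g a b \<longleftrightarrow> {z. f z = a} = {z. g z = b}"

end

theory Submission
  imports Defs
begin

text \<open>
  Normalise to \<open>F = (f - b1) / (a1 - b1)\<close>, so that \<open>F = 1\<close>, \<open>F = 0\<close> correspond to \<open>G = \<alpha>\<close>, \<open>G = \<beta>\<close>
  for \<open>G z = F (z + \<eta>) - F z\<close>, and let \<open>L = (\<alpha> - \<beta>) F + \<beta> - G\<close>, which vanishes at all shared points. Then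
  \<open>\<phi> = F' L / (F (F - 1))\<close> and \<open>\<psi> = G' L / ((G - \<alpha>) (G - \<beta>))\<close> are entire, and \<open>\<phi>\<close> has characteristic
  \<open>o(T)\<close>, where \<open>T = T(r, F)\<close>, along a sequence of radii of regular growth.

  Where \<open>F\<close> is large compared with \<open>G\<close>, both \<open>\<phi>(z)\<close> and \<open>\<phi>(z + \<eta>)\<close> are close to \<open>\<alpha> - \<beta>\<close> times
  logarithmic derivatives of \<open>F\<close> that nearly agree. If \<open>\<phi>\<close> is not \<open>\<eta>\<close>-periodic, Jensen's inequality for
  \<open>\<phi>(z + \<eta>) - \<phi>(z)\<close> therefore forces \<open>T(r, G) = T(r, F) + o(T)\<close>, and this makes \<open>\<psi>\<close> small as well.
  At a shared point of multiplicities \<open>p\<close> for \<open>F\<close> and \<open>q\<close> for \<open>G\<close> one has \<open>q \<phi> = p (\<alpha> - \<beta>) \<psi>\<close>; Jensen's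
  inequality for an auxiliary entire function shows that for some \<open>p, q \<le> 5\<close> this holds identically.
  Integrating, \<open>(F - 1)^q (G - \<beta>)^p = c F^q (G - \<alpha>)^p\<close>, whence \<open>q T(r, F) = p T(r, G) + O(1)\<close> and \<open>p = q\<close>.
  Then \<open>F\<close> is a Moebius transform of \<open>G\<close>, and the little Picard theorem leaves only \<open>L = 0\<close>.
\<close>

section \<open>Means over circles\<close>

text \<open>The obstacle is that the pairs are shared without multiplicities, so zeros of
  \<open>F - 1\<close> and \<open>G - \<alpha>\<close> cannot be compared by counting. Counting of
  shared points is therefore avoided: each main estimate is a pointwise inequality on a circle, with
  a bound \<open>x\<close> for finitely many small quotients on its right side, and its mean is
  played against Jensen's lower bound for the mean of \<open>ln (cmod X)\<close> of a suitable
  entire \<open>X\<close>. Finite order enters twice through the radii: it gives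
  \<open>T (2^j r) \<le> D^j T r\<close>, and with this the bound of order
  \<open>(T (2r) + T (4r) + 1) / sqrt r\<close> for shift quotients becomes \<open>o(T)\<close>. The
  radii also avoid countably many values, so that no denominator and no function whose plain
  logarithm is averaged vanishes on a circle; all integrands stay continuous. The exponents belong
  to the auxiliary function \<open>W^5 F'^5 (G - \<alpha>) (G - \<beta>) / (F (F - 1))^4\<close>. It
  is at most of size \<open>1 / F\<close> up to small factors, yet entire: large multiplicities
  supply enough zeros by themselves, and the finitely many small pairs \<open>p, q \<le> 5\<close>
  are handled by the product \<open>W\<close>.\<close>

definition circle_mean :: "(complex \<Rightarrow> real) \<Rightarrow> real \<Rightarrow> real" where
  "circle_mean h r = integral {0..2*pi} (\<lambda>\<theta>. h (of_real r * cis \<theta>)) / (2*pi)"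

lemma nev_char_eq: "nev_char f r = circle_mean (\<lambda>z. log_plus (cmod (f z))) r"
  by (simp add: nev_char_def circle_mean_def)

lemma circle_integrable:
  fixes h :: "complex \<Rightarrow> 'a::banach"
  assumes "continuous_on (sphere 0 r) h" "0 \<le> r"
  shows "(\<lambda>\<theta>. h (of_real r * cis \<theta>)) integrable_on {0..2*pi}"
proof (rule integrable_continuous_interval)
  show "continuous_on {0..2*pi} (\<lambda>\<theta>. h (of_real r * cis \<theta>))"
    by (rule continuous_on_compose2[OF assms(1)])
       (use assms(2) in \<open>auto intro!: continuous_intros simp: norm_mult\<close>)
qed

lemma circle_mean_mono:
  assumes "continuous_on (sphere 0 r) g" "continuous_on (sphere 0 r) h" "0 \<le> r"
    and "\<And>z. cmod z = r \<Longrightarrow> g z \<le> h z"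
  shows "circle_mean g r \<le> circle_mean h r"
proof -
  have "integral {0..2*pi} (\<lambda>\<theta>. g (of_real r * cis \<theta>)) \<le> integral {0..2*pi} (\<lambda>\<theta>. h (of_real r * cis \<theta>))"
    by (rule integral_le) (use assms in \<open>auto intro!: circle_integrable simp: norm_mult\<close>)
  then show ?thesis by (simp add: circle_mean_def divide_right_mono)
qed

lemma circle_mean_cong:
  assumes "0 \<le> r" "\<And>z. cmod z = r \<Longrightarrow> g z = h z"
  shows "circle_mean g r = circle_mean h r"
  using assms by (auto simp: circle_mean_def norm_mult intro!: integral_cong)

lemma circle_mean_add:
  assumes "continuous_on (sphere 0 r) g" "continuous_on (sphere 0 r) h" "0 \<le> r"
  shows "circle_mean (\<lambda>z. g z + h z) r = circle_mean g r + circle_mean h r"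
  using assms by (simp add: circle_mean_def Henstock_Kurzweil_Integration.integral_add circle_integrable add_divide_distrib)

lemma circle_mean_diff:
  assumes "continuous_on (sphere 0 r) g" "continuous_on (sphere 0 r) h" "0 \<le> r"
  shows "circle_mean (\<lambda>z. g z - h z) r = circle_mean g r - circle_mean h r"
  using assms by (simp add: circle_mean_def Henstock_Kurzweil_Integration.integral_diff circle_integrable diff_divide_distrib)

lemma circle_mean_cmult [simp]: "circle_mean (\<lambda>z. c * h z) r = c * circle_mean h r"
  by (simp add: circle_mean_def)

lemma circle_mean_const [simp]: "circle_mean (\<lambda>z. c) r = c"
  by (simp add: circle_mean_def)

lemma continuous_on_sum_list [continuous_intros]:
  fixes h :: "'a \<Rightarrow> 'b::topological_space \<Rightarrow> real"
  assumes "\<And>a. a \<in> set as \<Longrightarrow> continuous_on S (h a)"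
  shows "continuous_on S (\<lambda>z. \<Sum>a\<leftarrow>as. h a z)"
  using assms by (induction as) (auto intro!: continuous_intros)

lemma circle_mean_sum_list:
  assumes "\<And>a. a \<in> set as \<Longrightarrow> continuous_on (sphere 0 r) (h a)" "0 \<le> r"
  shows "circle_mean (\<lambda>z. \<Sum>a\<leftarrow>as. h a z) r = (\<Sum>a\<leftarrow>as. circle_mean (h a) r)"
  using assms(1)
proof (induction as)
  case (Cons a as)
  then show ?case by (simp add: circle_mean_add continuous_on_sum_list assms(2))
qed simp

lemma circle_mean_nonneg:
  assumes "continuous_on (sphere 0 r) h" "0 \<le> r" "\<And>z. cmod z = r \<Longrightarrow> 0 \<le> h z"
  shows "0 \<le> circle_mean h r"
  using circle_mean_mono[of r "\<lambda>_. 0" h] assms by simp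

section \<open>The positive part of the logarithm\<close>

lemma log_plus_nonneg [simp]: "0 \<le> log_plus x"
  by (simp add: log_plus_def)

text \<open>Since \<open>max 1 x\<close> stays away from 0, this form yields continuity and the
  product and sum rules without treating zeros separately.\<close>

lemma log_plus_eq_ln_max: "0 \<le> x \<Longrightarrow> log_plus x = ln (max 1 x)"
  by (cases "x = 0") (auto simp: log_plus_def max_def ln_le_zero_iff)

lemma ln_le_log_plus: "ln x \<le> log_plus x"
  by (simp add: log_plus_def)

lemma continuous_on_log_plus [continuous_intros]:
  assumes "continuous_on S h" shows "continuous_on S (\<lambda>z. log_plus (cmod (h z)))"
proof -
  have "continuous_on S (\<lambda>z. ln (max 1 (cmod (h z))))"
    by (intro continuous_intros assms) auto
  then show ?thesis by (simp add: log_plus_eq_ln_max)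
qed

lemma log_plus_mono: "0 \<le> x \<Longrightarrow> x \<le> y \<Longrightarrow> log_plus x \<le> log_plus y"
  by (simp add: log_plus_eq_ln_max)

lemma log_plus_mult: "0 \<le> x \<Longrightarrow> 0 \<le> y \<Longrightarrow> log_plus (x * y) \<le> log_plus x + log_plus y"
proof -
  assume xy: "0 \<le> x" "0 \<le> y"
  have "max 1 (x * y) \<le> max 1 x * max 1 y"
    using xy mult_mono[of x "max 1 x" y "max 1 y"] mult_mono[of 1 "max 1 x" 1 "max 1 y"] by auto
  then have "ln (max 1 (x * y)) \<le> ln (max 1 x * max 1 y)" by simp
  moreover have "max 1 x \<noteq> 0" "max 1 y \<noteq> 0" by (auto simp: max_def)
  ultimately show ?thesis using xy by (simp add: log_plus_eq_ln_max ln_mult)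
qed

lemma log_plus_add: "0 \<le> x \<Longrightarrow> 0 \<le> y \<Longrightarrow> log_plus (x + y) \<le> log_plus x + log_plus y + ln 2"
proof -
  assume xy: "0 \<le> x" "0 \<le> y"
  have "max 1 x * max 1 y \<ge> max 1 x" "max 1 x * max 1 y \<ge> max 1 y"
    using mult_mono[of "max 1 x" "max 1 x" 1 "max 1 y"] mult_mono[of 1 "max 1 x" "max 1 y" "max 1 y"] by auto
  then have "max 1 (x + y) \<le> max 1 x * max 1 y * 2"
    by linarith
  then have "ln (max 1 (x + y)) \<le> ln (max 1 x * max 1 y * 2)" by simp
  moreover have "max 1 x \<noteq> 0" "max 1 y \<noteq> 0" by (auto simp: max_def)
  ultimately show ?thesis using xy by (simp add: log_plus_eq_ln_max ln_mult)
qed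

section \<open>Cauchy integrals on circles and logarithms of zero-free functions\<close>

lemma holomorphic_circle_integral:
  fixes h :: "complex \<Rightarrow> complex"
  assumes "continuous_on (cball 0 r) h" "h holomorphic_on ball 0 r" "0 < r"
  shows "((\<lambda>\<theta>. h (of_real r * cis \<theta>)) has_integral 2 * pi * h 0) {0..2*pi}"
proof -
  have "((\<lambda>u. h u/(u-0)) has_contour_integral (2 * of_real pi * \<i> * h 0)) (circlepath 0 r)"
    using assms by (intro Cauchy_integral_circlepath) auto
  then have "((\<lambda>t. h (of_real r * cis t) / (of_real r * cis t) * r * \<i> * cis t) has_integral (2 * of_real pi * \<i> * h 0)) {0..2*pi}"
    by (simp add: circlepath_def has_contour_integral_part_circlepath_iff)
  then have "((\<lambda>t. h (of_real r * cis t) * \<i>) has_integral (2 * of_real pi * \<i> * h 0)) {0..2*pi}"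
    by (rule has_integral_eq[rotated]) (use assms in auto)
  from has_integral_mult_left[OF this, of "-\<i>"] show ?thesis by (simp add: algebra_simps)
qed

lemma circle_mean_Re:
  fixes h :: "complex \<Rightarrow> complex"
  assumes "continuous_on (cball 0 r) h" "h holomorphic_on ball 0 r" "0 < r"
  shows "circle_mean (\<lambda>z. Re (h z)) r = Re (h 0)"
proof -
  have "((\<lambda>\<theta>. Re (h (of_real r * cis \<theta>))) has_integral Re (2 * pi * h 0)) {0..2*pi}"
    using has_integral_linear[OF holomorphic_circle_integral[OF assms] bounded_linear_Re]
    by (simp add: o_def)
  then show ?thesis by (simp add: circle_mean_def integral_unique)
qed

lemma deriv_circle_integral:
  fixes h :: "complex \<Rightarrow> complex"
  assumes "continuous_on (cball 0 r) h" "h holomorphic_on ball 0 r" "cmod w < r"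
  shows "((\<lambda>\<theta>. h (of_real r * cis \<theta>) * (of_real r * cis \<theta> / (of_real r * cis \<theta> - w)^2))
           has_integral 2 * pi * deriv h w) {0..2*pi}"
proof -
  have "((\<lambda>u. h u / (u-w) ^ (Suc 1)) has_contour_integral ((2 * pi * \<i>) / (fact 1) * (deriv ^^ 1) h w))
           (circlepath 0 r)"
    using assms by (intro Cauchy_has_contour_integral_higher_derivative_circlepath) auto
  then have "((\<lambda>t. h (of_real r * cis t) / (of_real r * cis t - w)^2 * r * \<i> * cis t) has_integral
      (2 * of_real pi * \<i> * deriv h w)) {0..2*pi}"
    by (simp add: circlepath_def has_contour_integral_part_circlepath_iff power2_eq_square)
  from has_integral_mult_left[OF this, of "-\<i>"] show ?thesis by (simp add: mult_ac)
qed

text \<open>The kernel \<open>\<zeta>/(\<zeta>-w)\<^sup>2\<close> integrates \<open>h\<close> to \<open>deriv h w\<close> and the conjugate of \<open>h\<close> to \<open>0\<close>,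
  hence \<open>2 * Re h\<close> to \<open>deriv h w\<close>.\<close>

lemma deriv_bound_Re:
  fixes h :: "complex \<Rightarrow> complex"
  assumes h: "continuous_on (cball 0 r) h" "h holomorphic_on ball 0 r" and w: "cmod w < r"
  shows "cmod (deriv h w) \<le> 2 * r / (r - cmod w)^2 * circle_mean (\<lambda>z. \<bar>Re (h z)\<bar>) r"
proof -
  have r: "0 < r" using w norm_ge_zero[of w] by linarith
  let ?z = "\<lambda>\<theta>. of_real r * cis \<theta>"
  \<comment> \<open>On the circle \<open>z * cnj z = r^2\<close> makes the conjugate of
    \<open>k z\<close> equal to \<open>cnj (h z)\<close> times the kernel, while \<open>k\<close>
    itself is holomorphic in the disc and vanishes at 0. Its mean is therefore 0.\<close>
  define k where "k z = h z * (of_real (r^2) * z / (of_real (r^2) - cnj w * z)^2)" for z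
  have ne: "of_real (r^2) - cnj w * z \<noteq> 0" if "cmod z \<le> r" for z
  proof
    assume "of_real (r^2) - cnj w * z = 0"
    then have "cmod (of_real (r^2)) = cmod (cnj w * z)" by simp
    then have "r * r = cmod w * cmod z" by (simp add: norm_mult power2_eq_square)
    also have "\<dots> \<le> cmod w * r" using that by (intro mult_left_mono) auto
    also have "\<dots> < r * r" using w r by simp
    finally show False by simp
  qed
  have "((\<lambda>\<theta>. k (?z \<theta>)) has_integral 2 * pi * k 0) {0..2*pi}"
  proof (rule holomorphic_circle_integral[OF _ _ r])
    show "continuous_on (cball 0 r) k"
      unfolding k_def using ne by (intro continuous_intros h) auto
    show "k holomorphic_on ball 0 r"
      unfolding k_def using ne by (intro holomorphic_intros h) auto
  qed
  then have "((\<lambda>\<theta>. k (?z \<theta>)) has_integral 0) {0..2*pi}" by (simp add: k_def)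
  from has_integral_linear[OF this bounded_linear_cnj]
  have "((\<lambda>\<theta>. cnj (k (?z \<theta>))) has_integral 0) {0..2*pi}" by (simp add: o_def)
  moreover have "cnj (k (?z \<theta>)) = cnj (h (?z \<theta>)) * (?z \<theta> / (?z \<theta> - w)^2)" for \<theta>
  proof -
    have zz: "?z \<theta> * cnj (?z \<theta>) = of_real (r^2)"
      by (simp add: cis_cnj power2_eq_square mult_ac flip: cis_inverse)
    have z0: "?z \<theta> \<noteq> 0" "cnj (?z \<theta>) \<noteq> 0" using r by auto
    have "cnj (k (?z \<theta>)) = cnj (h (?z \<theta>)) * (of_real (r^2) * cnj (?z \<theta>) / (of_real (r^2) - w * cnj (?z \<theta>))^2)"
      by (simp add: k_def)
    also have "of_real (r^2) - w * cnj (?z \<theta>) = (?z \<theta> - w) * cnj (?z \<theta>)"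
      by (simp only: zz[symmetric] algebra_simps)
    also have "of_real (r^2) * cnj (?z \<theta>) / ((?z \<theta> - w) * cnj (?z \<theta>))^2 = ?z \<theta> / (?z \<theta> - w)^2"
      using z0 by (simp only: zz[symmetric]) (simp add: power2_eq_square)
    finally show ?thesis .
  qed
  ultimately have "((\<lambda>\<theta>. cnj (h (?z \<theta>)) * (?z \<theta> / (?z \<theta> - w)^2)) has_integral 0) {0..2*pi}"
    by simp
  from has_integral_add[OF deriv_circle_integral[OF h w] this]
  have *: "((\<lambda>\<theta>. of_real (2 * Re (h (?z \<theta>))) * (?z \<theta> / (?z \<theta> - w)^2)) has_integral 2 * pi * deriv h w) {0..2*pi}"
    by (simp only: distrib_right[symmetric] complex_add_cnj of_real_mult of_real_numeral add_0_right)
  have cont: "continuous_on (sphere 0 r) (\<lambda>z. \<bar>Re (h z)\<bar>)"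
    by (intro continuous_intros continuous_on_subset[OF h(1)]) auto
  have "cmod (2 * pi * deriv h w) \<le> integral {0..2*pi} (\<lambda>\<theta>. 2 * r / (r - cmod w)^2 * \<bar>Re (h (?z \<theta>))\<bar>)"
    unfolding integral_unique[OF *, symmetric]
  proof (rule integral_norm_bound_integral)
    show "(\<lambda>\<theta>. of_real (2 * Re (h (?z \<theta>))) * (?z \<theta> / (?z \<theta> - w)^2)) integrable_on {0..2*pi}"
      using * by blast
    show "(\<lambda>\<theta>. 2 * r / (r - cmod w)^2 * \<bar>Re (h (?z \<theta>))\<bar>) integrable_on {0..2*pi}"
      using integrable_cmul[OF circle_integrable[OF cont], of "2 * r / (r - cmod w)^2"] r by simp
    fix \<theta> :: real
    have "r - cmod w \<le> cmod (?z \<theta> - w)"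
      using norm_triangle_ineq2[of "?z \<theta>" w] r by (simp add: norm_mult)
    then have "r / (cmod (?z \<theta> - w))^2 \<le> r / (r - cmod w)^2"
      using w r by (intro divide_left_mono power_mono) (auto simp: zero_less_mult_iff)
    then have "2 * \<bar>Re (h (?z \<theta>))\<bar> * (r / (cmod (?z \<theta> - w))^2) \<le> 2 * \<bar>Re (h (?z \<theta>))\<bar> * (r / (r - cmod w)^2)"
      by (intro mult_left_mono) auto
    then show "cmod (of_real (2 * Re (h (?z \<theta>))) * (?z \<theta> / (?z \<theta> - w)^2)) \<le> 2 * r / (r - cmod w)^2 * \<bar>Re (h (?z \<theta>))\<bar>"
      using r by (simp add: norm_mult norm_divide norm_power mult_ac)
  qed
  also have "\<dots> = 2 * pi * (2 * r / (r - cmod w)^2 * circle_mean (\<lambda>z. \<bar>Re (h z)\<bar>) r)"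
    by (simp add: circle_mean_def)
  finally have "cmod (2 * pi * deriv h w) \<le> 2 * pi * (2 * r / (r - cmod w)^2 * circle_mean (\<lambda>z. \<bar>Re (h z)\<bar>) r)" .
  moreover have "cmod (2 * pi * deriv h w) = 2 * pi * cmod (deriv h w)" by (simp add: norm_mult)
  ultimately show ?thesis
    by (metis mult_le_cancel_left_pos mult_pos_pos pi_gt_zero zero_less_numeral)
qed

text \<open>The zero set has positive distance from the compact disc, so a branch of the logarithm
  exists on a slightly larger open disc and is continuous up to the circle.\<close>

lemma entire_log_on_cball:
  assumes E: "E holomorphic_on UNIV" and ne: "\<And>z. cmod z \<le> r \<Longrightarrow> E z \<noteq> 0" and r: "0 < r"
  obtains g where "continuous_on (cball 0 r) g" "g holomorphic_on ball 0 r"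
    "\<And>z. cmod z \<le> r \<Longrightarrow> Re (g z) = ln (cmod (E z))"
    "\<And>z. cmod z < r \<Longrightarrow> deriv g z = deriv E z / E z"
proof -
  have "closed {z. E z = 0}"
    using E by (intro closed_Collect_eq continuous_on_const holomorphic_on_imp_continuous_on)
  then obtain d where d: "d > 0" "\<And>x y. x \<in> cball 0 r \<Longrightarrow> E y = 0 \<Longrightarrow> d \<le> dist x y"
    using separate_compact_closed[of "cball 0 r" "{z. E z = 0}"] ne by force
  have ne': "E z \<noteq> 0" if "z \<in> ball 0 (r + d)" for z
  proof (cases "cmod z \<le> r")
    case False
    \<comment> \<open>The radial projection of \<open>z\<close> to the circle; its distance from
      \<open>z\<close> is \<open>cmod z - r < d\<close>.\<close>
    define x where "x = of_real (r / cmod z) * z"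
    have "x - z = of_real (r / cmod z - 1) * z" by (simp add: x_def algebra_simps)
    then have "dist x z = \<bar>r / cmod z - 1\<bar> * cmod z"
      by (simp only: dist_norm norm_mult norm_of_real)
    also have "\<dots> = cmod z - r" using False r by (cases "z = 0") (auto simp: abs_if field_simps split: if_splits)
    finally have "dist x z < d" using that by simp
    moreover have "x \<in> cball 0 r" using False r by (cases "z = 0") (auto simp: x_def norm_mult norm_divide)
    ultimately show ?thesis using d(2)[of x z] by auto
  qed (use ne in auto)
  obtain g where g: "g holomorphic_on ball 0 (r + d)" "\<And>x. x \<in> ball 0 (r + d) \<Longrightarrow> exp (g x) = E x"
    using holomorphic_logarithm_exists[of "ball 0 (r + d)" E 0] ne' r d(1) holomorphic_on_subset[OF E] by auto
  have sub: "cball 0 r \<subseteq> ball 0 (r + d)" using d(1) by auto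
  show thesis
  proof
    show "continuous_on (cball 0 r) g" "g holomorphic_on ball 0 r"
      using g(1) sub ball_subset_cball holomorphic_on_imp_continuous_on holomorphic_on_subset by blast+
    show "Re (g z) = ln (cmod (E z))" if "cmod z \<le> r" for z
      using g(2)[of z, symmetric] that d(1) by simp
    show "deriv g z = deriv E z / E z" if "cmod z < r" for z
    proof -
      have z: "z \<in> ball 0 (r + d)" using that d(1) by auto
      have "(g has_field_derivative deriv g z) (at z)"
        using g(1) z by (intro holomorphic_derivI[of _ "ball 0 (r + d)"]) auto
      then have "((\<lambda>z. exp (g z)) has_field_derivative exp (g z) * deriv g z) (at z)"
        by (auto intro!: derivative_eq_intros)
      moreover have "eventually (\<lambda>x. exp (g x) = E x) (nhds z)"
        using z g(2) by (intro eventually_nhds_in_open[THEN eventually_mono, of "ball 0 (r + d)"]) auto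
      ultimately have "(E has_field_derivative exp (g z) * deriv g z) (at z)"
        by (simp cong: DERIV_cong_ev)
      then show ?thesis using g(2)[OF z] ne'[OF z] by (simp add: DERIV_imp_deriv)
    qed
  qed
qed

lemma circle_mean_ln_zero_free:
  assumes "E holomorphic_on UNIV" "\<And>z. cmod z \<le> r \<Longrightarrow> E z \<noteq> 0" "0 < r"
  shows "circle_mean (\<lambda>z. ln (cmod (E z))) r = ln (cmod (E 0))"
proof -
  obtain g where g: "continuous_on (cball 0 r) g" "g holomorphic_on ball 0 r"
    "\<And>z. cmod z \<le> r \<Longrightarrow> Re (g z) = ln (cmod (E z))"
    using entire_log_on_cball[OF assms] by metis
  have "circle_mean (\<lambda>z. ln (cmod (E z))) r = circle_mean (\<lambda>z. Re (g z)) r"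
    using g(3) assms(3) by (intro circle_mean_cong) auto
  also have "\<dots> = Re (g 0)" using circle_mean_Re[OF g(1,2) assms(3)] .
  finally show ?thesis using g(3)[of 0] assms(3) by simp
qed

text \<open>The real part of the logarithm of \<open>E\<close> is \<open>ln (cmod E)\<close>, and
  \<open>deriv_bound_Re\<close> asks for nothing but the real part.\<close>

lemma zero_free_log_deriv_bound:
  assumes "E holomorphic_on UNIV" "\<And>z. cmod z \<le> r \<Longrightarrow> E z \<noteq> 0" "cmod w < r"
  shows "cmod (deriv E w / E w) \<le> 2 * r / (r - cmod w)^2 * circle_mean (\<lambda>z. \<bar>ln (cmod (E z))\<bar>) r"
proof -
  have r: "0 < r" using assms(3) norm_ge_zero[of w] by linarith
  obtain g where g: "continuous_on (cball 0 r) g" "g holomorphic_on ball 0 r"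
    "\<And>z. cmod z \<le> r \<Longrightarrow> Re (g z) = ln (cmod (E z))" "\<And>z. cmod z < r \<Longrightarrow> deriv g z = deriv E z / E z"
    using entire_log_on_cball[OF assms(1,2) r] by metis
  have "circle_mean (\<lambda>z. \<bar>ln (cmod (E z))\<bar>) r = circle_mean (\<lambda>z. \<bar>Re (g z)\<bar>) r"
    using g(3) r by (intro circle_mean_cong) auto
  then show ?thesis using deriv_bound_Re[OF g(1,2) assms(3)] g(4)[OF assms(3)] by simp
qed

lemma zero_free_log_diff_bound:
  assumes "E holomorphic_on UNIV" "\<And>z. cmod z \<le> r \<Longrightarrow> E z \<noteq> 0" "s < r" "cmod v \<le> s" "cmod w \<le> s"
  shows "ln (cmod (E v)) - ln (cmod (E w))
      \<le> 2 * r / (r - s)^2 * circle_mean (\<lambda>z. \<bar>ln (cmod (E z))\<bar>) r * cmod (v - w)"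
proof -
  have r: "0 < r" using assms(3,4) norm_ge_zero[of v] by linarith
  obtain g where g: "continuous_on (cball 0 r) g" "g holomorphic_on ball 0 r"
    "\<And>z. cmod z \<le> r \<Longrightarrow> Re (g z) = ln (cmod (E z))" "\<And>z. cmod z < r \<Longrightarrow> deriv g z = deriv E z / E z"
    using entire_log_on_cball[OF assms(1,2) r] by metis
  define m where "m = circle_mean (\<lambda>z. \<bar>ln (cmod (E z))\<bar>) r"
  have m: "m = circle_mean (\<lambda>z. \<bar>Re (g z)\<bar>) r"
    unfolding m_def using g(3) r by (intro circle_mean_cong) auto
  have m0: "0 \<le> m"
    unfolding m by (intro circle_mean_nonneg continuous_intros continuous_on_subset[OF g(1)]) (use r in auto)
  have "cmod (g v - g w) \<le> 2 * r / (r - s)^2 * m * cmod (v - w)"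
  proof (rule field_differentiable_bound[of "cball 0 s"])
    fix z :: complex assume z: "z \<in> cball 0 s"
    show "(g has_field_derivative deriv g z) (at z within cball 0 s)"
      using z assms(3) by (intro has_field_derivative_at_within[OF holomorphic_derivI[OF g(2)]]) auto
    have "cmod (deriv g z) \<le> 2 * r / (r - cmod z)^2 * m"
      unfolding m using z assms(3) by (intro deriv_bound_Re g) auto
    also have "\<dots> \<le> 2 * r / (r - s)^2 * m"
      using z assms(3) r m0 by (intro mult_right_mono divide_left_mono power_mono) (auto simp: zero_less_mult_iff)
    finally show "cmod (deriv g z) \<le> 2 * r / (r - s)^2 * m" .
  qed (use assms in auto)
  moreover have "Re (g v) - Re (g w) \<le> cmod (g v - g w)"
    using complex_Re_le_cmod[of "g v - g w"] by simp
  ultimately show ?thesis using g(3)[of v] g(3)[of w] assms by (simp add: m_def)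
qed

section \<open>Jensen's inequality\<close>

text \<open>The local cofactor at \<open>a\<close> and the quotient \<open>F z / (z - a) ^ n\<close>
  agree on the overlap of their domains, so they glue to an entire function. If
  \<open>F a \<noteq> 0\<close>, the exponent is 0.\<close>

lemma entire_factor_zero:
  fixes F :: "complex \<Rightarrow> complex"
  assumes F: "F holomorphic_on UNIV" and nz: "F b \<noteq> 0"
  obtains k h where "h holomorphic_on UNIV" "h a \<noteq> 0" "\<And>z. F z = (z - a) ^ k * h z"
proof (cases "F a = 0")
  case False
  then show ?thesis using that[of F 0] F by simp
next
  case True
  have nc: "\<not> F constant_on UNIV"
    using True nz by (metis UNIV_I constant_on_def)
  obtain g r n where g: "0 < r" "g holomorphic_on ball a r"
      "\<And>w. w \<in> ball a r \<Longrightarrow> F w = (w - a)^n * g w" "\<And>w. w \<in> ball a r \<Longrightarrow> g w \<noteq> 0"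
    using holomorphic_factor_zero_nonconstant[OF F open_UNIV connected_UNIV UNIV_I True nc] by metis
  define h where "h z = (if z \<in> ball a r then g z else F z / (z - a)^n)" for z
  have h: "h z = F z / (z - a)^n" if "z \<noteq> a" for z
    using that g(3)[of z] by (auto simp: h_def)
  have "h holomorphic_on ball a r"
    using g(2) by (rule holomorphic_transform) (auto simp: h_def)
  moreover have "(\<lambda>z. F z / (z - a)^n) holomorphic_on (- {a})"
    by (intro holomorphic_intros holomorphic_on_subset[OF F]) auto
  then have "h holomorphic_on (- {a})"
    by (rule holomorphic_transform) (auto simp: h)
  moreover have "ball a r \<union> - {a} = UNIV" using g(1) by auto
  ultimately have "h holomorphic_on UNIV"
    using holomorphic_on_Un[of h "ball a r" "- {a}"] by (simp add: open_Compl)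
  moreover have "h a \<noteq> 0" using g(1,4) by (auto simp: h_def)
  moreover have "F z = (z - a)^n * h z" for z
    using g(1) g(3)[of a] h[of z] by (cases "z = a") (auto simp: h_def)
  ultimately show ?thesis using that by blast
qed

text \<open>Induction on the finite set of zeros in the disc: splitting off the full power at one
  zero removes exactly that point. The list repeats each zero according to its multiplicity.\<close>

lemma entire_factor_cball:
  assumes "F holomorphic_on UNIV" "F b \<noteq> 0"
  shows "\<exists>as E. E holomorphic_on UNIV \<and> (\<forall>z. cmod z \<le> r \<longrightarrow> E z \<noteq> 0)
           \<and> (\<forall>a\<in>set as. cmod a \<le> r \<and> F a = 0) \<and> (\<forall>z. F z = (\<Prod>a\<leftarrow>as. z - a) * E z)"
proof -
  have "finite {z\<in>cball 0 r. F z = 0}"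
  proof (cases "F constant_on UNIV")
    case True
    then have "F z \<noteq> 0" for z using assms(2) by (metis UNIV_I constant_on_def)
    then show ?thesis by simp
  next
    case False
    then show ?thesis by (intro holomorphic_compact_finite_zeros[OF assms(1)]) auto
  qed
  then show ?thesis
    using assms
  proof (induction "{z\<in>cball 0 r. F z = 0}" arbitrary: F rule: finite_induct)
    case empty
    show ?case
      by (rule exI[of _ "[]"], rule exI[of _ F]) (use empty in auto)
  next
    case (insert x A F)
    obtain k h where h: "h holomorphic_on UNIV" "h x \<noteq> 0" "\<And>z. F z = (z - x) ^ k * h z"
      using entire_factor_zero[OF insert.prems] by metis
    have x: "cmod x \<le> r" "F x = 0" using insert.hyps(4) by auto
    then have k: "k \<noteq> 0" using h by (metis mult_1 power_0)
    have "{z\<in>cball 0 r. h z = 0} = {z\<in>cball 0 r. F z = 0} - {x}"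
      using h(2) by (auto simp: h(3))
    also have "\<dots> = A" using insert.hyps by auto
    finally have A: "A = {z\<in>cball 0 r. h z = 0}" by simp
    have "h b \<noteq> 0" using insert.prems(2) by (auto simp: h(3))
    from insert.hyps(3)[OF A h(1) this] obtain as E where E: "E holomorphic_on UNIV" "\<forall>z. cmod z \<le> r \<longrightarrow> E z \<noteq> 0"
      "\<forall>a\<in>set as. cmod a \<le> r \<and> h a = 0" "\<forall>z. h z = (\<Prod>a\<leftarrow>as. z - a) * E z"
      by blast
    have "F z = (\<Prod>a\<leftarrow>replicate k x @ as. z - a) * E z" for z
      using E(4) by (simp add: h(3) map_replicate prod_list_replicate)
    moreover have "\<forall>a\<in>set (replicate k x @ as). cmod a \<le> r \<and> F a = 0"
      using E(3) x k by (auto simp: h(3))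
    ultimately show ?case using E(1,2) by blast
  qed
qed

lemma continuous_on_ln_cmod:
  assumes "F holomorphic_on UNIV" "0 \<notin> F ` S"
  shows "continuous_on S (\<lambda>z. ln (cmod (F z)))"
  using assms by (intro continuous_intros continuous_on_subset[OF holomorphic_on_imp_continuous_on]) auto

lemma ln_cmod_prod_list:
  assumes "\<And>a. a \<in> set as \<Longrightarrow> f a \<noteq> 0"
  shows "ln (cmod (\<Prod>a\<leftarrow>as. f a :: complex)) = (\<Sum>a\<leftarrow>as. ln (cmod (f a)))"
  using assms
proof (induction as)
  case (Cons a as)
  then have "(\<Prod>a\<leftarrow>as. f a) \<noteq> 0" by (auto simp: prod_list_zero_iff)
  with Cons show ?case by (simp add: norm_mult ln_mult)
qed simp

text \<open>The reflected factor \<open>(r^2 - cnj a * z) / r\<close> has the same modulus as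
  \<open>z - a\<close> on the circle, no zero in the disc, and the value \<open>r\<close> at the
  centre.\<close>

lemma circle_mean_ln_dist:
  assumes "cmod a < r"
  shows "circle_mean (\<lambda>z. ln (cmod (z - a))) r = ln r"
proof -
  have r: "0 < r" using assms norm_ge_zero[of a] by linarith
  define E where "E z = (of_real (r^2) - cnj a * z) / of_real r" for z
  have ne: "E z \<noteq> 0" if "cmod z \<le> r" for z
  proof
    assume "E z = 0"
    then have "cmod (of_real (r^2)) = cmod (cnj a * z)" using r by (simp add: E_def)
    then have "r * r = cmod a * cmod z" by (simp add: norm_mult power2_eq_square)
    also have "\<dots> \<le> cmod a * r" using that by (intro mult_left_mono) auto
    also have "\<dots> < r * r" using assms r by simp
    finally show False by simp
  qed
  have "E holomorphic_on UNIV" unfolding E_def using r by (intro holomorphic_intros) auto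
  from circle_mean_ln_zero_free[OF this ne r]
  have "circle_mean (\<lambda>z. ln (cmod (E z))) r = ln r"
    using r by (simp add: E_def norm_divide norm_power power2_eq_square)
  moreover have "cmod (E z) = cmod (z - a)" if "cmod z = r" for z
  proof -
    have "of_real (r^2) = z * cnj z" using that complex_norm_square[of z] by simp
    then have "of_real (r^2) - cnj a * z = z * cnj (z - a)" by (simp add: algebra_simps)
    then have "cmod (of_real (r^2) - cnj a * z) = cmod z * cmod (z - a)"
      by (simp only: norm_mult complex_mod_cnj)
    then show ?thesis using that r by (simp add: E_def norm_divide)
  qed
  then have "circle_mean (\<lambda>z. ln (cmod (E z))) r = circle_mean (\<lambda>z. ln (cmod (z - a))) r"
    using r by (intro circle_mean_cong) auto
  ultimately show ?thesis by simp
qed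

lemma circle_mean_ln_factored:
  assumes E: "E holomorphic_on UNIV" "0 \<notin> E ` sphere 0 r"
    and a: "\<And>a. a \<in> set as \<Longrightarrow> cmod a < r" and r: "0 < r"
    and F: "\<And>z. F z = (\<Prod>a\<leftarrow>as. z - a) * E z"
  shows "circle_mean (\<lambda>z. ln (cmod (F z))) r = length as * ln r + circle_mean (\<lambda>z. ln (cmod (E z))) r"
proof -
  have cont: "continuous_on (sphere 0 r) (\<lambda>z. ln (cmod (z - a)))" if "a \<in> set as" for a
    using a[OF that] by (intro continuous_on_ln_cmod holomorphic_intros) auto
  have "circle_mean (\<lambda>z. ln (cmod (F z))) r = circle_mean (\<lambda>z. (\<Sum>a\<leftarrow>as. ln (cmod (z - a))) + ln (cmod (E z))) r"
  proof (rule circle_mean_cong)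
    fix z assume z: "cmod z = r"
    have "z - a \<noteq> 0" if "a \<in> set as" for a using a[OF that] z by auto
    then show "ln (cmod (F z)) = (\<Sum>a\<leftarrow>as. ln (cmod (z - a))) + ln (cmod (E z))"
      using E(2) z by (subst ln_cmod_prod_list[symmetric])
         (auto simp: F norm_mult ln_mult prod_list_zero_iff image_iff)
  qed (use r in auto)
  also have "\<dots> = (\<Sum>a\<leftarrow>as. ln r) + circle_mean (\<lambda>z. ln (cmod (E z))) r"
  proof -
    have "continuous_on (sphere 0 r) (\<lambda>z. \<Sum>a\<leftarrow>as. ln (cmod (z - a)))"
      using cont by (rule continuous_on_sum_list)
    moreover have "(\<Sum>a\<leftarrow>as. circle_mean (\<lambda>z. ln (cmod (z - a))) r) = (\<Sum>a\<leftarrow>as. ln r)"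
      using a by (intro arg_cong[of _ _ sum_list] map_cong) (auto simp: circle_mean_ln_dist)
    ultimately show ?thesis
      using cont r E by (simp add: circle_mean_add circle_mean_sum_list continuous_on_ln_cmod)
  qed
  finally show ?thesis by (simp add: sum_list_triv)
qed

lemma ln_cmod_factored_at_0:
  assumes F: "\<And>z. F z = (\<Prod>a\<leftarrow>as. z - a) * E z" and F0: "F 0 \<noteq> 0" and r: "0 < r"
    and a: "\<And>a. a \<in> set as \<Longrightarrow> cmod a \<le> r"
  shows "ln (cmod (F 0)) \<le> length as * ln r + ln (cmod (E 0))"
proof -
  have ne: "(\<Prod>a\<leftarrow>as. - a) \<noteq> 0" "E 0 \<noteq> 0" using F0 F[of 0] by auto
  then have a0: "a \<noteq> 0" if "a \<in> set as" for a using that by (auto simp: prod_list_zero_iff)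
  have "ln (cmod (F 0)) = (\<Sum>a\<leftarrow>as. ln (cmod (- a))) + ln (cmod (E 0))"
    using ne a0 by (subst ln_cmod_prod_list[symmetric]) (auto simp: F norm_mult ln_mult)
  also have "(\<Sum>a\<leftarrow>as. ln (cmod (- a))) \<le> (\<Sum>a\<leftarrow>as. ln r)"
    using a a0 r by (intro sum_list_mono) auto
  finally show ?thesis by (simp add: sum_list_triv)
qed

text \<open>Jensen's formula, in which every zero \<open>a\<close> contributes a nonnegative term
  \<open>ln (r / cmod a)\<close>; these terms are dropped.\<close>

lemma jensen_ineq:
  assumes F: "F holomorphic_on UNIV" "F 0 \<noteq> 0" "0 \<notin> F ` sphere 0 r" and r: "0 < r"
  shows "ln (cmod (F 0)) \<le> circle_mean (\<lambda>z. ln (cmod (F z))) r"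
proof -
  obtain as E where E: "E holomorphic_on UNIV" "\<And>z. cmod z \<le> r \<Longrightarrow> E z \<noteq> 0"
      "\<And>a. a\<in>set as \<Longrightarrow> cmod a \<le> r \<and> F a = 0" "\<And>z. F z = (\<Prod>a\<leftarrow>as. z - a) * E z"
    using entire_factor_cball[OF F(1,2), of r] by metis
  have a: "cmod a < r" if "a \<in> set as" for a
    using E(3)[OF that] F(3) by (cases "cmod a = r") (auto simp: image_iff)
  have "ln (cmod (F 0)) \<le> length as * ln r + ln (cmod (E 0))"
    using E(3) by (intro ln_cmod_factored_at_0[OF E(4) F(2) r]) auto
  also have "ln (cmod (E 0)) = circle_mean (\<lambda>z. ln (cmod (E z))) r"
    using circle_mean_ln_zero_free[OF E(1,2) r] by simp
  finally show ?thesis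
    using circle_mean_ln_factored[OF E(1) _ a r E(4)] E(2) by (auto simp: image_iff)
qed

text \<open>Removing the factor \<open>z ^ k\<close> admits functions that vanish at the centre; on
  the circle its logarithm is the constant \<open>k * ln r\<close>.\<close>

lemma jensen_lower_bound:
  assumes h: "h holomorphic_on UNIV" "h 0 \<noteq> 0" and F: "\<And>z. F z = z ^ k * h z"
    and r: "0 < r" "0 \<notin> F ` sphere 0 r"
  shows "k * ln r + ln (cmod (h 0)) \<le> circle_mean (\<lambda>z. ln (cmod (F z))) r"
proof -
  have h0: "0 \<notin> h ` sphere 0 r" using r by (auto simp: F image_iff)
  have "circle_mean (\<lambda>z. ln (cmod (F z))) r = circle_mean (\<lambda>z. k * ln r + ln (cmod (h z))) r"
    using r h0 by (intro circle_mean_cong) (auto simp: F norm_mult norm_power ln_mult ln_realpow image_iff)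
  also have "\<dots> = k * ln r + circle_mean (\<lambda>z. ln (cmod (h z))) r"
    using r h h0 by (subst circle_mean_add) (auto intro!: continuous_on_ln_cmod)
  finally show ?thesis using jensen_ineq[OF h h0 r(1)] by simp
qed

text \<open>Each listed zero adds \<open>ln (2 * r)\<close> to the mean but at most
  \<open>ln r\<close> to \<open>ln (cmod (F 0))\<close>, a gain of \<open>ln 2\<close>. Further
  zeros of \<open>E\<close> can only raise the mean, by Jensen's inequality for
  \<open>E\<close>.\<close>

lemma count_zeros_bound:
  assumes E: "E holomorphic_on UNIV" and F: "\<And>z. F z = (\<Prod>a\<leftarrow>as. z - a) * E z"
    and F0: "F 0 \<noteq> 0" "0 \<notin> F ` sphere 0 (2 * r)" and r: "0 < r"
    and a: "\<And>a. a \<in> set as \<Longrightarrow> cmod a \<le> r"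
  shows "length as * ln 2 \<le> circle_mean (\<lambda>z. ln (cmod (F z))) (2 * r) - ln (cmod (F 0))"
proof -
  have E0: "E 0 \<noteq> 0" "0 \<notin> E ` sphere 0 (2 * r)"
    using F0 by (auto simp: F image_iff)
  have "circle_mean (\<lambda>z. ln (cmod (F z))) (2 * r)
      = length as * ln (2 * r) + circle_mean (\<lambda>z. ln (cmod (E z))) (2 * r)"
    by (rule circle_mean_ln_factored[OF E E0(2) _ _ F]) (use a r in force)+
  then show ?thesis
    using jensen_ineq[OF E E0] ln_cmod_factored_at_0[OF F F0(1) r a] r
    by (simp add: ln_mult algebra_simps)
qed

section \<open>Square-root singularities on circles\<close>

lemma ln_le_sqrt: "0 \<le> x \<Longrightarrow> ln (1 + x) \<le> 2 * sqrt x"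
proof -
  assume "0 \<le> x"
  then have "1 + x \<le> (1 + sqrt x)^2" by (simp add: power2_eq_square algebra_simps)
  then have "ln (1 + x) \<le> ln ((1 + sqrt x)^2)" using \<open>0 \<le> x\<close> by (intro ln_mono) auto
  also have "\<dots> = 2 * ln (1 + sqrt x)" using \<open>0 \<le> x\<close> by (simp add: ln_realpow)
  also have "\<dots> \<le> 2 * sqrt x" using \<open>0 \<le> x\<close> ln_add_one_self_le_self[of "sqrt x"] by simp
  finally show ?thesis .
qed

text \<open>Poles \<open>1 / (z - a)\<close> have no uniformly bounded mean modulus on circles close
  to \<open>a\<close>, but their square roots do. Hence logarithms are estimated through square
  roots.\<close>

lemma log_plus_le_sqrt: "0 \<le> x \<Longrightarrow> log_plus x \<le> 2 * ln (1 + sqrt x)"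
proof -
  assume x: "0 \<le> x"
  then have "max 1 x \<le> (1 + sqrt x)^2" by (simp add: power2_eq_square algebra_simps)
  then have "ln (max 1 x) \<le> ln ((1 + sqrt x)^2)" by (intro ln_mono) auto
  moreover have "ln ((1 + sqrt x)^2) = 2 * ln (1 + sqrt x)" using x by (simp add: ln_realpow)
  ultimately show ?thesis using x by (simp add: log_plus_eq_ln_max)
qed

lemma sin_ge_half:
  assumes "0 \<le> x" "x \<le> pi / 2" shows "x / 2 \<le> sin x"
\<comment> \<open>Up to \<open>pi / 3\<close> the derivative \<open>cos x - 1 / 2\<close> is
  nonnegative; beyond it \<open>sin x \<ge> sqrt 3 / 2\<close> exceeds
  \<open>pi / 4 \<ge> x / 2\<close>.\<close>
proof (cases "x \<le> pi / 3")
  case True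
  have "cos (pi/3) \<le> cos y" if "0 \<le> y" "y \<le> x" for y
    using that True assms by (intro cos_monotone_0_pi_le) auto
  then have "sin 0 - 0/2 \<le> sin x - x/2"
    using assms by (intro DERIV_nonneg_imp_nondecreasing[of 0 x "\<lambda>x. sin x - x/2"])
      (auto intro!: exI derivative_eq_intros simp: cos_60)
  then show ?thesis by simp
next
  case False
  have "sin (pi/3) \<le> sin x"
    using False assms by (intro sin_monotone_2pi_le) auto
  moreover have "pi \<le> 16/5" using pi_approx(2) by simp
  moreover have "sqrt 3 \<ge> 17/10" by (rule real_le_rsqrt) (simp add: power2_eq_square)
  ultimately show ?thesis using assms(2) \<open>pi \<le> 16/5\<close> unfolding sin_60 by linarith
qed

text \<open>The value \<open>M\<close> at the singularity is arbitrary, so that the integrand can dominate a given function there.\<close>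

lemma has_integral_inverse_sqrt:
  fixes b M :: real
  shows "((\<lambda>x. if x = b then M else 1 / sqrt \<bar>x - b\<bar>) has_integral
      2 * sgn (2*pi - b) * sqrt \<bar>2*pi - b\<bar> - 2 * sgn (- b) * sqrt \<bar>b\<bar>) {0..2*pi}"
proof -
  have "((\<lambda>x. if x = b then M else 1 / sqrt \<bar>x - b\<bar>) has_integral
      2 * sgn (2*pi - b) * sqrt \<bar>2*pi - b\<bar> - 2 * sgn (0 - b) * sqrt \<bar>0 - b\<bar>) {0..2*pi}"
  proof (rule fundamental_theorem_of_calculus_strong[of "{b}"])
    have "isCont (\<lambda>x. 2 * (sgn (x - b) * sqrt \<bar>x - b\<bar>)) x" for x
    proof (cases "x = b")
      case True
      have "((\<lambda>x. sgn (x - b) * sqrt \<bar>x - b\<bar>) \<longlongrightarrow> 0) (at b)"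
      proof (rule Lim_null_comparison)
        show "eventually (\<lambda>x. norm (sgn (x - b) * sqrt \<bar>x - b\<bar>) \<le> sqrt \<bar>x - b\<bar>) (at b)"
          by (intro always_eventually) (auto simp: abs_mult sgn_if)
        show "((\<lambda>x. sqrt \<bar>x - b\<bar>) \<longlongrightarrow> 0) (at b)"
          by (auto intro!: tendsto_eq_intros)
      qed
      from tendsto_mult_left[OF this, of 2] show ?thesis using True by (simp add: isCont_def)
    next
      case False
      then show ?thesis by (intro continuous_intros) auto
    qed
    then show "continuous_on {0..2*pi} (\<lambda>x. 2 * sgn (x - b) * sqrt \<bar>x - b\<bar>)"
      by (simp add: continuous_at_imp_continuous_on mult.assoc)
    fix x assume "x \<in> {0..2*pi} - {b}"
    then have "x \<noteq> b" by simp
    then consider "x > b" | "x < b" by linarith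
    then have "((\<lambda>x. 2 * sgn (x - b) * sqrt \<bar>x - b\<bar>) has_real_derivative 1 / sqrt \<bar>x - b\<bar>) (at x)"
    proof cases
      case 1
      have "((\<lambda>x. 2 * sqrt (x - b)) has_real_derivative 1 / sqrt (x - b)) (at x)"
        using 1 by (auto intro!: derivative_eq_intros simp: field_simps)
      moreover have "eventually (\<lambda>x. 2 * sqrt (x - b) = 2 * sgn (x - b) * sqrt \<bar>x - b\<bar>) (nhds x)"
        using 1 by (intro eventually_mono[OF eventually_nhds_in_open[of "{b<..}"]]) auto
      ultimately have "((\<lambda>x. 2 * sgn (x - b) * sqrt \<bar>x - b\<bar>) has_real_derivative 1 / sqrt (x - b)) (at x)"
        by (rule DERIV_cong_ev[OF refl _ refl, THEN iffD1, rotated])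
      then show ?thesis using 1 by simp
    next
      case 2
      have "((\<lambda>x. - 2 * sqrt (b - x)) has_real_derivative 1 / sqrt (b - x)) (at x)"
        using 2 by (auto intro!: derivative_eq_intros simp: field_simps)
      moreover have "eventually (\<lambda>x. - 2 * sqrt (b - x) = 2 * sgn (x - b) * sqrt \<bar>x - b\<bar>) (nhds x)"
        using 2 by (intro eventually_mono[OF eventually_nhds_in_open[of "{..<b}"]]) auto
      ultimately have "((\<lambda>x. 2 * sgn (x - b) * sqrt \<bar>x - b\<bar>) has_real_derivative 1 / sqrt (b - x)) (at x)"
        by (rule DERIV_cong_ev[OF refl _ refl, THEN iffD1, rotated])
      then show ?thesis using 2 by simp
    qed
    then show "((\<lambda>x. 2 * sgn (x - b) * sqrt \<bar>x - b\<bar>) has_vector_derivative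
        (if x = b then M else 1 / sqrt \<bar>x - b\<bar>)) (at x)"
      using \<open>x \<noteq> b\<close> by (simp add: has_real_derivative_iff_has_vector_derivative)
  qed auto
  then show ?thesis by simp
qed

text \<open>The chord is \<open>2 * \<bar>sin (x / 2)\<bar>\<close>, bounded below for
  \<open>\<bar>x\<bar> \<le> pi\<close>. A difference of two angles from one full turn comes into
  that range after subtracting one of three multiples of \<open>2 * pi\<close>.\<close>

lemma cis_chord_ge:
  assumes "\<bar>x\<bar> \<le> 2 * pi"
  obtains k where "k \<in> {-1, 0, 1::real}" "\<bar>x - 2 * pi * k\<bar> / 2 \<le> cmod (cis x - 1)"
proof -
  have chord: "\<bar>y\<bar> / 2 \<le> cmod (cis y - 1)" if "\<bar>y\<bar> \<le> pi" for y
  proof -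
    have "\<bar>y / 2\<bar> / 2 \<le> sin \<bar>y / 2\<bar>" using that by (intro sin_ge_half) auto
    also have "\<dots> \<le> \<bar>sin (y / 2)\<bar>" by (simp add: abs_if)
    finally show ?thesis using dist_exp_i_1[of y] by (simp add: cis_conv_exp)
  qed
  consider "\<bar>x\<bar> \<le> pi" | "x > pi" | "x < - pi" by linarith
  then show ?thesis
  proof cases
    case 1 then show ?thesis using that[of 0] chord[of x] by simp
  next
    case 2
    have "cis (x - 2 * pi) = cis x" by (simp add: cis_divide[symmetric])
    then show ?thesis using that[of 1] chord[of "x - 2 * pi"] 2 assms by simp
  next
    case 3
    have "cis (x + 2 * pi) = cis x" by (simp add: cis_mult[symmetric])
    then show ?thesis using that[of "-1"] chord[of "x + 2 * pi"] 3 assms by simp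
  qed
qed

text \<open>Moving the second point radially to the first circle costs
  \<open>\<bar>s - r\<bar>\<close>, which is itself at most the distance on the right. This doubling
  accounts for the factor 1/2.\<close>

lemma dist_circle_ge:
  fixes \<theta> \<alpha> s r :: real
  assumes "0 \<le> r" "0 \<le> s"
  shows "r / 2 * cmod (cis (\<theta> - \<alpha>) - 1) \<le> cmod (of_real r * cis \<theta> - of_real s * cis \<alpha>)"
proof -
  let ?d = "cmod (of_real r * cis \<theta> - of_real s * cis \<alpha>)"
  have "cis (\<theta> - \<alpha>) - 1 = (cis \<theta> - cis \<alpha>) * cis (- \<alpha>)"
    by (simp add: algebra_simps cis_mult)
  then have "r * cmod (cis (\<theta> - \<alpha>) - 1) = cmod (of_real r * cis \<theta> - of_real r * cis \<alpha>)"
    using assms by (simp add: norm_mult flip: right_diff_distrib)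
  also have "\<dots> \<le> ?d + cmod (of_real s * cis \<alpha> - of_real r * cis \<alpha>)"
    using norm_triangle_ineq[of "of_real r * cis \<theta> - of_real s * cis \<alpha>" "of_real s * cis \<alpha> - of_real r * cis \<alpha>"] by simp
  also have "cmod (of_real s * cis \<alpha> - of_real r * cis \<alpha>) = \<bar>s - r\<bar>"
    by (simp add: norm_mult flip: left_diff_distrib of_real_diff)
  also have "\<bar>s - r\<bar> \<le> ?d"
    using norm_triangle_ineq3[of "of_real r * cis \<theta>" "of_real s * cis \<alpha>"] assms by (simp add: norm_mult)
  finally show ?thesis by simp
qed

text \<open>Three singularities, one for each translate of the argument of \<open>a\<close>, each
  with integral at most \<open>4 * sqrt (4 * pi)\<close>.\<close>

definition inv_sqrt_const :: real where
  "inv_sqrt_const = 12 * sqrt (4 * pi)"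

text \<open>The bound is uniform in the distance of \<open>a\<close> from the circle, because
  \<open>1 / sqrt \<bar>x\<bar>\<close> is integrable across its singularity.\<close>

lemma circle_mean_inverse_sqrt_dist:
  assumes r: "0 < r" and a: "cmod a \<noteq> r"
  shows "circle_mean (\<lambda>z. 1 / sqrt (cmod (z - a))) r \<le> inv_sqrt_const / sqrt r"
proof -
  define \<alpha> where "\<alpha> = Arg2pi a"
  have \<alpha>: "0 \<le> \<alpha>" "\<alpha> < 2 * pi" "a = of_real (cmod a) * cis \<alpha>"
    using Arg2pi[of a] by (auto simp: \<alpha>_def is_Arg_def cis_conv_exp)
  \<comment> \<open>At the angle of \<open>a\<close> the distance is still at least
    \<open>\<bar>r - cmod a\<bar>\<close>; the factor \<open>sqrt r / 2\<close> cancels the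
    prefactor \<open>2 / sqrt r\<close> of the majorant.\<close>
  define M where "M = sqrt r / (2 * sqrt \<bar>r - cmod a\<bar>)"
  define u where "u k x = (if x = \<alpha> + 2 * pi * k then M else 1 / sqrt \<bar>x - (\<alpha> + 2 * pi * k)\<bar>)" for k x :: real
  define I where "I b = 2 * sgn (2*pi - b) * sqrt \<bar>2*pi - b\<bar> - 2 * sgn (- b) * sqrt \<bar>b\<bar>" for b :: real
  have M0: "0 \<le> M" using r by (simp add: M_def)
  have u0: "0 \<le> u k x" for k x using M0 by (simp add: u_def)
  have u_int: "(u k has_integral I (\<alpha> + 2 * pi * k)) {0..2*pi}" for k
    unfolding u_def I_def by (rule has_integral_inverse_sqrt)
  have I: "I b \<le> 4 * sqrt (4 * pi)" if "\<bar>b\<bar> \<le> 4 * pi" "\<bar>2*pi - b\<bar> \<le> 4 * pi" for b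
  proof -
    have "sgn x * sqrt \<bar>x\<bar> \<le> sqrt \<bar>x\<bar>" for x :: real
      using real_sqrt_ge_zero[of "\<bar>x\<bar>"] by (auto simp: sgn_if)
    from order_trans[OF this real_sqrt_le_mono[OF that(1)]] order_trans[OF this real_sqrt_le_mono[OF that(2)]]
    have "sgn (2*pi - b) * sqrt \<bar>2*pi - b\<bar> \<le> sqrt (4 * pi)" "- sgn (- b) * sqrt \<bar>b\<bar> \<le> sqrt (4 * pi)"
      by (simp_all add: sgn_minus)
    then show ?thesis by (simp add: I_def)
  qed
  have bound: "1 / sqrt (cmod (of_real r * cis \<theta> - a)) \<le> 2 / sqrt r * (u (-1) \<theta> + u 0 \<theta> + u 1 \<theta>)"
    if \<theta>: "\<theta> \<in> {0..2*pi}" for \<theta>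
  proof -
    let ?d = "cmod (of_real r * cis \<theta> - a)"
    have dpos: "\<bar>r - cmod a\<bar> \<le> ?d"
      using norm_triangle_ineq3[of "of_real r * cis \<theta>" a] r by (simp add: norm_mult)
    have rpos: "0 < \<bar>r - cmod a\<bar>" using a by simp
    obtain k where k: "k \<in> {-1, 0, 1::real}" "\<bar>(\<theta> - \<alpha>) - 2 * pi * k\<bar> / 2 \<le> cmod (cis (\<theta> - \<alpha>) - 1)"
      using cis_chord_ge[of "\<theta> - \<alpha>"] \<alpha> \<theta> by (auto simp: abs_le_iff)
    have "1 / sqrt ?d \<le> 2 / sqrt r * u k \<theta>"
    proof (cases "\<theta> = \<alpha> + 2 * pi * k")
      case True
      have "1 / sqrt ?d \<le> 1 / sqrt \<bar>r - cmod a\<bar>"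
        using dpos rpos by (intro divide_left_mono real_sqrt_le_mono mult_pos_pos real_sqrt_gt_zero) linarith+
      then show ?thesis using True r by (simp add: u_def M_def)
    next
      case False
      let ?x = "\<bar>\<theta> - (\<alpha> + 2 * pi * k)\<bar>"
      have "r / 4 * ?x \<le> r / 2 * cmod (cis (\<theta> - \<alpha>) - 1)"
        using k(2) r mult_left_mono[OF k(2), of "r / 2"] by (simp add: algebra_simps)
      also have "\<dots> \<le> ?d"
        by (subst \<alpha>(3)) (use dist_circle_ge[of r "cmod a" \<theta> \<alpha>] r in simp)
      finally have "sqrt (r / 4 * ?x) \<le> sqrt ?d" by simp
      moreover have "0 < sqrt (r / 4 * ?x)" using r False by simp
      ultimately have "1 / sqrt ?d \<le> 1 / sqrt (r / 4 * ?x)"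
        by (intro divide_left_mono mult_pos_pos) linarith+
      also have "\<dots> = 2 / sqrt r * u k \<theta>"
        using False by (simp add: u_def real_sqrt_mult real_sqrt_divide)
      finally show ?thesis .
    qed
    also have "\<dots> \<le> 2 / sqrt r * (u (-1) \<theta> + u 0 \<theta> + u 1 \<theta>)"
      using k(1) u0[of "-1" \<theta>] u0[of 0 \<theta>] u0[of 1 \<theta>] r by (intro mult_left_mono) auto
    finally show ?thesis .
  qed
  have "integral {0..2*pi} (\<lambda>\<theta>. 1 / sqrt (cmod (of_real r * cis \<theta> - a)))
      \<le> 2 / sqrt r * (I (\<alpha> + 2 * pi * (-1)) + I (\<alpha> + 2 * pi * 0) + I (\<alpha> + 2 * pi * 1))"
  proof (rule has_integral_le)
    have "continuous_on (sphere 0 r) (\<lambda>z. 1 / sqrt (cmod (z - a)))"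
      using a by (intro continuous_intros) auto
    from circle_integrable[OF this] r
    show "((\<lambda>\<theta>. 1 / sqrt (cmod (of_real r * cis \<theta> - a))) has_integral
        integral {0..2*pi} (\<lambda>\<theta>. 1 / sqrt (cmod (of_real r * cis \<theta> - a)))) {0..2*pi}"
      by (simp add: integrable_integral)
    show "((\<lambda>\<theta>. 2 / sqrt r * (u (-1) \<theta> + u 0 \<theta> + u 1 \<theta>)) has_integral
        2 / sqrt r * (I (\<alpha> + 2 * pi * (-1)) + I (\<alpha> + 2 * pi * 0) + I (\<alpha> + 2 * pi * 1))) {0..2*pi}"
      by (intro has_integral_mult_right has_integral_add u_int)
  qed (use bound in auto)
  also have "\<dots> \<le> 2 / sqrt r * (4 * sqrt (4 * pi) + 4 * sqrt (4 * pi) + 4 * sqrt (4 * pi))"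
    using \<alpha> r by (intro mult_left_mono add_mono I) auto
  also have "\<dots> = 2 * inv_sqrt_const / sqrt r" by (simp add: inv_sqrt_const_def)
  finally have "circle_mean (\<lambda>z. 1 / sqrt (cmod (z - a))) r \<le> (2 * inv_sqrt_const / sqrt r) / (2 * pi)"
    unfolding circle_mean_def by (intro divide_right_mono) auto
  also have "\<dots> \<le> (2 * inv_sqrt_const / sqrt r) / 2"
    using pi_gt3 r by (intro divide_left_mono) (auto simp: inv_sqrt_const_def)
  finally show ?thesis by simp
qed

section \<open>Logarithmic derivatives and shifts\<close>

lemma nev_char_nonneg:
  assumes "continuous_on (sphere 0 r) f" "0 \<le> r"
  shows "0 \<le> nev_char f r"
  unfolding nev_char_eq using assms by (intro circle_mean_nonneg continuous_intros) auto

lemma circle_mean_ln_le_nev_char: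
  assumes "F holomorphic_on UNIV" "0 \<notin> F ` sphere 0 r" "0 \<le> r"
  shows "circle_mean (\<lambda>z. ln (cmod (F z))) r \<le> nev_char F r"
  unfolding nev_char_eq using assms
  by (intro circle_mean_mono continuous_intros continuous_on_ln_cmod ln_le_log_plus
      continuous_on_subset[OF holomorphic_on_imp_continuous_on]) auto

lemma abs_ln_eq: "\<bar>ln x\<bar> = 2 * log_plus x - ln x"
  by (simp add: log_plus_def)

text \<open>Writing \<open>\<bar>ln x\<bar>\<close> as \<open>2 * log_plus x - ln x\<close> leaves a
  logarithm whose mean is known exactly; the scaled distance is at most 2.\<close>

lemma circle_mean_abs_ln_dist:
  assumes "cmod a < r"
  shows "circle_mean (\<lambda>z. \<bar>ln (cmod ((z - a) / of_real r))\<bar>) r \<le> 2 * ln 2"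
proof -
  have r: "0 < r" using assms norm_ge_zero[of a] by linarith
  have ne: "0 \<notin> (\<lambda>z. (z - a) / of_real r) ` sphere 0 r" using assms r by auto
  have "circle_mean (\<lambda>z. \<bar>ln (cmod ((z - a) / of_real r))\<bar>) r
      \<le> circle_mean (\<lambda>z. (2 * ln 2 + ln r) - ln (cmod (z - a))) r"
  proof (rule circle_mean_mono)
    fix z assume z: "cmod z = r"
    have "cmod (z - a) \<le> 2 * r" using norm_triangle_ineq4[of z a] z assms by simp
    then have "log_plus (cmod ((z - a) / of_real r)) \<le> log_plus 2"
      using r by (intro log_plus_mono) (auto simp: norm_divide divide_le_eq)
    then have "log_plus (cmod ((z - a) / of_real r)) \<le> ln 2" by (simp add: log_plus_eq_ln_max)
    moreover have "z \<noteq> a" using z assms by auto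
    then have "ln (cmod ((z - a) / of_real r)) = ln (cmod (z - a)) - ln r"
      using r by (simp add: norm_divide ln_div)
    ultimately show "\<bar>ln (cmod ((z - a) / of_real r))\<bar> \<le> (2 * ln 2 + ln r) - ln (cmod (z - a))"
      using abs_ln_eq[of "cmod ((z - a) / of_real r)"] by linarith
  qed (use r assms ne in \<open>auto intro!: continuous_intros continuous_on_ln_cmod holomorphic_intros\<close>)
  also have "\<dots> = 2 * ln 2"
    using assms r by (subst circle_mean_diff)
      (auto simp: circle_mean_ln_dist intro!: continuous_intros continuous_on_ln_cmod holomorphic_intros)
  finally show ?thesis .
qed

text \<open>Dividing each linear factor by \<open>r\<close> keeps the mean of its absolute logarithm
  at most \<open>2 * ln 2\<close>, so \<open>E\<close> inherits a bound linear in the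
  characteristics. Of the three copies of \<open>\<bar>ln (cmod (F 0))\<bar>\<close>, two come from
  counting the zeros and one from Jensen's inequality.\<close>

lemma entire_zero_free_part:
  assumes F: "F holomorphic_on UNIV" "F 0 \<noteq> 0" and r: "0 < r"
    and nz: "0 \<notin> F ` sphere 0 r" "0 \<notin> F ` sphere 0 (2 * r)"
  obtains as E where "E holomorphic_on UNIV" "\<And>z. cmod z \<le> r \<Longrightarrow> E z \<noteq> 0"
    "\<And>a. a \<in> set as \<Longrightarrow> cmod a < r" "\<And>z. F z = (\<Prod>a\<leftarrow>as. (z - a) / of_real r) * E z"
    "length as * ln 2 \<le> nev_char F (2 * r) + \<bar>ln (cmod (F 0))\<bar>"
    "circle_mean (\<lambda>z. \<bar>ln (cmod (E z))\<bar>) r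
       \<le> 2 * nev_char F r + 2 * nev_char F (2 * r) + 3 * \<bar>ln (cmod (F 0))\<bar>"
proof -
  let ?c = "\<bar>ln (cmod (F 0))\<bar>"
  obtain as E where E: "E holomorphic_on UNIV" "\<And>z. cmod z \<le> r \<Longrightarrow> E z \<noteq> 0"
      "\<And>a. a\<in>set as \<Longrightarrow> cmod a \<le> r \<and> F a = 0" "\<And>z. F z = (\<Prod>a\<leftarrow>as. z - a) * E z"
    using entire_factor_cball[OF F, of r] by metis
  have a: "cmod a < r" if "a \<in> set as" for a
    using E(3)[OF that] nz(1) by (cases "cmod a = r") (auto simp: image_iff)
  have "length as * ln 2 \<le> circle_mean (\<lambda>z. ln (cmod (F z))) (2 * r) - ln (cmod (F 0))"
    using E(3) by (intro count_zeros_bound[OF E(1,4) F(2) nz(2) r]) auto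
  also have "circle_mean (\<lambda>z. ln (cmod (F z))) (2 * r) \<le> nev_char F (2 * r)"
    using r by (intro circle_mean_ln_le_nev_char F nz) auto
  finally have n: "length as * ln 2 \<le> nev_char F (2 * r) + ?c" by simp
  define E' where "E' z = of_real r ^ length as * E z" for z
  have hol: "E' holomorphic_on UNIV" unfolding E'_def by (intro holomorphic_intros E)
  have ne: "E' z \<noteq> 0" if "cmod z \<le> r" for z using E(2)[OF that] r by (simp add: E'_def)
  have prod: "(\<Prod>a\<leftarrow>as. (z - a) / of_real r) * of_real r ^ length as = (\<Prod>a\<leftarrow>as. z - a)" for z
    using r by (induction as) auto
  have F': "F z = (\<Prod>a\<leftarrow>as. (z - a) / of_real r) * E' z" for z
    using prod[of z] by (simp add: E(4) E'_def mult.assoc[symmetric])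
  have contF: "continuous_on S F" for S
    using F(1) holomorphic_on_imp_continuous_on continuous_on_subset by blast
  have cont: "continuous_on (sphere 0 r) (\<lambda>z. \<bar>ln (cmod ((z - a) / of_real r))\<bar>)" if "a \<in> set as" for a
    using a[OF that] r by (intro continuous_intros continuous_on_ln_cmod holomorphic_intros) auto
  have contlnF: "continuous_on (sphere 0 r) (\<lambda>z. ln (cmod (F z)))"
    using F nz by (intro continuous_on_ln_cmod)
  have "circle_mean (\<lambda>z. \<bar>ln (cmod (E' z))\<bar>) r
      \<le> circle_mean (\<lambda>z. (2 * log_plus (cmod (F z)) - ln (cmod (F z))) + (\<Sum>a\<leftarrow>as. \<bar>ln (cmod ((z - a) / of_real r))\<bar>)) r"
  proof (rule circle_mean_mono)
    fix z assume z: "cmod z = r"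
    have za: "(z - a) / of_real r \<noteq> 0" if "a \<in> set as" for a using a[OF that] z r by auto
    then have "(\<Prod>a\<leftarrow>as. (z - a) / of_real r) \<noteq> 0" by (auto simp: prod_list_zero_iff)
    then have "ln (cmod (F z)) = ln (cmod (\<Prod>a\<leftarrow>as. (z - a) / of_real r)) + ln (cmod (E' z))"
      using ne[of z] z by (simp add: F' norm_mult ln_mult)
    also have "ln (cmod (\<Prod>a\<leftarrow>as. (z - a) / of_real r)) = (\<Sum>a\<leftarrow>as. ln (cmod ((z - a) / of_real r)))"
      using za by (rule ln_cmod_prod_list)
    finally have "\<bar>ln (cmod (E' z))\<bar> \<le> \<bar>ln (cmod (F z))\<bar> + \<bar>\<Sum>a\<leftarrow>as. ln (cmod ((z - a) / of_real r))\<bar>"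
      by linarith
    also have "\<bar>\<Sum>a\<leftarrow>as. ln (cmod ((z - a) / of_real r))\<bar> \<le> (\<Sum>a\<leftarrow>as. \<bar>ln (cmod ((z - a) / of_real r))\<bar>)"
      using sum_list_abs[of "map (\<lambda>a. ln (cmod ((z - a) / of_real r))) as"] by (simp add: o_def)
    finally show "\<bar>ln (cmod (E' z))\<bar> \<le> (2 * log_plus (cmod (F z)) - ln (cmod (F z))) + (\<Sum>a\<leftarrow>as. \<bar>ln (cmod ((z - a) / of_real r))\<bar>)"
      by (simp add: abs_ln_eq)
  next
    show "continuous_on (sphere 0 r) (\<lambda>z. \<bar>ln (cmod (E' z))\<bar>)"
      using ne hol by (intro continuous_intros continuous_on_ln_cmod) force+
    show "continuous_on (sphere 0 r) (\<lambda>z. 2 * log_plus (cmod (F z)) - ln (cmod (F z)) + (\<Sum>a\<leftarrow>as. \<bar>ln (cmod ((z - a) / of_real r))\<bar>))"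
      by (intro continuous_on_add continuous_on_diff continuous_on_mult continuous_on_const
          continuous_on_log_plus continuous_on_sum_list contF contlnF cont)
  qed (use r in auto)
  also have "\<dots> = 2 * nev_char F r - circle_mean (\<lambda>z. ln (cmod (F z))) r
      + (\<Sum>a\<leftarrow>as. circle_mean (\<lambda>z. \<bar>ln (cmod ((z - a) / of_real r))\<bar>) r)"
    using cont contlnF r
    by (simp add: circle_mean_add circle_mean_diff circle_mean_sum_list nev_char_eq
        continuous_on_diff continuous_on_mult continuous_on_log_plus contF continuous_on_sum_list)
  finally have E'_le: "circle_mean (\<lambda>z. \<bar>ln (cmod (E' z))\<bar>) r \<le> \<dots>" .
  have "(\<Sum>a\<leftarrow>as. circle_mean (\<lambda>z. \<bar>ln (cmod ((z - a) / of_real r))\<bar>) r) \<le> (\<Sum>a\<leftarrow>as. 2 * ln 2)"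
    using a by (intro sum_list_mono circle_mean_abs_ln_dist)
  also have "\<dots> = 2 * (length as * ln 2)" by (simp add: sum_list_triv)
  also have "2 * (length as * ln 2) \<le> 2 * (nev_char F (2 * r) + ?c)" by (rule mult_left_mono[OF n]) simp
  finally have sum_le: "(\<Sum>a\<leftarrow>as. circle_mean (\<lambda>z. \<bar>ln (cmod ((z - a) / of_real r))\<bar>) r)
      \<le> 2 * (nev_char F (2 * r) + ?c)" .
  have "circle_mean (\<lambda>z. \<bar>ln (cmod (E' z))\<bar>) r
       \<le> 2 * nev_char F r + 2 * nev_char F (2 * r) + 3 * ?c"
  proof -
    have *: "x \<le> s + 2 * t + 3 * c" if "q \<le> 2 * (t + c)" "x \<le> s - m + q" "l \<le> m" "- c \<le> l"
      for x s m q t c l :: real using that by simp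
    show ?thesis by (rule *[OF sum_le E'_le jensen_ineq[OF F nz(1) r]]) simp
  qed
  then show ?thesis using that[OF hol ne a F' n] by blast
qed

text \<open>Concavity of the logarithm, through its tangent at the mean \<open>m\<close>.\<close>

lemma circle_mean_ln_one_plus:
  assumes y: "continuous_on (sphere 0 r) y" "\<And>z. cmod z = r \<Longrightarrow> 0 \<le> y z" and r: "0 \<le> r"
  shows "circle_mean (\<lambda>z. ln (1 + y z)) r \<le> ln (1 + circle_mean y r)"
proof -
  define m where "m = circle_mean y r"
  have m: "0 \<le> m" unfolding m_def using assms by (intro circle_mean_nonneg) auto
  have pos: "1 + y z > 0" if "cmod z = r" for z using y(2)[OF that] by linarith
  have "circle_mean (\<lambda>z. ln (1 + y z)) r \<le> circle_mean (\<lambda>z. (ln (1 + m) - m / (1 + m)) + 1 / (1 + m) * y z) r"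
  proof (rule circle_mean_mono)
    show "continuous_on (sphere 0 r) (\<lambda>z. ln (1 + y z))"
      using pos by (intro continuous_intros y) force
    show "continuous_on (sphere 0 r) (\<lambda>z. ln (1 + m) - m / (1 + m) + 1 / (1 + m) * y z)"
      using m by (intro continuous_intros y) auto
    fix z assume z: "cmod z = r"
    have "ln ((1 + y z) / (1 + m)) \<le> (1 + y z) / (1 + m) - 1"
      using pos[OF z] m by (intro ln_le_minus_one) auto
    moreover have "ln ((1 + y z) / (1 + m)) = ln (1 + y z) - ln (1 + m)"
      using pos[OF z] m by (simp add: ln_div)
    moreover have "(1 + y z) / (1 + m) - 1 = 1 / (1 + m) * y z - m / (1 + m)"
      using m by (simp add: divide_simps)
    ultimately show "ln (1 + y z) \<le> (ln (1 + m) - m / (1 + m)) + 1 / (1 + m) * y z"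
      by linarith
  qed (use r in auto)
  also have "\<dots> = (ln (1 + m) - m / (1 + m)) + 1 / (1 + m) * m"
    using y r by (simp add: circle_mean_add circle_mean_cmult continuous_on_mult continuous_on_const flip: m_def del: times_divide_eq_left)
  finally show ?thesis by (simp add: m_def)
qed

lemma log_deriv_factored:
  assumes E: "E holomorphic_on UNIV" and F: "\<And>z. F z = (\<Prod>a\<leftarrow>as. (z - a) / of_real r) * E z"
    and r: "r \<noteq> 0" and nz: "F z \<noteq> 0"
  shows "deriv F z / F z = (\<Sum>a\<leftarrow>as. 1 / (z - a)) + deriv E z / E z"
  using F nz
proof (induction as arbitrary: F)
  case Nil
  then have "F = E" by auto
  then show ?case by simp
next
  case (Cons a as)
  define G where "G z = (\<Prod>a\<leftarrow>as. (z - a) / of_real r) * E z" for z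
  have FG: "F = (\<lambda>z. (z - a) / of_real r * G z)" by (auto simp: Cons.prems(1) G_def mult_ac)
  have ne: "z \<noteq> a" "G z \<noteq> 0" using Cons.prems(2) by (auto simp: FG)
  have "G holomorphic_on UNIV"
    unfolding G_def using E r by (induction as) (auto intro!: holomorphic_intros simp: mult.assoc)
  then have "(G has_field_derivative deriv G z) (at z)"
    by (rule holomorphic_derivI) auto
  then have "(F has_field_derivative ((z - a) / of_real r * deriv G z + G z / of_real r)) (at z)"
    unfolding FG using r by (auto intro!: derivative_eq_intros simp: field_simps)
  then have "deriv F z / F z = 1 / (z - a) + deriv G z / G z"
    using ne r by (simp add: DERIV_imp_deriv FG field_simps)
  also have "deriv G z / G z = (\<Sum>a\<leftarrow>as. 1 / (z - a)) + deriv E z / E z"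
    using ne by (intro Cons.IH) (auto simp: G_def)
  finally show ?case by simp
qed

lemma sqrt_norm_sum_list_le:
  "sqrt (cmod (\<Sum>a\<leftarrow>as. f a)) \<le> (\<Sum>a\<leftarrow>as. sqrt (cmod (f a)))"
proof (induction as)
  case (Cons a as)
  have "sqrt (cmod (\<Sum>a\<leftarrow>a # as. f a)) \<le> sqrt (cmod (f a) + cmod (\<Sum>a\<leftarrow>as. f a))"
    by (simp add: norm_triangle_ineq)
  also have "\<dots> \<le> sqrt (cmod (f a)) + sqrt (cmod (\<Sum>a\<leftarrow>as. f a))"
    by (intro sqrt_add_le_add_sqrt) auto
  finally show ?case using Cons by simp
qed simp

lemma circle_mean_sum_inverse_sqrt:
  assumes "\<And>a. a \<in> set as \<Longrightarrow> cmod a \<noteq> r" "0 < r"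
  shows "circle_mean (\<lambda>z. \<Sum>a\<leftarrow>as. 1 / sqrt (cmod (z - a))) r \<le> length as * inv_sqrt_const / sqrt r"
    and "continuous_on (sphere 0 r) (\<lambda>z. \<Sum>a\<leftarrow>as. 1 / sqrt (cmod (z - a)))"
proof -
  have cont: "continuous_on (sphere 0 r) (\<lambda>z. 1 / sqrt (cmod (z - a)))" if "a \<in> set as" for a
    using assms(1)[OF that] by (intro continuous_intros) auto
  then show "continuous_on (sphere 0 r) (\<lambda>z. \<Sum>a\<leftarrow>as. 1 / sqrt (cmod (z - a)))"
    by (rule continuous_on_sum_list)
  have "circle_mean (\<lambda>z. \<Sum>a\<leftarrow>as. 1 / sqrt (cmod (z - a))) r = (\<Sum>a\<leftarrow>as. circle_mean (\<lambda>z. 1 / sqrt (cmod (z - a))) r)"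
    using cont assms(2) by (intro circle_mean_sum_list) auto
  also have "\<dots> \<le> (\<Sum>a\<leftarrow>as. inv_sqrt_const / sqrt r)"
    using assms by (intro sum_list_mono circle_mean_inverse_sqrt_dist)
  finally show "circle_mean (\<lambda>z. \<Sum>a\<leftarrow>as. 1 / sqrt (cmod (z - a))) r \<le> length as * inv_sqrt_const / sqrt r"
    by (simp add: sum_list_triv)
qed

lemma inv_sqrt_const_nonneg: "0 \<le> inv_sqrt_const"
  by (simp add: inv_sqrt_const_def)

lemma continuous_on_entire:
  "F holomorphic_on UNIV \<Longrightarrow> continuous_on S F"
  using holomorphic_on_imp_continuous_on continuous_on_subset by blast

lemma continuous_on_entire_deriv:
  "F holomorphic_on UNIV \<Longrightarrow> continuous_on S (deriv F)"
  using continuous_on_entire[OF holomorphic_deriv[of F UNIV]] by simp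

lemma entire_shift:
  "F holomorphic_on UNIV \<Longrightarrow> (\<lambda>z. F (z + \<eta>)) holomorphic_on UNIV"
  using holomorphic_on_compose_gen[OF holomorphic_on_add[OF holomorphic_on_ident holomorphic_on_const], of F UNIV]
  by (simp add: o_def)

text \<open>The decomposition is made on the disc of radius \<open>2 * r\<close>, so that the circle
  of radius \<open>r\<close> and its small shifts keep away from the boundary; counting the zeros of
  that disc brings in \<open>4 * r\<close>. One constant serves all radii.\<close>

lemma entire_zero_free_part_uniform:
  assumes F: "F holomorphic_on UNIV" "F 0 \<noteq> 0"
  obtains C where "0 \<le> C" "\<And>r. 1 \<le> r \<Longrightarrow> 0 \<notin> F ` (sphere 0 r \<union> sphere 0 (2*r) \<union> sphere 0 (4*r)) \<Longrightarrow>
    \<exists>as E. E holomorphic_on UNIV \<and> (\<forall>z. cmod z \<le> 2*r \<longrightarrow> E z \<noteq> 0) \<and> (\<forall>a\<in>set as. cmod a \<noteq> r) \<and>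
      (\<forall>z. F z = (\<Prod>a\<leftarrow>as. (z - a) / of_real (2*r)) * E z) \<and>
      length as \<le> C * (nev_char F (2*r) + nev_char F (4*r) + 1) \<and>
      0 \<le> circle_mean (\<lambda>z. \<bar>ln (cmod (E z))\<bar>) (2*r) \<and>
      circle_mean (\<lambda>z. \<bar>ln (cmod (E z))\<bar>) (2*r) \<le> C * (nev_char F (2*r) + nev_char F (4*r) + 1)"
proof
  define c where "c = \<bar>ln (cmod (F 0))\<bar>"
  define C where "C = 2 + 3 * c"
  have c: "0 \<le> c" by (simp add: c_def)
  show "0 \<le> C" using c by (simp add: C_def)
  fix r :: real
  assume r: "1 \<le> r" and nz: "0 \<notin> F ` (sphere 0 r \<union> sphere 0 (2*r) \<union> sphere 0 (4*r))"
  have nz2: "0 \<notin> F ` sphere 0 (2*r)" "0 \<notin> F ` sphere 0 (2*(2*r))" and r2: "0 < 2*r"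
    using nz r by (auto simp: image_Un)
  define S where "S = nev_char F (2*r) + nev_char F (4*r) + 1"
  have T: "0 \<le> nev_char F (2*r)" "0 \<le> nev_char F (4*r)"
    using r by (auto intro!: nev_char_nonneg continuous_on_entire F)
  have S: "1 \<le> S" using T by (simp add: S_def)
  obtain as E where E: "E holomorphic_on UNIV" "\<And>z. cmod z \<le> 2*r \<Longrightarrow> E z \<noteq> 0"
    "\<And>a. a \<in> set as \<Longrightarrow> cmod a < 2*r" "\<And>z. F z = (\<Prod>a\<leftarrow>as. (z - a) / of_real (2*r)) * E z"
    "length as * ln 2 \<le> nev_char F (2 * (2*r)) + \<bar>ln (cmod (F 0))\<bar>"
    "circle_mean (\<lambda>z. \<bar>ln (cmod (E z))\<bar>) (2*r)
       \<le> 2 * nev_char F (2*r) + 2 * nev_char F (2 * (2*r)) + 3 * \<bar>ln (cmod (F 0))\<bar>"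
    by (rule entire_zero_free_part[OF F r2 nz2]) (rule that)
  define Q where "Q = circle_mean (\<lambda>z. \<bar>ln (cmod (E z))\<bar>) (2*r)"
  have Q: "Q \<le> C * S"
  proof -
    have "Q \<le> 2 * S + 3 * c * 1" using E(6) by (simp add: Q_def S_def c_def)
    also have "\<dots> \<le> 2 * S + 3 * c * S" using S c by (intro add_mono mult_left_mono) auto
    finally show ?thesis by (simp add: C_def algebra_simps)
  qed
  have Q0: "0 \<le> Q"
    unfolding Q_def using r E by (intro circle_mean_nonneg continuous_intros continuous_on_ln_cmod) force+
  have n: "length as \<le> C * S"
  proof -
    have "length as * (1/2) \<le> length as * ln 2" using ln2_ge_two_thirds by (intro mult_left_mono) auto
    also have "\<dots> \<le> 1 * S + c * 1" using E(5) T by (simp add: S_def c_def)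
    also have "\<dots> \<le> 1 * S + c * S" using S c by (intro add_mono mult_left_mono) auto
    finally have "length as \<le> (2 + 2 * c) * S" by (simp add: algebra_simps)
    also have "\<dots> \<le> C * S" using S c by (intro mult_right_mono) (auto simp: C_def)
    finally show ?thesis .
  qed
  have az: "cmod a \<noteq> r" if "a \<in> set as" for a
  proof -
    have "F a = 0" using that by (auto simp: E(4) prod_list_zero_iff)
    then show ?thesis using nz by (auto simp: image_iff)
  qed
  show "\<exists>as E. E holomorphic_on UNIV \<and> (\<forall>z. cmod z \<le> 2*r \<longrightarrow> E z \<noteq> 0) \<and> (\<forall>a\<in>set as. cmod a \<noteq> r) \<and>
      (\<forall>z. F z = (\<Prod>a\<leftarrow>as. (z - a) / of_real (2*r)) * E z) \<and>
      length as \<le> C * (nev_char F (2*r) + nev_char F (4*r) + 1) \<and>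
      0 \<le> circle_mean (\<lambda>z. \<bar>ln (cmod (E z))\<bar>) (2*r) \<and>
      circle_mean (\<lambda>z. \<bar>ln (cmod (E z))\<bar>) (2*r) \<le> C * (nev_char F (2*r) + nev_char F (4*r) + 1)"
    unfolding S_def[symmetric] using E(1,2,4) az n Q0 Q unfolding Q_def by blast
qed

text \<open>Taking square roots before summing over the zeros makes every pole harmless in the mean.
  Concavity then moves the logarithm outside the mean, and only the logarithm of the characteristic
  remains.\<close>

lemma nev_char_log_deriv_aux:
  assumes F: "F holomorphic_on UNIV" "F 0 \<noteq> 0"
  obtains C where "0 \<le> C" "\<And>r. 1 \<le> r \<Longrightarrow> 0 \<notin> F ` (sphere 0 r \<union> sphere 0 (2*r) \<union> sphere 0 (4*r)) \<Longrightarrow>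
     nev_char (\<lambda>z. deriv F z / F z) r \<le> 2 * ln (1 + C * (nev_char F (2*r) + nev_char F (4*r) + 1))"
proof -
  obtain D where D: "0 \<le> D" "\<And>r. 1 \<le> r \<Longrightarrow> 0 \<notin> F ` (sphere 0 r \<union> sphere 0 (2*r) \<union> sphere 0 (4*r)) \<Longrightarrow>
    \<exists>as E. E holomorphic_on UNIV \<and> (\<forall>z. cmod z \<le> 2*r \<longrightarrow> E z \<noteq> 0) \<and> (\<forall>a\<in>set as. cmod a \<noteq> r) \<and>
      (\<forall>z. F z = (\<Prod>a\<leftarrow>as. (z - a) / of_real (2*r)) * E z) \<and>
      length as \<le> D * (nev_char F (2*r) + nev_char F (4*r) + 1) \<and>
      0 \<le> circle_mean (\<lambda>z. \<bar>ln (cmod (E z))\<bar>) (2*r) \<and>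
      circle_mean (\<lambda>z. \<bar>ln (cmod (E z))\<bar>) (2*r) \<le> D * (nev_char F (2*r) + nev_char F (4*r) + 1)"
    by (rule entire_zero_free_part_uniform[OF F]) (rule that)
  \<comment> \<open>The first term bounds the poles at the zeros of \<open>F\<close>; the others
    bound the zero-free part through \<open>sqrt (4 * Q) \<le> 4 * Q + 1\<close>.\<close>
  define C where "C = D * inv_sqrt_const + 4 * D + 1"
  show ?thesis
  proof
    show C0: "0 \<le> C" using D(1) inv_sqrt_const_nonneg by (simp add: C_def)
    fix r :: real
    assume r: "1 \<le> r" and nz: "0 \<notin> F ` (sphere 0 r \<union> sphere 0 (2*r) \<union> sphere 0 (4*r))"
    define S where "S = nev_char F (2*r) + nev_char F (4*r) + 1"
    have S: "1 \<le> S"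
      unfolding S_def using r by (simp add: nev_char_nonneg continuous_on_entire F add_nonneg_nonneg)
    obtain as E where E: "E holomorphic_on UNIV" "\<And>z. cmod z \<le> 2*r \<Longrightarrow> E z \<noteq> 0"
      and az: "\<And>a. a \<in> set as \<Longrightarrow> cmod a \<noteq> r" and FE: "\<And>z. F z = (\<Prod>a\<leftarrow>as. (z - a) / of_real (2*r)) * E z"
      and n: "length as \<le> D * S" and Q_bounds: "0 \<le> circle_mean (\<lambda>z. \<bar>ln (cmod (E z))\<bar>) (2*r)"
        "circle_mean (\<lambda>z. \<bar>ln (cmod (E z))\<bar>) (2*r) \<le> D * S"
      using D(2)[OF _ nz, folded S_def] r by blast
    define Q where "Q = circle_mean (\<lambda>z. \<bar>ln (cmod (E z))\<bar>) (2*r)"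
    have Q0: "0 \<le> Q" and Q: "Q \<le> D * S" using Q_bounds by (simp_all add: Q_def)
    have E': "cmod (deriv E z / E z) \<le> 4 * Q" if z: "cmod z = r" for z
    proof -
      have "cmod (deriv E z / E z) \<le> 2 * (2*r) / (2*r - cmod z)^2 * Q"
        unfolding Q_def using z r by (intro zero_free_log_deriv_bound E(1,2)) auto
      also have "\<dots> = 4 / r * Q" using z r by (simp add: power2_eq_square)
      also have "\<dots> \<le> 4 * Q" using r Q0 by (intro mult_right_mono) (auto simp: field_simps)
      finally show ?thesis .
    qed
    define y where "y z = (\<Sum>a\<leftarrow>as. 1 / sqrt (cmod (z - a))) + sqrt (4 * Q)" for z
    have ycont: "continuous_on (sphere 0 r) y"
      unfolding y_def using az r by (intro continuous_intros circle_mean_sum_inverse_sqrt(2)) auto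
    have y0: "0 \<le> y z" for z
      unfolding y_def using Q0 by (intro add_nonneg_nonneg sum_list_nonneg) auto
    have "nev_char (\<lambda>z. deriv F z / F z) r \<le> circle_mean (\<lambda>z. 2 * ln (1 + y z)) r"
      unfolding nev_char_eq
    proof (rule circle_mean_mono)
      show "continuous_on (sphere 0 r) (\<lambda>z. log_plus (cmod (deriv F z / F z)))"
        using nz by (intro continuous_intros continuous_on_entire continuous_on_entire_deriv F) force
      have "1 + y z > 0" for z using y0[of z] by linarith
      then show "continuous_on (sphere 0 r) (\<lambda>z. 2 * ln (1 + y z))"
        by (intro continuous_intros ycont) (metis less_irrefl)
      fix z assume z: "cmod z = r"
      have "F z \<noteq> 0" using z nz by (auto simp: image_iff)
      then have "deriv F z / F z = (\<Sum>a\<leftarrow>as. 1 / (z - a)) + deriv E z / E z"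
        using r by (intro log_deriv_factored[OF E(1) FE]) auto
      then have "sqrt (cmod (deriv F z / F z)) \<le> sqrt (cmod (\<Sum>a\<leftarrow>as. 1 / (z - a)) + cmod (deriv E z / E z))"
        by (simp add: norm_triangle_ineq)
      also have "\<dots> \<le> sqrt (cmod (\<Sum>a\<leftarrow>as. 1 / (z - a))) + sqrt (cmod (deriv E z / E z))"
        by (intro sqrt_add_le_add_sqrt) auto
      also have "\<dots> \<le> (\<Sum>a\<leftarrow>as. sqrt (cmod (1 / (z - a)))) + sqrt (4 * Q)"
        using E'[OF z] by (intro add_mono sqrt_norm_sum_list_le) auto
      also have "\<dots> = y z" by (simp add: y_def norm_divide real_sqrt_divide)
      finally have "ln (1 + sqrt (cmod (deriv F z / F z))) \<le> ln (1 + y z)"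
        by (intro ln_mono) (auto simp: add_pos_nonneg)
      then show "log_plus (cmod (deriv F z / F z)) \<le> 2 * ln (1 + y z)"
        using log_plus_le_sqrt[of "cmod (deriv F z / F z)"] by simp
    qed (use r in auto)
    also have "\<dots> \<le> 2 * ln (1 + circle_mean y r)"
      using circle_mean_ln_one_plus[OF ycont y0] r by simp
    also have "circle_mean y r \<le> C * S"
    proof -
      have "circle_mean y r = circle_mean (\<lambda>z. \<Sum>a\<leftarrow>as. 1 / sqrt (cmod (z - a))) r + sqrt (4 * Q)"
        unfolding y_def using az r
        by (subst circle_mean_add) (auto intro!: circle_mean_sum_inverse_sqrt(2))
      also have "\<dots> \<le> length as * inv_sqrt_const / sqrt r + sqrt (4 * Q)"
        using circle_mean_sum_inverse_sqrt(1)[OF az] r by simp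
      also have "length as * inv_sqrt_const / sqrt r \<le> length as * inv_sqrt_const / 1"
        using r inv_sqrt_const_nonneg by (intro divide_left_mono) auto
      also have "sqrt (4 * Q) \<le> 4 * Q + 1"
      proof (rule real_le_lsqrt)
        have "4 * Q * 1 \<le> (4 * Q + 1) * (4 * Q + 1)" using Q0 by (intro mult_mono) auto
        then show "4 * Q \<le> (4 * Q + 1)^2" by (simp add: power2_eq_square)
      qed (use Q0 in auto)
      also have "length as * inv_sqrt_const / 1 + (4 * Q + 1)
          \<le> D * S * inv_sqrt_const + (4 * (D * S) + S)"
        using n Q S inv_sqrt_const_nonneg by (intro add_mono) (auto intro!: mult_right_mono)
      also have "\<dots> = C * S" by (simp add: C_def algebra_simps)
      finally show ?thesis by simp
    qed
    then have "2 * ln (1 + circle_mean y r) \<le> 2 * ln (1 + C * S)"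
      using circle_mean_nonneg[OF ycont _ y0] r by (intro mult_left_mono ln_mono) auto
    finally show "nev_char (\<lambda>z. deriv F z / F z) r \<le> 2 * ln (1 + C * (nev_char F (2*r) + nev_char F (4*r) + 1))"
      by (simp add: S_def)
  qed
qed

text \<open>A zero \<open>a\<close> contributes \<open>ln (cmod (1 + \<eta> / (z - a)))\<close>, at
  most a multiple of \<open>1 / sqrt (cmod (z - a))\<close>, whose mean is of order
  \<open>1 / sqrt r\<close>; the zero-free part gains even \<open>1 / r\<close>. Unlike for the
  logarithmic derivative, the sum over the zeros stays outside the logarithm, and the decay in
  \<open>r\<close> has to compensate for it.\<close>

lemma nev_char_shift_quot_aux:
  assumes F: "F holomorphic_on UNIV" "F 0 \<noteq> 0"
  obtains C where "0 \<le> C" "\<And>r. 1 \<le> r \<Longrightarrow> 2 * cmod \<eta> \<le> r \<Longrightarrow>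
     0 \<notin> F ` (sphere 0 r \<union> sphere 0 (2*r) \<union> sphere 0 (4*r)) \<Longrightarrow>
     nev_char (\<lambda>z. F (z + \<eta>) / F z) r \<le> C * (nev_char F (2*r) + nev_char F (4*r) + 1) / sqrt r"
proof -
  obtain D where D: "0 \<le> D" "\<And>r. 1 \<le> r \<Longrightarrow> 0 \<notin> F ` (sphere 0 r \<union> sphere 0 (2*r) \<union> sphere 0 (4*r)) \<Longrightarrow>
    \<exists>as E. E holomorphic_on UNIV \<and> (\<forall>z. cmod z \<le> 2*r \<longrightarrow> E z \<noteq> 0) \<and> (\<forall>a\<in>set as. cmod a \<noteq> r) \<and>
      (\<forall>z. F z = (\<Prod>a\<leftarrow>as. (z - a) / of_real (2*r)) * E z) \<and>
      length as \<le> D * (nev_char F (2*r) + nev_char F (4*r) + 1) \<and>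
      0 \<le> circle_mean (\<lambda>z. \<bar>ln (cmod (E z))\<bar>) (2*r) \<and>
      circle_mean (\<lambda>z. \<bar>ln (cmod (E z))\<bar>) (2*r) \<le> D * (nev_char F (2*r) + nev_char F (4*r) + 1)"
    by (rule entire_zero_free_part_uniform[OF F]) (rule that)
  define C where "C = 2 * sqrt (cmod \<eta>) * (D * inv_sqrt_const) + 16 * cmod \<eta> * D"
  show ?thesis
  proof
    show C0: "0 \<le> C" using D(1) inv_sqrt_const_nonneg by (simp add: C_def)
    fix r :: real
    assume r: "1 \<le> r" "2 * cmod \<eta> \<le> r"
      and nz: "0 \<notin> F ` (sphere 0 r \<union> sphere 0 (2*r) \<union> sphere 0 (4*r))"
    define S where "S = nev_char F (2*r) + nev_char F (4*r) + 1"
    have S: "1 \<le> S"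
      unfolding S_def using r by (simp add: nev_char_nonneg continuous_on_entire F add_nonneg_nonneg)
    obtain as E where E: "E holomorphic_on UNIV" "\<And>z. cmod z \<le> 2*r \<Longrightarrow> E z \<noteq> 0"
      and az: "\<And>a. a \<in> set as \<Longrightarrow> cmod a \<noteq> r" and FE: "\<And>z. F z = (\<Prod>a\<leftarrow>as. (z - a) / of_real (2*r)) * E z"
      and n: "length as \<le> D * S" and Q_bounds: "0 \<le> circle_mean (\<lambda>z. \<bar>ln (cmod (E z))\<bar>) (2*r)"
        "circle_mean (\<lambda>z. \<bar>ln (cmod (E z))\<bar>) (2*r) \<le> D * S"
      using D(2)[OF _ nz, folded S_def] r by blast
    define Q where "Q = circle_mean (\<lambda>z. \<bar>ln (cmod (E z))\<bar>) (2*r)"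
    have Q0: "0 \<le> Q" and Q: "Q \<le> D * S" using Q_bounds by (simp_all add: Q_def)
    define y where "y z = 2 * sqrt (cmod \<eta>) * (\<Sum>a\<leftarrow>as. 1 / sqrt (cmod (z - a))) + 16 * cmod \<eta> * Q / r" for z
    have ycont: "continuous_on (sphere 0 r) y"
      unfolding y_def using az r by (intro continuous_intros circle_mean_sum_inverse_sqrt(2)) auto
    have y0: "0 \<le> y z" for z
      unfolding y_def using Q0 r by (intro add_nonneg_nonneg mult_nonneg_nonneg sum_list_nonneg divide_nonneg_nonneg) auto
    have "nev_char (\<lambda>z. F (z + \<eta>) / F z) r \<le> circle_mean y r"
      unfolding nev_char_eq
    proof (rule circle_mean_mono)
      show "continuous_on (sphere 0 r) (\<lambda>z. log_plus (cmod (F (z + \<eta>) / F z)))"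
        using nz by (intro continuous_intros continuous_on_entire entire_shift F) force
      fix z assume z: "cmod z = r"
      have Fz: "F z \<noteq> 0" using z nz by (auto simp: image_iff)
      have "ln (cmod (F (z + \<eta>) / F z)) \<le> y z"
      proof (cases "F (z + \<eta>) = 0")
        \<comment> \<open>At a zero of the numerator \<open>ln 0 = 0\<close>, so that nonnegativity
          of \<open>y\<close> suffices.\<close>
        case True
        then show ?thesis using y0 by simp
      next
        case False
        have P0: "(\<Prod>a\<leftarrow>as. (w - a) / of_real (2*r)) \<noteq> 0" if "F w \<noteq> 0" for w
          using that FE[of w] by auto
        have wa: "(w - a) / of_real (2*r) \<noteq> 0" if "F w \<noteq> 0" "a \<in> set as" for w a
          using P0[OF that(1)] that(2) by (auto simp: prod_list_zero_iff)
        have lnF: "ln (cmod (F w)) = (\<Sum>a\<leftarrow>as. ln (cmod ((w - a) / of_real (2*r)))) + ln (cmod (E w))"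
          if "F w \<noteq> 0" for w
        proof -
          have "E w \<noteq> 0" using that FE[of w] by auto
          then have "ln (cmod (F w)) = ln (cmod (\<Prod>a\<leftarrow>as. (w - a) / of_real (2*r))) + ln (cmod (E w))"
            using P0[OF that] by (simp only: FE norm_mult) (simp add: ln_mult)
          then show ?thesis using wa[OF that] by (subst (asm) ln_cmod_prod_list) auto
        qed
        have "ln (cmod (F (z + \<eta>) / F z)) = ln (cmod (F (z + \<eta>))) - ln (cmod (F z))"
          using False Fz by (simp add: norm_divide ln_div)
        also have "\<dots> = (\<Sum>a\<leftarrow>as. ln (cmod ((z + \<eta> - a) / of_real (2*r))) - ln (cmod ((z - a) / of_real (2*r))))
            + (ln (cmod (E (z + \<eta>))) - ln (cmod (E z)))"
          by (simp only: lnF[OF False] lnF[OF Fz] sum_list_subtractf)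
        also have "\<dots> \<le> (\<Sum>a\<leftarrow>as. 2 * sqrt (cmod \<eta>) * (1 / sqrt (cmod (z - a)))) + 16 * cmod \<eta> * Q / r"
        proof (intro add_mono sum_list_mono)
          fix a assume a: "a \<in> set as"
          have ne: "z + \<eta> - a \<noteq> 0" "z - a \<noteq> 0" using wa[OF False a] wa[OF Fz a] by auto
          have "ln (cmod ((z + \<eta> - a) / of_real (2*r))) - ln (cmod ((z - a) / of_real (2*r)))
              = ln (cmod ((z + \<eta> - a) / (z - a)))"
            using ne r by (simp add: norm_divide ln_div)
          also have "(z + \<eta> - a) / (z - a) = 1 + \<eta> / (z - a)" using ne by (simp add: field_simps)
          also have "ln (cmod (1 + \<eta> / (z - a))) \<le> ln (1 + cmod \<eta> / cmod (z - a))"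
          proof (rule ln_mono)
            show "cmod (1 + \<eta> / (z - a)) \<le> 1 + cmod \<eta> / cmod (z - a)"
              using norm_triangle_ineq[of 1 "\<eta> / (z - a)"] by (simp add: norm_divide)
            show "0 < cmod (1 + \<eta> / (z - a))" using ne by (simp add: add_divide_eq_iff algebra_simps)
          qed
          also have "\<dots> \<le> 2 * sqrt (cmod \<eta> / cmod (z - a))" by (intro ln_le_sqrt) auto
          finally show "ln (cmod ((z + \<eta> - a) / of_real (2*r))) - ln (cmod ((z - a) / of_real (2*r)))
              \<le> 2 * sqrt (cmod \<eta>) * (1 / sqrt (cmod (z - a)))"
            by (simp add: real_sqrt_divide)
        next
          \<comment> \<open>\<open>2 * cmod \<eta> \<le> r\<close> keeps \<open>z + \<eta>\<close>
            in the disc of radius \<open>3/2 * r\<close>, at distance \<open>r / 2\<close> from the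
            circle of radius \<open>2 * r\<close>; this gives the constant 16.\<close>
          have "ln (cmod (E (z + \<eta>))) - ln (cmod (E z)) \<le> 2 * (2*r) / (2*r - 3/2*r)^2 * Q * cmod (z + \<eta> - z)"
            unfolding Q_def using z r norm_triangle_ineq[of z \<eta>]
            by (intro zero_free_log_diff_bound E(1,2)) auto
          also have "\<dots> = 16 * cmod \<eta> * Q / r" using r by (simp add: power2_eq_square)
          finally show "ln (cmod (E (z + \<eta>))) - ln (cmod (E z)) \<le> 16 * cmod \<eta> * Q / r" .
        qed
        also have "\<dots> = y z" by (simp only: y_def sum_list_const_mult)
        finally show ?thesis .
      qed
      then show "log_plus (cmod (F (z + \<eta>) / F z)) \<le> y z"
        using y0[of z] by (simp add: log_plus_def)
    qed (use r ycont in auto)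
    also have "circle_mean y r \<le> C * S / sqrt r"
    proof -
      have "circle_mean y r = 2 * sqrt (cmod \<eta>) * circle_mean (\<lambda>z. \<Sum>a\<leftarrow>as. 1 / sqrt (cmod (z - a))) r + 16 * cmod \<eta> * Q / r"
        unfolding y_def using az r
        by (subst circle_mean_add) (auto intro!: continuous_on_mult continuous_on_const circle_mean_sum_inverse_sqrt(2))
      also have "\<dots> \<le> 2 * sqrt (cmod \<eta>) * (length as * inv_sqrt_const / sqrt r) + 16 * cmod \<eta> * Q / sqrt r"
      proof (intro add_mono mult_left_mono divide_left_mono)
        have "sqrt r * 1 \<le> sqrt r * sqrt r" using r by (intro mult_left_mono) auto
        then show "sqrt r \<le> r" using r by simp
      qed (use az r Q0 circle_mean_sum_inverse_sqrt(1) in auto)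
      also have "\<dots> = (2 * sqrt (cmod \<eta>) * (length as * inv_sqrt_const) + 16 * cmod \<eta> * Q) / sqrt r"
        by (simp add: add_divide_distrib)
      also have "\<dots> \<le> (2 * sqrt (cmod \<eta>) * (D * S * inv_sqrt_const) + 16 * cmod \<eta> * (D * S)) / sqrt r"
        using n Q r inv_sqrt_const_nonneg by (intro divide_right_mono add_mono mult_left_mono mult_right_mono) auto
      also have "\<dots> = C * S / sqrt r" by (simp add: C_def algebra_simps)
      finally show ?thesis .
    qed
    finally show "nev_char (\<lambda>z. F (z + \<eta>) / F z) r \<le> C * (nev_char F (2*r) + nev_char F (4*r) + 1) / sqrt r"
      by (simp add: S_def)
  qed
qed

lemma nev_char_mono:
  assumes "continuous_on (sphere 0 r) g" "continuous_on (sphere 0 r) h" "0 \<le> r"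
    and "\<And>z. cmod z = r \<Longrightarrow> cmod (g z) \<le> cmod (h z)"
  shows "nev_char g r \<le> nev_char h r"
  unfolding nev_char_eq using assms by (intro circle_mean_mono continuous_intros log_plus_mono) auto

text \<open>Splitting off \<open>z ^ k\<close> reduces to a function that is nonzero at 0. The power
  adds \<open>k / z\<close> to the logarithmic derivative, of modulus at most \<open>k\<close> since
  \<open>r \<ge> 1\<close>, and for the same reason \<open>h\<close> has no larger characteristic
  than \<open>F\<close>.\<close>

lemma nev_char_log_deriv:
  assumes F: "F holomorphic_on UNIV" "F b \<noteq> 0"
  obtains C where "0 \<le> C" "\<And>r. 1 \<le> r \<Longrightarrow> 0 \<notin> F ` (sphere 0 r \<union> sphere 0 (2*r) \<union> sphere 0 (4*r)) \<Longrightarrow>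
     nev_char (\<lambda>z. deriv F z / F z) r \<le> 2 * ln (1 + C * (nev_char F (2*r) + nev_char F (4*r) + 1)) + C"
proof -
  obtain k h where h: "h holomorphic_on UNIV" "h 0 \<noteq> 0" "\<And>z. F z = (z - 0) ^ k * h z"
    by (rule entire_factor_zero[OF F, of 0]) (rule that)
  note h = h(1,2) h(3)[unfolded diff_zero]
  obtain C where C: "0 \<le> C" "\<And>r. 1 \<le> r \<Longrightarrow> 0 \<notin> h ` (sphere 0 r \<union> sphere 0 (2*r) \<union> sphere 0 (4*r)) \<Longrightarrow>
     nev_char (\<lambda>z. deriv h z / h z) r \<le> 2 * ln (1 + C * (nev_char h (2*r) + nev_char h (4*r) + 1))"
    by (rule nev_char_log_deriv_aux[OF h(1,2)]) (rule that)
  define C' where "C' = C + (log_plus k + ln 2)"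
  show ?thesis
  proof
    show "0 \<le> C'" using C(1) by (simp add: C'_def)
    fix r :: real
    assume r: "1 \<le> r" and nz: "0 \<notin> F ` (sphere 0 r \<union> sphere 0 (2*r) \<union> sphere 0 (4*r))"
    then have hz: "0 \<notin> h ` (sphere 0 r \<union> sphere 0 (2*r) \<union> sphere 0 (4*r))"
      by (auto simp: h(3) image_iff)
    have hF: "nev_char h s \<le> nev_char F s" if "r \<le> s" for s
      using that r mult_right_mono[of 1 "s ^ k"]
      by (intro nev_char_mono continuous_on_entire h F) (auto simp: h(3) norm_mult norm_power one_le_power)
    have T: "0 \<le> nev_char h (2*r)" "0 \<le> nev_char h (4*r)"
      using r by (auto intro!: nev_char_nonneg continuous_on_entire h)
    have contq: "continuous_on (sphere 0 r) (\<lambda>z. deriv h z / h z)"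
      using hz by (intro continuous_intros continuous_on_entire continuous_on_entire_deriv h) auto
    have "nev_char (\<lambda>z. deriv F z / F z) r \<le> circle_mean (\<lambda>z. (log_plus k + ln 2) + log_plus (cmod (deriv h z / h z))) r"
      unfolding nev_char_eq
    proof (rule circle_mean_mono)
      show "continuous_on (sphere 0 r) (\<lambda>z. log_plus (cmod (deriv F z / F z)))"
        using nz by (intro continuous_intros continuous_on_entire continuous_on_entire_deriv F) auto
      fix z assume z: "cmod z = r"
      have z0: "z \<noteq> 0" using z r by auto
      have Fz: "F z \<noteq> 0" using z nz by (auto simp: image_iff)
      have F_eq: "F = (\<lambda>z. z ^ k * h z)" using h(3) by auto
      have "(F has_field_derivative (of_nat k * z ^ (k - 1) * h z + z ^ k * deriv h z)) (at z)"
        unfolding F_eq using holomorphic_derivI[OF h(1) open_UNIV, of z]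
        by (auto intro!: derivative_eq_intros)
      then have "deriv F z / F z = (of_nat k * z ^ (k - 1) * h z + z ^ k * deriv h z) / (z ^ k * h z)"
        by (simp add: DERIV_imp_deriv h(3))
      also have "\<dots> = of_nat k / z + deriv h z / h z"
      proof -
        have "of_nat k * z ^ (k - 1) = of_nat k * z ^ k / z" using z0 by (cases k) auto
        then show ?thesis using z0 Fz by (simp add: F_eq add_divide_distrib)
      qed
      finally have "cmod (deriv F z / F z) \<le> cmod (of_nat k / z) + cmod (deriv h z / h z)"
        by (simp add: norm_triangle_ineq)
      also have "cmod (of_nat k / z) \<le> k"
        using z r mult_right_mono[of 1 r "real k"] by (simp add: norm_divide divide_le_eq mult.commute)
      finally have "log_plus (cmod (deriv F z / F z)) \<le> log_plus (k + cmod (deriv h z / h z))"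
        by (intro log_plus_mono) auto
      also have "\<dots> \<le> log_plus k + log_plus (cmod (deriv h z / h z)) + ln 2"
        by (intro log_plus_add) auto
      finally show "log_plus (cmod (deriv F z / F z)) \<le> (log_plus k + ln 2) + log_plus (cmod (deriv h z / h z))"
        by simp
    qed (use r contq in \<open>auto intro!: continuous_intros\<close>)
    also have "\<dots> = (log_plus k + ln 2) + nev_char (\<lambda>z. deriv h z / h z) r"
      unfolding nev_char_eq using r contq by (subst circle_mean_add) (auto intro!: continuous_intros)
    also have "nev_char (\<lambda>z. deriv h z / h z) r \<le> 2 * ln (1 + C * (nev_char h (2*r) + nev_char h (4*r) + 1))"
      using C(2)[OF r hz] .
    also have "\<dots> \<le> 2 * ln (1 + C' * (nev_char F (2*r) + nev_char F (4*r) + 1))"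
      using C(1) T hF[of "2*r"] hF[of "4*r"] r
      by (intro mult_left_mono ln_mono add_left_mono mult_mono add_mono) (auto simp: C'_def add_pos_nonneg)
    finally show "nev_char (\<lambda>z. deriv F z / F z) r \<le> 2 * ln (1 + C' * (nev_char F (2*r) + nev_char F (4*r) + 1)) + C'"
      using C(1) by (simp add: C'_def)
  qed
qed

text \<open>As for the logarithmic derivative; here the power of \<open>z\<close> contributes
  \<open>k * ln (1 + cmod \<eta> / r)\<close>, which also decays at least like
  \<open>1 / sqrt r\<close>.\<close>

lemma nev_char_shift_quot:
  assumes F: "F holomorphic_on UNIV" "F b \<noteq> 0"
  obtains C where "0 \<le> C" "\<And>r. 1 \<le> r \<Longrightarrow> 2 * cmod \<eta> \<le> r \<Longrightarrow>
     0 \<notin> F ` (sphere 0 r \<union> sphere 0 (2*r) \<union> sphere 0 (4*r)) \<Longrightarrow>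
     nev_char (\<lambda>z. F (z + \<eta>) / F z) r \<le> C * (nev_char F (2*r) + nev_char F (4*r) + 1) / sqrt r"
proof -
  obtain k h where h: "h holomorphic_on UNIV" "h 0 \<noteq> 0" "\<And>z. F z = (z - 0) ^ k * h z"
    by (rule entire_factor_zero[OF F, of 0]) (rule that)
  note h = h(1,2) h(3)[unfolded diff_zero]
  obtain C where C: "0 \<le> C" "\<And>r. 1 \<le> r \<Longrightarrow> 2 * cmod \<eta> \<le> r \<Longrightarrow>
     0 \<notin> h ` (sphere 0 r \<union> sphere 0 (2*r) \<union> sphere 0 (4*r)) \<Longrightarrow>
     nev_char (\<lambda>z. h (z + \<eta>) / h z) r \<le> C * (nev_char h (2*r) + nev_char h (4*r) + 1) / sqrt r"
    by (rule nev_char_shift_quot_aux[OF h(1,2), of \<eta>]) (rule that)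
  define D where "D = k * cmod \<eta>"
  show ?thesis
  proof
    show "0 \<le> C + D" using C(1) by (simp add: D_def)
    fix r :: real
    assume r: "1 \<le> r" "2 * cmod \<eta> \<le> r" and nz: "0 \<notin> F ` (sphere 0 r \<union> sphere 0 (2*r) \<union> sphere 0 (4*r))"
    then have hz: "0 \<notin> h ` (sphere 0 r \<union> sphere 0 (2*r) \<union> sphere 0 (4*r))"
      by (auto simp: h(3) image_iff)
    have hF: "nev_char h s \<le> nev_char F s" if "r \<le> s" for s
      using that r mult_right_mono[of 1 "s ^ k"]
      by (intro nev_char_mono continuous_on_entire h F) (auto simp: h(3) norm_mult norm_power one_le_power)
    have T: "0 \<le> nev_char h (2*r)" "0 \<le> nev_char h (4*r)"
      using r by (auto intro!: nev_char_nonneg continuous_on_entire h)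
    have sqrt: "0 < sqrt r" "sqrt r \<le> r"
      using r mult_left_mono[of 1 "sqrt r" "sqrt r"] by auto
    have contq: "continuous_on (sphere 0 r) (\<lambda>z. h (z + \<eta>) / h z)"
      using hz by (intro continuous_intros continuous_on_entire entire_shift h) auto
    have "nev_char (\<lambda>z. F (z + \<eta>) / F z) r \<le> circle_mean (\<lambda>z. D / sqrt r + log_plus (cmod (h (z + \<eta>) / h z))) r"
      unfolding nev_char_eq
    proof (rule circle_mean_mono)
      show "continuous_on (sphere 0 r) (\<lambda>z. log_plus (cmod (F (z + \<eta>) / F z)))"
        using nz by (intro continuous_intros continuous_on_entire entire_shift F) auto
      fix z assume z: "cmod z = r"
      have z0: "z \<noteq> 0" using z r by auto
      have "F (z + \<eta>) / F z = ((z + \<eta>) / z) ^ k * (h (z + \<eta>) / h z)"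
        by (simp add: h(3) power_divide)
      then have "cmod (F (z + \<eta>) / F z) = cmod ((z + \<eta>) / z) ^ k * cmod (h (z + \<eta>) / h z)"
        by (simp only: norm_mult norm_power)
      then have "log_plus (cmod (F (z + \<eta>) / F z)) \<le> log_plus (cmod ((z + \<eta>) / z) ^ k) + log_plus (cmod (h (z + \<eta>) / h z))"
        using log_plus_mult[of "cmod ((z + \<eta>) / z) ^ k" "cmod (h (z + \<eta>) / h z)"] by simp
      also have "log_plus (cmod ((z + \<eta>) / z) ^ k) \<le> log_plus ((1 + cmod \<eta> / r) ^ k)"
      proof (intro log_plus_mono power_mono)
        have "(z + \<eta>) / z = 1 + \<eta> / z" using z0 by (simp add: field_simps)
        then show "cmod ((z + \<eta>) / z) \<le> 1 + cmod \<eta> / r"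
          using norm_triangle_ineq[of 1 "\<eta> / z"] z by (simp add: norm_divide)
      qed auto
      also have "\<dots> = k * ln (1 + cmod \<eta> / r)"
      proof -
        have "1 \<le> (1 + cmod \<eta> / r) ^ k" using r by (intro one_le_power) auto
        then show ?thesis using r by (simp add: log_plus_eq_ln_max ln_realpow add_pos_nonneg)
      qed
      also have "\<dots> \<le> k * (cmod \<eta> / r)"
        using r by (intro mult_left_mono ln_add_one_self_le_self) auto
      also have "\<dots> \<le> D / sqrt r"
        using sqrt r unfolding D_def times_divide_eq_right by (intro divide_left_mono) auto
      finally show "log_plus (cmod (F (z + \<eta>) / F z)) \<le> D / sqrt r + log_plus (cmod (h (z + \<eta>) / h z))"
        by simp
    qed (use r contq in \<open>auto intro!: continuous_intros\<close>)
    also have "\<dots> = D / sqrt r + nev_char (\<lambda>z. h (z + \<eta>) / h z) r"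
      unfolding nev_char_eq using r contq by (subst circle_mean_add) (auto intro!: continuous_intros)
    also have "nev_char (\<lambda>z. h (z + \<eta>) / h z) r \<le> C * (nev_char h (2*r) + nev_char h (4*r) + 1) / sqrt r"
      using C(2)[OF r hz] .
    also have "\<dots> \<le> C * (nev_char F (2*r) + nev_char F (4*r) + 1) / sqrt r"
      using C(1) T hF[of "2*r"] hF[of "4*r"] r
      by (intro divide_right_mono mult_left_mono add_mono) auto
    also have "D / sqrt r \<le> D * (nev_char F (2*r) + nev_char F (4*r) + 1) / sqrt r"
      using T hF[of "2*r"] hF[of "4*r"] r mult_left_mono[of 1 "nev_char F (2*r) + nev_char F (4*r) + 1" D]
      by (intro divide_right_mono) (auto simp: D_def)
    finally show "nev_char (\<lambda>z. F (z + \<eta>) / F z) r \<le> (C + D) * (nev_char F (2*r) + nev_char F (4*r) + 1) / sqrt r"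
      by (simp add: add_divide_distrib distrib_right)
  qed
qed

section \<open>Quotients of entire functions\<close>

lemma entire_countable_zeros:
  assumes "F holomorphic_on UNIV" "F b \<noteq> 0"
  shows "countable {z. F z = 0}"
proof (cases "F constant_on UNIV")
  case True
  then have "F z \<noteq> 0" for z using assms(2) by (metis UNIV_I constant_on_def)
  then show ?thesis by simp
next
  case False
  then show ?thesis using holomorphic_countable_zeros[OF assms(1)] by (auto simp: fsigma_UNIV)
qed

text \<open>Two countable zero sets cannot cover the plane.\<close>

lemma entire_mult_nonzero:
  assumes "F holomorphic_on UNIV" "F a \<noteq> 0" "G holomorphic_on UNIV" "G b \<noteq> 0"
  shows "\<exists>z. F z * G z \<noteq> 0"
proof (rule ccontr)
  assume "\<nexists>z. F z * G z \<noteq> 0"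
  then have "{z. F z = 0} \<union> {z. G z = 0} = UNIV" by auto
  moreover have "countable ({z. F z = 0} \<union> {z. G z = 0})"
    using assms by (intro countable_Un entire_countable_zeros)
  ultimately show False using uncountable_UNIV_complex by simp
qed

lemma entire_mult_cancel:
  assumes "A holomorphic_on UNIV" "B holomorphic_on UNIV" "L holomorphic_on UNIV" "L b \<noteq> 0"
    and "\<And>z. A z * L z = B z * L z"
  shows "A z = B z"
proof (rule ccontr)
  assume "A z \<noteq> B z"
  then have "\<exists>z. (A z - B z) * L z \<noteq> 0"
    using assms by (intro entire_mult_nonzero[of "\<lambda>z. A z - B z" z L b] holomorphic_intros) auto
  then show False using assms(5) by (auto simp: algebra_simps)
qed

text \<open>A lower bound for the order of vanishing, satisfied by the zero function for every
  \<open>m\<close>. Exact multiplicities are expressed by a cofactor that is nonzero at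
  \<open>a\<close>.\<close>

definition vanishes :: "(complex \<Rightarrow> complex) \<Rightarrow> complex \<Rightarrow> nat \<Rightarrow> bool" where
  "vanishes F a m \<longleftrightarrow> (\<exists>h. h holomorphic_on UNIV \<and> (\<forall>z. F z = (z - a) ^ m * h z))"

lemma vanishes_mult:
  assumes "vanishes F a m" "vanishes G a n"
  shows "vanishes (\<lambda>z. F z * G z) a (m + n)"
proof -
  obtain h k where "h holomorphic_on UNIV" "\<forall>z. F z = (z - a) ^ m * h z"
    "k holomorphic_on UNIV" "\<forall>z. G z = (z - a) ^ n * k z"
    using assms by (auto simp: vanishes_def)
  then show ?thesis
    unfolding vanishes_def by (intro exI[of _ "\<lambda>z. h z * k z"]) (auto intro!: holomorphic_intros simp: power_add)
qed

lemma vanishes_power: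
  assumes "vanishes F a m"
  shows "vanishes (\<lambda>z. F z ^ n) a (n * m)"
proof -
  obtain h where "h holomorphic_on UNIV" "\<forall>z. F z = (z - a) ^ m * h z"
    using assms by (auto simp: vanishes_def)
  then show ?thesis
    unfolding vanishes_def
    by (intro exI[of _ "\<lambda>z. h z ^ n"]) (auto intro!: holomorphic_intros simp: power_mult_distrib mult.commute simp flip: power_mult)
qed

lemma vanishes_mono:
  assumes "vanishes F a m" "n \<le> m"
  shows "vanishes F a n"
proof -
  obtain h where "h holomorphic_on UNIV" "\<forall>z. F z = (z - a) ^ m * h z"
    using assms by (auto simp: vanishes_def)
  then show ?thesis
    using assms(2) unfolding vanishes_def
    by (intro exI[of _ "\<lambda>z. (z - a) ^ (m - n) * h z"])
       (auto intro!: holomorphic_intros simp: mult.assoc[symmetric] simp flip: power_add)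
qed

lemma vanishes_0: "F holomorphic_on UNIV \<Longrightarrow> vanishes F a 0"
  by (auto simp: vanishes_def)

lemma vanishes_1:
  assumes "F holomorphic_on UNIV" "F a = 0"
  shows "vanishes F a 1"
proof (cases "\<exists>b. F b \<noteq> 0")
  case True
  then obtain b where "F b \<noteq> 0" by blast
  from assms(1) this obtain k h where h: "h holomorphic_on UNIV" "h a \<noteq> 0" "\<And>z. F z = (z - a) ^ k * h z"
    by (rule entire_factor_zero[of _ _ a]) (rule that)
  have "k \<noteq> 0" using h(2) h(3)[of a] assms(2) by (intro notI) auto
  moreover have "vanishes F a k" using h by (auto simp: vanishes_def)
  ultimately show ?thesis by (auto intro: vanishes_mono)
next
  case False
  then show ?thesis unfolding vanishes_def by (intro exI[of _ "\<lambda>_. 0"]) auto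
qed

lemma deriv_factored:
  assumes "h holomorphic_on UNIV" "\<And>z. F z - c = (z - a) ^ m * h z" "0 < m"
  shows "deriv F z = (z - a) ^ (m - 1) * (of_nat m * h z + (z - a) * deriv h z)"
proof -
  have "((\<lambda>z. (z - a) ^ m * h z + c) has_field_derivative
      (of_nat m * (z - a) ^ (m - 1) * h z + (z - a) ^ m * deriv h z)) (at z)"
    using holomorphic_derivI[OF assms(1) open_UNIV, of z] by (auto intro!: derivative_eq_intros)
  moreover have "F = (\<lambda>z. (z - a) ^ m * h z + c)" using assms(2) by (auto simp: fun_eq_iff diff_eq_eq)
  moreover have "(z - a) ^ m = (z - a) ^ (m - 1) * (z - a)" using assms(3) by (metis power_minus_mult)
  ultimately show ?thesis by (simp add: DERIV_imp_deriv algebra_simps)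
qed

lemma vanishes_deriv:
  assumes "F holomorphic_on UNIV" "vanishes (\<lambda>z. F z - c) a m"
  shows "vanishes (deriv F) a (m - 1)"
proof (cases "m = 0")
  case True
  then show ?thesis using assms by (auto intro!: vanishes_0 holomorphic_deriv)
next
  case False
  obtain h where h: "h holomorphic_on UNIV" "\<And>z. F z - c = (z - a) ^ m * h z"
    using assms by (auto simp: vanishes_def)
  show ?thesis
    unfolding vanishes_def
    using deriv_factored[OF h] False h(1)
    by (intro exI[of _ "\<lambda>z. of_nat m * h z + (z - a) * deriv h z"]) (auto intro!: holomorphic_intros)
qed

text \<open>\<open>Q\<close> is defined by limits, which gives the correct value at removable
  singularities independently of local choices. Near each point \<open>N = q * D\<close> with
  \<open>q\<close> holomorphic and \<open>D\<close> nonzero off that point, so the limit returns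
  \<open>q\<close>.\<close>

lemma entire_quotient:
  assumes N: "N holomorphic_on UNIV" and D: "D holomorphic_on UNIV"
    and zeros: "\<And>a. D a = 0 \<Longrightarrow> \<exists>m d. d holomorphic_on UNIV \<and> d a \<noteq> 0 \<and> (\<forall>z. D z = (z - a) ^ m * d z) \<and> vanishes N a m"
  obtains Q where "Q holomorphic_on UNIV" "\<And>z. N z = Q z * D z"
proof -
  define Q where "Q z = Lim (at z) (\<lambda>w. N w / D w)" for z
  have open_ne: "open {z. f z \<noteq> 0}" if "f holomorphic_on UNIV" for f :: "complex \<Rightarrow> complex"
    using that by (intro open_Collect_neq continuous_on_const continuous_on_entire)
  have loc: "\<exists>U q. open U \<and> a \<in> U \<and> q holomorphic_on U \<and> (\<forall>w\<in>U. N w = q w * D w) \<and> (\<forall>w\<in>U - {a}. D w \<noteq> 0)" for a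
  proof (cases "D a = 0")
    case False
    then show ?thesis
      by (intro exI[of _ "{z. D z \<noteq> 0}"] exI[of _ "\<lambda>w. N w / D w"])
         (auto intro!: open_ne D N holomorphic_intros intro: holomorphic_on_subset)
  next
    case True
    then obtain m d n where d: "d holomorphic_on UNIV" "d a \<noteq> 0" "\<And>z. D z = (z - a) ^ m * d z"
      and n: "n holomorphic_on UNIV" "\<And>z. N z = (z - a) ^ m * n z"
      using zeros[OF True] by (auto simp: vanishes_def)
    show ?thesis
      by (intro exI[of _ "{z. d z \<noteq> 0}"] exI[of _ "\<lambda>w. n w / d w"])
         (use d n in \<open>auto intro!: open_ne holomorphic_intros intro: holomorphic_on_subset\<close>)
  qed
  have Q: "\<exists>U q. open U \<and> a \<in> U \<and> q holomorphic_on U \<and> (\<forall>w\<in>U. N w = q w * D w) \<and> (\<forall>w\<in>U. Q w = q w)" for a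
  proof -
    obtain U q where U: "open U" "a \<in> U" "q holomorphic_on U" "\<And>w. w \<in> U \<Longrightarrow> N w = q w * D w"
      "\<And>w. w \<in> U - {a} \<Longrightarrow> D w \<noteq> 0"
      using loc[of a] by blast
    have "Q w = q w" if w: "w \<in> U" for w
    proof -
      have "q \<midarrow>w\<rightarrow> q w"
        using U(1,3) w by (meson continuous_on_eq_continuous_at holomorphic_on_imp_continuous_on isCont_def)
      moreover have "eventually (\<lambda>v. v \<in> U - {a}) (at w)"
      proof -
        have "eventually (\<lambda>v. v \<in> U) (at w)" using U(1) w by (rule eventually_at_in_open')
        moreover have "eventually (\<lambda>v. v \<noteq> a) (at w)"
          by (cases "w = a") (auto simp: eventually_neq_at_within)
        ultimately show ?thesis by eventually_elim auto
      qed
      then have "eventually (\<lambda>v. q v = N v / D v) (at w)"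
        by eventually_elim (use U(4,5) in auto)
      ultimately have "((\<lambda>v. N v / D v) \<longlongrightarrow> q w) (at w)"
        using filterlim_cong[OF refl refl] by (auto elim: Lim_transform_eventually)
      then show ?thesis unfolding Q_def by (intro tendsto_Lim) auto
    qed
    then show ?thesis using U by blast
  qed
  have "Q holomorphic_on UNIV"
  proof (rule holomorphic_on_open[THEN iffD2, OF open_UNIV], intro ballI)
    fix a
    obtain U q where U: "open U" "a \<in> U" "q holomorphic_on U" "\<forall>w\<in>U. Q w = q w"
      using Q[of a] by blast
    then have "Q holomorphic_on U" by (metis holomorphic_transform)
    then show "\<exists>f'. (Q has_field_derivative f') (at a)"
      using U holomorphic_on_open by blast
  qed
  moreover have "N z = Q z * D z" for z
    using Q[of z] by force
  ultimately show ?thesis using that by blast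
qed

text \<open>At a zero of \<open>U - c\<close> the other factor is nonzero because
  \<open>c \<noteq> d\<close>, so the denominator vanishes there to order exactly
  \<open>n * p\<close>. The case \<open>n = 1\<close> produces \<open>\<phi>\<close> and
  \<open>\<psi>\<close>, the case \<open>n = 4\<close> the auxiliary function.\<close>

lemma entire_quotient_two_values:
  assumes U: "U holomorphic_on UNIV" and nc: "\<And>e. \<exists>z. U z \<noteq> e" and cd: "c \<noteq> d"
    and N: "N holomorphic_on UNIV"
    and c: "\<And>a p h. h holomorphic_on UNIV \<Longrightarrow> h a \<noteq> 0 \<Longrightarrow> (\<And>z. U z - c = (z - a) ^ p * h z) \<Longrightarrow> 0 < p \<Longrightarrow> vanishes N a (n * p)"
    and d: "\<And>a p h. h holomorphic_on UNIV \<Longrightarrow> h a \<noteq> 0 \<Longrightarrow> (\<And>z. U z - d = (z - a) ^ p * h z) \<Longrightarrow> 0 < p \<Longrightarrow> vanishes N a (n * p)"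
  obtains Q where "Q holomorphic_on UNIV" "\<And>z. N z = Q z * ((U z - c) * (U z - d)) ^ n"
proof -
  have half: "\<exists>m d. d holomorphic_on UNIV \<and> d a \<noteq> 0 \<and> (\<forall>z. ((U z - c') * (U z - d')) ^ n = (z - a) ^ m * d z) \<and> vanishes N a m"
    if "U a = c'" "c' \<noteq> d'"
      "\<And>p h. h holomorphic_on UNIV \<Longrightarrow> h a \<noteq> 0 \<Longrightarrow> (\<And>z. U z - c' = (z - a) ^ p * h z) \<Longrightarrow> 0 < p \<Longrightarrow> vanishes N a (n * p)"
    for a c' d'
  proof -
    obtain b where b: "U b \<noteq> c'" using nc by blast
    have "(\<lambda>z. U z - c') holomorphic_on UNIV" "U b - c' \<noteq> 0" using U b by (auto intro!: holomorphic_intros)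
    then obtain p h where h: "h holomorphic_on UNIV" "h a \<noteq> 0" "\<And>z. U z - c' = (z - a) ^ p * h z"
      by (rule entire_factor_zero[of _ _ a]) (rule that)
    have p: "0 < p" using h(2) h(3)[of a] that(1) by (cases p) auto
    have "((U z - c') * (U z - d')) ^ n = (z - a) ^ (n * p) * (h z * (U z - d')) ^ n" for z
      by (simp add: h(3) power_mult_distrib mult.assoc mult.commute[of n p] power_mult)
    then show ?thesis
      using that(1,2) h(1,2) U that(3)[OF h p]
      by (intro exI[of _ "n * p"] exI[of _ "\<lambda>z. (h z * (U z - d')) ^ n"])
         (auto intro!: holomorphic_intros)
  qed
  show ?thesis
  proof (rule entire_quotient[of N "\<lambda>z. ((U z - c) * (U z - d)) ^ n"])
    show "(\<lambda>z. ((U z - c) * (U z - d)) ^ n) holomorphic_on UNIV" by (intro holomorphic_intros U)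
    fix a assume "((U a - c) * (U a - d)) ^ n = 0"
    then consider "U a = c" | "U a = d" by auto
    then show "\<exists>m e. e holomorphic_on UNIV \<and> e a \<noteq> 0 \<and> (\<forall>z. ((U z - c) * (U z - d)) ^ n = (z - a) ^ m * e z) \<and> vanishes N a m"
    proof cases
      case 1 then show ?thesis using half[of a c d] cd c by blast
    next
      case 2
      then have "\<exists>m e. e holomorphic_on UNIV \<and> e a \<noteq> 0 \<and> (\<forall>z. ((U z - d) * (U z - c)) ^ n = (z - a) ^ m * e z) \<and> vanishes N a m"
        using half[of a d c] cd d by blast
      then show ?thesis by (simp add: mult.commute)
    qed
  qed (use N that in auto)
qed

text \<open>At a point of multiplicity \<open>p\<close> the derivative vanishes to order
  \<open>p - 1\<close>, and the simple zero of \<open>L\<close> supplies the missing one.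
  Multiplicities therefore need not be shared.\<close>

lemma entire_log_deriv_quotient:
  assumes U: "U holomorphic_on UNIV" and nc: "\<And>e. \<exists>z. U z \<noteq> e" and cd: "c \<noteq> d"
    and L: "L holomorphic_on UNIV" "\<And>z. U z = c \<or> U z = d \<Longrightarrow> L z = 0"
  obtains Q where "Q holomorphic_on UNIV" "\<And>z. deriv U z * L z = Q z * ((U z - c) * (U z - d))"
proof -
  have van: "vanishes (\<lambda>z. deriv U z * L z) a (1 * p)"
    if h: "h holomorphic_on UNIV" "\<And>z. U z - e = (z - a) ^ p * h z" "0 < p" and e: "e = c \<or> e = d" for a p h e
  proof -
    have "vanishes (\<lambda>z. U z - e) a p" using h by (auto simp: vanishes_def)
    then have "vanishes (deriv U) a (p - 1)" by (rule vanishes_deriv[OF U])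
    moreover have "U a = e" using h(2)[of a] h(3) by (simp add: power_0_left)
    then have "vanishes L a 1" using e L by (intro vanishes_1) auto
    ultimately have "vanishes (\<lambda>z. deriv U z * L z) a (p - 1 + 1)" by (rule vanishes_mult)
    then show ?thesis using h(3) by simp
  qed
  have hol: "(\<lambda>z. deriv U z * L z) holomorphic_on UNIV" by (intro holomorphic_intros U L) auto
  from U nc cd hol obtain Q where Q: "Q holomorphic_on UNIV" "\<And>z. deriv U z * L z = Q z * ((U z - c) * (U z - d)) ^ 1"
    by (rule entire_quotient_two_values[where n = 1]) (use van in blast)+
  show ?thesis using that[OF Q(1)] Q(2) by simp
qed

text \<open>The number \<open>deriv L a\<close> on the right is the same whether \<open>U\<close> is
  \<open>F\<close> or \<open>G\<close>. Eliminating it links the values of \<open>\<phi>\<close> and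
  \<open>\<psi>\<close> at a shared point through the two multiplicities.\<close>

lemma log_deriv_quotient_value:
  assumes U: "U holomorphic_on UNIV" and L: "L holomorphic_on UNIV" "L a = 0"
    and Q: "Q holomorphic_on UNIV" "\<And>z. deriv U z * L z = Q z * ((U z - c) * (U z - d))"
    and h: "h holomorphic_on UNIV" "h a \<noteq> 0" "\<And>z. U z - c = (z - a) ^ p * h z" "0 < p"
  shows "(c - d) * Q a = of_nat p * deriv L a"
proof -
  \<comment> \<open>The two sides of the equation for \<open>Q\<close> after cancelling
    \<open>(z - a) ^ (p - 1)\<close>. Both vanish at \<open>a\<close>, and comparing their
    derivatives there gives the value.\<close>
  define A where "A z = (of_nat p * h z + (z - a) * deriv h z) * L z" for z
  define B where "B z = Q z * (U z - d) * h z * (z - a)" for z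
  have "A z = B z" for z
  proof (cases "z = a")
    case False
    have "(z - a) ^ p = (z - a) ^ (p - 1) * (z - a)" using h(4) by (metis power_minus_mult)
    moreover have "deriv U z = (z - a) ^ (p - 1) * (of_nat p * h z + (z - a) * deriv h z)"
      using deriv_factored[OF h(1,3,4)] .
    ultimately have "(z - a) ^ (p - 1) * A z = (z - a) ^ (p - 1) * B z"
      using Q(2)[of z] by (simp add: h(3) A_def B_def mult_ac)
    then show ?thesis using False by simp
  qed (simp add: A_def B_def L)
  then have AB: "A = B" by auto
  have dL: "(L has_field_derivative deriv L a) (at a)" and dh: "(h has_field_derivative deriv h a) (at a)"
    and ddh: "(deriv h has_field_derivative deriv (deriv h) a) (at a)"
    and dQ: "(Q has_field_derivative deriv Q a) (at a)" and dU: "(U has_field_derivative deriv U a) (at a)"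
    using L h Q U by (auto intro!: holomorphic_derivI[OF _ open_UNIV] holomorphic_deriv)
  have "(A has_field_derivative of_nat p * h a * deriv L a) (at a)"
    unfolding A_def using dL dh ddh L(2) by (auto intro!: derivative_eq_intros)
  moreover have "(B has_field_derivative Q a * (U a - d) * h a) (at a)"
    unfolding B_def using dQ dU dh by (auto intro!: derivative_eq_intros)
  ultimately have "of_nat p * h a * deriv L a = Q a * (U a - d) * h a"
    using AB DERIV_unique by blast
  moreover have "U a = c" using h(3)[of a] h(4) by (simp add: power_0_left)
  ultimately show ?thesis using h(2) by (simp add: mult_ac)
qed

section \<open>Radii of regular growth\<close>

lemma tail_maximum:
  fixes x :: "nat \<Rightarrow> real"
  assumes "x \<longlonglongrightarrow> 0" "0 < x N"
  obtains n where "N \<le> n" "\<And>m. n \<le> m \<Longrightarrow> x m \<le> x n"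
proof -
  obtain M where M: "\<And>m. M \<le> m \<Longrightarrow> x m < x N"
    using order_tendstoD(2)[OF assms] by (auto simp: eventually_sequentially)
  \<comment> \<open>Beyond \<open>M\<close> all terms lie below \<open>x N\<close>, so a maximum
    over this finite range dominates the whole tail.\<close>
  define S where "S = {N..max N M}"
  have "finite (x ` S)" "x ` S \<noteq> {}" by (auto simp: S_def)
  then obtain n where n: "n \<in> S" "x n = Max (x ` S)" using Max_in by (metis imageE)
  have le: "x m \<le> x n" if "m \<in> S" for m using n(2) that \<open>finite (x ` S)\<close> by simp
  show ?thesis
  proof
    show "N \<le> n" using n(1) by (simp add: S_def)
    fix m assume m: "n \<le> m"
    show "x m \<le> x n"
    proof (cases "m \<le> max N M")
      case True then show ?thesis using m n(1) by (intro le) (auto simp: S_def)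
    next
      case False
      then have "x m < x N" by (intro M) auto
      also have "x N \<le> x n" by (intro le) (auto simp: S_def)
      finally show ?thesis by simp
    qed
  qed
qed

text \<open>Regular growth along a sequence: a maximum of the tail of \<open>t (2^n \<rho>) / D^n\<close> bounds
  \<open>t\<close> at all later dyadic multiples.\<close>

lemma polya_radii:
  fixes t :: "real \<Rightarrow> real"
  assumes growth: "eventually (\<lambda>r. t r \<le> r ^ K) at_top"
    and lower: "\<And>r. 1 \<le> r \<Longrightarrow> r \<notin> B \<Longrightarrow> ln r - C \<le> t r"
    and B: "countable B"
  obtains r :: "nat \<Rightarrow> real" and D where "filterlim r at_top sequentially" "\<And>k. 1 \<le> r k"
    "\<And>j k. 2 ^ j * r k \<notin> B" "\<And>j k. t (2 ^ j * r k) \<le> D ^ j * t (r k)"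
    "filterlim (\<lambda>k. t (r k)) at_top sequentially" "\<And>k. 0 < t (r k)"
proof -
  \<comment> \<open>All dyadic multiples of a starting radius \<open>\<rho>\<close> must avoid
    \<open>B\<close>. This excludes countably many \<open>\<rho>\<close> from an uncountable
    interval.\<close>
  have "countable (\<Union>n. (\<lambda>b. b / 2 ^ n) ` B)" using B by auto
  then have "\<not> {1..2::real} \<subseteq> (\<Union>n. (\<lambda>b. b / 2 ^ n) ` B)"
    using uncountable_closed_interval[of 1 "2::real"] countable_subset by (metis one_less_numeral_iff semiring_norm(76))
  then obtain \<rho> where \<rho>: "1 \<le> \<rho>" "\<rho> \<le> 2" "\<And>n. \<rho> \<notin> (\<lambda>b. b / 2 ^ n) ` B"
    unfolding subset_eq by (metis UN_I UNIV_I atLeastAtMost_iff)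
  have good: "2 ^ n * \<rho> \<notin> B" for n
  proof
    assume "2 ^ n * \<rho> \<in> B"
    then have "2 ^ n * \<rho> / 2 ^ n \<in> (\<lambda>b. b / 2 ^ n) ` B" by (rule imageI)
    then show False using \<rho>(3)[of n] by simp
  qed
  have ge1: "2 ^ n \<le> 2 ^ n * \<rho>" for n using \<rho>(1) by simp
  \<comment> \<open>One power of 2 beyond the growth exponent, so that
    \<open>t (2 ^ n * \<rho>) / D ^ n\<close> decays like \<open>(1 / 2) ^ n\<close>.\<close>
  define D :: real where "D = 2 ^ (K + 1)"
  define x where "x n = t (2 ^ n * \<rho>) / D ^ n" for n
  have lim: "filterlim (\<lambda>n. 2 ^ n * \<rho>) at_top sequentially"
  proof (rule filterlim_at_top_mono[OF filterlim_real_sequentially], rule always_eventually, rule allI)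
    fix n :: nat
    have "real n < 2 ^ n" by (rule of_nat_less_two_power)
    then show "real n \<le> 2 ^ n * \<rho>" using ge1[of n] by linarith
  qed
  have lnlim: "filterlim (\<lambda>n. ln (2 ^ n * \<rho>) - C) at_top sequentially"
    using filterlim_tendsto_add_at_top[OF tendsto_const[of "- C"] filterlim_compose[OF ln_at_top lim]] by simp
  have tlim: "filterlim (\<lambda>n. t (2 ^ n * \<rho>)) at_top sequentially"
  proof (rule filterlim_at_top_mono[OF lnlim], rule always_eventually, rule allI)
    fix n show "ln (2 ^ n * \<rho>) - C \<le> t (2 ^ n * \<rho>)"
      by (intro lower good order_trans[OF _ ge1]) simp
  qed
  then have "eventually (\<lambda>n. 0 < t (2 ^ n * \<rho>)) sequentially"
    by (simp add: filterlim_at_top_dense)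
  then obtain N0 where N0: "\<And>n. N0 \<le> n \<Longrightarrow> 0 < t (2 ^ n * \<rho>)" by (auto simp: eventually_sequentially)
  have "x \<longlonglongrightarrow> 0"
  proof (rule Lim_null_comparison)
    have "eventually (\<lambda>n. t (2 ^ n * \<rho>) \<le> (2 ^ n * \<rho>) ^ K) sequentially"
      using growth lim by (rule eventually_compose_filterlim)
    moreover have "eventually (\<lambda>n. N0 \<le> n) sequentially" by (rule eventually_ge_at_top)
    ultimately show "eventually (\<lambda>n. norm (x n) \<le> 2 ^ K * (1 / 2) ^ n) sequentially"
    proof eventually_elim
      case (elim n)
      have "x n \<le> (2 ^ n * \<rho>) ^ K / D ^ n"
        unfolding x_def by (intro divide_right_mono elim) (auto simp: D_def)
      also have "\<dots> \<le> (2 ^ n * 2) ^ K / D ^ n"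
        using \<rho> by (intro divide_right_mono power_mono mult_left_mono) (auto simp: D_def)
      also have "\<dots> = 2 ^ K * (1 / 2) ^ n"
      proof -
        have "D ^ n = (2 ^ n) ^ K * 2 ^ n"
          by (simp add: D_def power_mult_distrib mult.commute flip: power_mult)
        then show ?thesis by (simp add: power_mult_distrib power_one_over field_simps)
      qed
      finally have "x n \<le> 2 ^ K * (1 / 2) ^ n" .
      moreover have "0 \<le> x n" using N0[OF elim(2)] by (simp add: x_def D_def)
      ultimately show ?case by simp
    qed
    show "(\<lambda>n. 2 ^ K * (1 / 2) ^ n :: real) \<longlonglongrightarrow> 0"
      by (rule tendsto_mult_right_zero[OF LIMSEQ_power_zero]) simp
  qed
  then have "\<exists>n. max k N0 \<le> n \<and> (\<forall>m\<ge>n. x m \<le> x n)" for k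
    using tail_maximum[of x "max k N0"] N0[of "max k N0"] by (auto simp: x_def D_def)
  then obtain n where n: "\<And>k. max k N0 \<le> n k" "\<And>k m. n k \<le> m \<Longrightarrow> x m \<le> x (n k)" by metis
  have nlim: "filterlim n at_top sequentially"
    using n(1) by (auto simp: filterlim_at_top eventually_sequentially) (meson dual_order.trans max.boundedE)
  show ?thesis
  proof
    show "filterlim (\<lambda>k. 2 ^ n k * \<rho>) at_top sequentially" by (rule filterlim_compose[OF lim nlim])
    show "1 \<le> 2 ^ n k * \<rho>" for k by (rule order_trans[OF _ ge1]) simp
    show "2 ^ j * (2 ^ n k * \<rho>) \<notin> B" for j k
      using good[of "j + n k"] by (simp add: power_add mult.assoc)
    show "filterlim (\<lambda>k. t (2 ^ n k * \<rho>)) at_top sequentially" by (rule filterlim_compose[OF tlim nlim])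
    show "0 < t (2 ^ n k * \<rho>)" for k using n(1)[of k] by (intro N0) auto
    show "t (2 ^ j * (2 ^ n k * \<rho>)) \<le> D ^ j * t (2 ^ n k * \<rho>)" for j k
    proof -
      have "x (j + n k) \<le> x (n k)" by (rule n(2)) auto
      then have "t (2 ^ (j + n k) * \<rho>) \<le> x (n k) * D ^ (j + n k)"
        by (simp add: x_def[of "j + n k"] divide_le_eq D_def)
      also have "\<dots> = D ^ j * t (2 ^ n k * \<rho>)" by (simp add: x_def power_add D_def)
      finally show ?thesis by (simp add: power_add mult.assoc)
    qed
  qed
qed

section \<open>Small functions along a sequence of radii\<close>

locale growth_radii =
  fixes r T :: "nat \<Rightarrow> real"
  assumes r_ge_1: "1 \<le> r k"
    and r_top: "filterlim r at_top sequentially"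
    and T_top: "filterlim T at_top sequentially"
begin

definition small :: "(complex \<Rightarrow> complex) \<Rightarrow> bool" where
  "small h \<longleftrightarrow> (\<forall>k. continuous_on (sphere 0 (r k)) h) \<and> (\<lambda>k. nev_char h (r k)) \<in> o(T)"

text \<open>All dyadic multiples are included because an estimate at radius \<open>s\<close> uses
  the characteristic at \<open>2 * s\<close> and \<open>4 * s\<close>, and the property has to pass
  on to shifts.\<close>

definition dominated :: "(complex \<Rightarrow> complex) \<Rightarrow> bool" where
  "dominated U \<longleftrightarrow> (\<forall>j. (\<lambda>k. nev_char U (2 ^ j * r k)) \<in> O(T))"

text \<open>Absence of zeros on all circles in use makes quotients by \<open>U\<close> and the
  logarithm of its modulus continuous there.\<close>

definition clean :: "(complex \<Rightarrow> complex) \<Rightarrow> bool" where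
  "clean U \<longleftrightarrow> U holomorphic_on UNIV \<and> (\<forall>j k. 0 \<notin> U ` sphere 0 (2 ^ j * r k))"

lemma radius_ge_1: "1 \<le> 2 ^ j * r k"
  using mult_mono[of 1 "2 ^ j" 1 "r k"] r_ge_1[of k] by simp

lemma cleanD: "clean U \<Longrightarrow> U holomorphic_on UNIV" "clean U \<Longrightarrow> cmod z = 2 ^ j * r k \<Longrightarrow> U z \<noteq> 0"
  by (force simp: clean_def)+

lemma clean_nonzero: "clean U \<Longrightarrow> cmod z = r k \<Longrightarrow> U z \<noteq> 0"
  using cleanD(2)[of U z 0 k] by simp

lemma T_pos: "eventually (\<lambda>k. c < T k) sequentially"
  using T_top by (simp add: filterlim_at_top_dense)

lemma const_smallo_T: "(\<lambda>_. c :: real) \<in> o(T)"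
proof (rule landau_o.smallI)
  fix e :: real assume e: "0 < e"
  from T_pos[of "\<bar>c\<bar> / e"] T_pos[of 0]
  show "eventually (\<lambda>k. norm c \<le> e * norm (T k)) sequentially"
    by eventually_elim (use e in \<open>simp add: divide_less_eq mult.commute\<close>)
qed

lemma T_le_smallo: "e \<in> o(T) \<Longrightarrow> (\<And>k. T k \<le> e k) \<Longrightarrow> False"
proof -
  assume e: "e \<in> o(T)" "\<And>k. T k \<le> e k"
  have "eventually (\<lambda>k. norm (e k) \<le> 1/2 * norm (T k)) sequentially"
    by (rule landau_o.smallD[OF e(1)]) simp
  with T_pos[of 0] have "eventually (\<lambda>k. False) sequentially"
  proof eventually_elim
    case (elim k)
    then show ?case using e(2)[of k] by auto
  qed
  then show False by simp
qed

lemma smallo_T_mono: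
  assumes "e \<in> o(T)" "\<And>k. 0 \<le> f k" "\<And>k. f k \<le> e k"
  shows "f \<in> o(T)"
proof -
  have "f \<in> O(e)"
    by (rule landau_o.bigI[of 1]) (use assms(2,3) in \<open>auto intro!: always_eventually order_trans[OF _ abs_ge_self]\<close>)
  then show ?thesis using assms(1) by (rule landau_o.big_small_trans)
qed

lemma bigo_T_mono:
  assumes "e \<in> O(T)" "\<And>k. 0 \<le> f k" "\<And>k. f k \<le> e k"
  shows "f \<in> O(T)"
proof -
  have "f \<in> O(e)"
    by (rule landau_o.bigI[of 1]) (use assms(2,3) in \<open>auto intro!: always_eventually order_trans[OF _ abs_ge_self]\<close>)
  then show ?thesis using assms(1) by (rule landau_o.big_trans)
qed

lemma eventually_smallo_T_mono:
  assumes "e \<in> o(T)" "eventually (\<lambda>k. 0 \<le> f k \<and> f k \<le> e k) sequentially"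
  shows "f \<in> o(T)"
proof -
  have "f \<in> O(e)"
    by (rule landau_o.bigI[of 1]) (use assms(2) in \<open>auto elim!: eventually_mono\<close>)
  then show ?thesis using assms(1) by (rule landau_o.big_small_trans)
qed

text \<open>Applied with \<open>x\<close> the product of all \<open>max 1 (cmod (h z))\<close>, whose logarithm is the sum of the
  \<open>log_plus (cmod (h z))\<close>.\<close>

lemma circle_mean_small_bound:
  assumes hs: "\<And>h. h \<in> set hs \<Longrightarrow> small h" and g: "\<And>k. continuous_on (sphere 0 (r k)) g"
    and bound: "\<And>k z x. cmod z = r k \<Longrightarrow> 1 \<le> x \<Longrightarrow> (\<And>h. h \<in> set hs \<Longrightarrow> cmod (h z) \<le> x) \<Longrightarrow> g z \<le> C + c * ln x"
  obtains e where "e \<in> o(T)" "\<And>k. circle_mean g (r k) \<le> e k"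
proof
  define e where "e k = C + c * (\<Sum>h\<leftarrow>hs. nev_char h (r k))" for k
  have "(\<lambda>k. \<Sum>h\<leftarrow>hs. nev_char h (r k)) \<in> o(T)"
    using hs by (induction hs) (auto simp: small_def intro!: sum_in_smallo)
  then show "e \<in> o(T)"
    unfolding e_def by (intro sum_in_smallo const_smallo_T) (cases "c = 0"; simp)
  fix k
  have r: "0 \<le> r k" using r_ge_1[of k] by simp
  have cont: "continuous_on (sphere 0 (r k)) (\<lambda>z. \<Sum>h\<leftarrow>hs. log_plus (cmod (h z)))"
    using hs by (intro continuous_on_sum_list continuous_intros) (auto simp: small_def)
  have "circle_mean g (r k) \<le> circle_mean (\<lambda>z. C + c * (\<Sum>h\<leftarrow>hs. log_plus (cmod (h z)))) (r k)"
  proof (rule circle_mean_mono[OF g _ r])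
    show "continuous_on (sphere 0 (r k)) (\<lambda>z. C + c * (\<Sum>h\<leftarrow>hs. log_plus (cmod (h z))))"
      by (intro continuous_intros cont)
    fix z assume z: "cmod z = r k"
    define x where "x = exp (\<Sum>h\<leftarrow>hs. log_plus (cmod (h z)))"
    have "g z \<le> C + c * ln x"
    proof (rule bound[OF z])
      show "1 \<le> x" by (auto simp: x_def intro!: sum_list_nonneg)
      fix h assume h: "h \<in> set hs"
      have "log_plus (cmod (h z)) \<le> (\<Sum>h\<leftarrow>hs. log_plus (cmod (h z)))"
        using h by (intro member_le_sum_list) auto
      then have "exp (log_plus (cmod (h z))) \<le> x" by (simp add: x_def)
      moreover have "cmod (h z) \<le> exp (log_plus (cmod (h z)))" by (simp add: log_plus_eq_ln_max)
      ultimately show "cmod (h z) \<le> x" by linarith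
    qed
    then show "g z \<le> C + c * (\<Sum>h\<leftarrow>hs. log_plus (cmod (h z)))" by (simp add: x_def)
  qed
  also have "\<dots> = e k"
  proof -
    have "circle_mean (\<lambda>z. \<Sum>h\<leftarrow>hs. log_plus (cmod (h z))) (r k) = (\<Sum>h\<leftarrow>hs. nev_char h (r k))"
      unfolding nev_char_eq using hs r
      by (intro circle_mean_sum_list continuous_intros) (auto simp: small_def)
    then show ?thesis
      using cont r by (simp add: e_def circle_mean_add continuous_on_mult continuous_on_const)
  qed
  finally show "circle_mean g (r k) \<le> e k" .
qed

text \<open>The logarithm turns the exponent of a polynomial bound into a constant factor, so
  smallness can be read off from a pointwise inequality.\<close>

lemma small_polynomial_bound:
  assumes hs: "\<And>h. h \<in> set hs \<Longrightarrow> small h" and g: "\<And>k. continuous_on (sphere 0 (r k)) g" and C: "1 \<le> C"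
    and bound: "\<And>k z x. cmod z = r k \<Longrightarrow> 1 \<le> x \<Longrightarrow> (\<And>h. h \<in> set hs \<Longrightarrow> cmod (h z) \<le> x) \<Longrightarrow> cmod (g z) \<le> C * x ^ c"
  shows "small g"
proof -
  have key: "log_plus (cmod (g z)) \<le> ln C + c * ln x"
    if "cmod z = r k" "1 \<le> x" "\<And>h. h \<in> set hs \<Longrightarrow> cmod (h z) \<le> x" for k z x
  proof -
    have 1: "1 \<le> C * x ^ c" using C that(2) mult_mono[of 1 C 1 "x ^ c"] by simp
    have "log_plus (cmod (g z)) \<le> log_plus (C * x ^ c)" using bound[of z k x] that by (intro log_plus_mono) auto
    also have "\<dots> = ln C + c * ln x" using 1 C that(2) by (simp add: log_plus_eq_ln_max ln_mult ln_realpow)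
    finally show ?thesis .
  qed
  obtain e where e: "e \<in> o(T)" "\<And>k. circle_mean (\<lambda>z. log_plus (cmod (g z))) (r k) \<le> e k"
  proof (rule circle_mean_small_bound[of hs "\<lambda>z. log_plus (cmod (g z))" "ln C" c])
    show "log_plus (cmod (g z)) \<le> ln C + c * ln x"
      if "cmod z = r k" "1 \<le> x" "\<And>h. h \<in> set hs \<Longrightarrow> cmod (h z) \<le> x" for k z x
      using that by (rule key)
  qed (use hs g in \<open>auto intro: continuous_on_log_plus\<close>)
  have "0 \<le> nev_char g (r k)" for k using g r_ge_1[of k] by (intro nev_char_nonneg) auto
  then have "(\<lambda>k. nev_char g (r k)) \<in> o(T)"
    using e(2) by (intro smallo_T_mono[OF e(1)]) (auto simp: nev_char_eq)
  then show ?thesis using g by (simp add: small_def)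
qed

lemma dominated_sum_bigo:
  assumes "dominated U"
  shows "(\<lambda>k. nev_char U (2 * (2 ^ j * r k)) + nev_char U (4 * (2 ^ j * r k)) + 1) \<in> O(T)"
proof -
  have "(\<lambda>k. nev_char U (2 ^ (j + 1) * r k) + nev_char U (2 ^ (j + 2) * r k) + 1) \<in> O(T)"
    using assms unfolding dominated_def
    by (intro sum_in_bigo landau_o.small_imp_big[OF const_smallo_T]) blast+
  then show ?thesis by (simp add: mult_ac)
qed

lemma clean_circles:
  assumes "clean U"
  shows "0 \<notin> U ` (sphere 0 (2 ^ j * r k) \<union> sphere 0 (2 * (2 ^ j * r k)) \<union> sphere 0 (4 * (2 ^ j * r k)))"
proof
  assume "0 \<in> U ` (sphere 0 (2 ^ j * r k) \<union> sphere 0 (2 * (2 ^ j * r k)) \<union> sphere 0 (4 * (2 ^ j * r k)))"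
  then obtain z where z: "U z = 0"
    "cmod z = 2 ^ j * r k \<or> cmod z = 2 ^ (j + 1) * r k \<or> cmod z = 2 ^ (j + 2) * r k"
    by (auto simp: image_iff mult_ac)
  then show False using cleanD(2)[OF assms] by blast
qed

lemma clean_nonzero_point: "clean U \<Longrightarrow> U (of_real (r 0)) \<noteq> 0"
  using clean_nonzero[of U "of_real (r 0)" 0] r_ge_1[of 0] by simp

lemma small_log_deriv:
  assumes "clean U" "dominated U"
  shows "small (\<lambda>z. deriv U z / U z)"
proof -
  define S where "S k = nev_char U (2 * r k) + nev_char U (4 * r k) + 1" for k
  obtain C where C: "0 \<le> C" "\<And>r. 1 \<le> r \<Longrightarrow> 0 \<notin> U ` (sphere 0 r \<union> sphere 0 (2*r) \<union> sphere 0 (4*r)) \<Longrightarrow>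
     nev_char (\<lambda>z. deriv U z / U z) r \<le> 2 * ln (1 + C * (nev_char U (2*r) + nev_char U (4*r) + 1)) + C"
    by (rule nev_char_log_deriv[OF cleanD(1)[OF assms(1)] clean_nonzero_point[OF assms(1)]]) (rule that)
  have cont: "continuous_on (sphere 0 (r k)) (\<lambda>z. deriv U z / U z)" for k
    using clean_nonzero[OF assms(1)] cleanD(1)[OF assms(1)]
    by (intro continuous_intros continuous_on_entire continuous_on_entire_deriv) auto
  have S0: "0 \<le> S k" for k
    unfolding S_def using cleanD(1)[OF assms(1)] r_ge_1[of k]
    by (intro add_nonneg_nonneg nev_char_nonneg continuous_on_entire) auto
  have "S \<in> O(T)" using dominated_sum_bigo[OF assms(2), of 0] by (simp add: S_def[abs_def])
  then obtain c where c: "0 < c" "eventually (\<lambda>k. norm (S k) \<le> c * norm (T k)) sequentially"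
    by (auto elim: landau_o.bigE)
  \<comment> \<open>The logarithm of \<open>1 + C * S k\<close> is bounded by a square root; this
    crude estimate is already \<open>o(T)\<close>.\<close>
  have "(\<lambda>k. sqrt (T k)) \<in> o(T)"
  proof (rule landau_o.smallI)
    fix e :: real assume e: "0 < e"
    from T_pos[of "1 / e^2"] T_pos[of 0]
    show "eventually (\<lambda>k. norm (sqrt (T k)) \<le> e * norm (T k)) sequentially"
    proof eventually_elim
      case (elim k)
      have "sqrt (T k) = T k / sqrt (T k)" using elim(2) by (simp add: real_div_sqrt)
      also have "\<dots> \<le> T k / (1 / e)"
      proof (intro divide_left_mono)
        have "sqrt (1 / e^2) \<le> sqrt (T k)" using elim(1) by simp
        then show "1 / e \<le> sqrt (T k)" using e by (simp add: real_sqrt_divide)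
      qed (use elim e in auto)
      finally show ?case using elim e by (simp add: mult.commute)
    qed
  qed
  then have "(\<lambda>k. 4 * sqrt (C * c) * sqrt (T k) + C) \<in> o(T)"
    by (intro sum_in_smallo const_smallo_T) (cases "4 * sqrt (C * c) = 0"; simp)
  moreover have "eventually (\<lambda>k. 0 \<le> nev_char (\<lambda>z. deriv U z / U z) (r k) \<and>
      nev_char (\<lambda>z. deriv U z / U z) (r k) \<le> 4 * sqrt (C * c) * sqrt (T k) + C) sequentially"
    using c(2) T_pos[of 0]
  proof eventually_elim
    case (elim k)
    have "nev_char (\<lambda>z. deriv U z / U z) (r k) \<le> 2 * ln (1 + C * S k) + C"
      unfolding S_def using clean_circles[OF assms(1), of 0 k] r_ge_1[of k] by (intro C(2)) auto
    also have "ln (1 + C * S k) \<le> 2 * sqrt (C * S k)" using C(1) S0[of k] by (intro ln_le_sqrt) auto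
    also have "sqrt (C * S k) \<le> sqrt (C * (c * T k))"
      using elim C(1) S0[of k] by (intro real_sqrt_le_mono mult_left_mono) auto
    also have "\<dots> = sqrt (C * c) * sqrt (T k)" by (simp add: real_sqrt_mult)
    finally show ?case
      using nev_char_nonneg[OF cont, of k] r_ge_1[of k] by simp
  qed
  ultimately have "(\<lambda>k. nev_char (\<lambda>z. deriv U z / U z) (r k)) \<in> o(T)"
    by (rule eventually_smallo_T_mono)
  then show ?thesis using cont by (simp add: small_def)
qed

text \<open>The factor \<open>1 / sqrt s\<close> turns \<open>O(T)\<close> into \<open>o(T)\<close>.
  Every dyadic multiple is treated because \<open>dominated_shift\<close> needs them all.\<close>

lemma shift_quot_smallo:
  assumes "clean U" "dominated U"
  shows "(\<lambda>k. nev_char (\<lambda>z. U (z + \<eta>) / U z) (2 ^ j * r k)) \<in> o(T)"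
proof -
  define s where "s k = 2 ^ j * r k" for k
  define S where "S k = nev_char U (2 * s k) + nev_char U (4 * s k) + 1" for k
  obtain C where C: "0 \<le> C" "\<And>r. 1 \<le> r \<Longrightarrow> 2 * cmod \<eta> \<le> r \<Longrightarrow>
     0 \<notin> U ` (sphere 0 r \<union> sphere 0 (2*r) \<union> sphere 0 (4*r)) \<Longrightarrow>
     nev_char (\<lambda>z. U (z + \<eta>) / U z) r \<le> C * (nev_char U (2*r) + nev_char U (4*r) + 1) / sqrt r"
    by (rule nev_char_shift_quot[OF cleanD(1)[OF assms(1)] clean_nonzero_point[OF assms(1)], of \<eta>]) (rule that)
  have cont: "continuous_on (sphere 0 (s k)) (\<lambda>z. U (z + \<eta>) / U z)" for k
    using cleanD[OF assms(1)] unfolding s_def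
    by (intro continuous_intros continuous_on_entire entire_shift) auto
  have s1: "1 \<le> s k" for k unfolding s_def by (rule radius_ge_1)
  have S0: "0 \<le> S k" for k
    unfolding S_def using cleanD(1)[OF assms(1)] s1[of k]
    by (intro add_nonneg_nonneg nev_char_nonneg continuous_on_entire) auto
  have SO: "S \<in> O(T)" using dominated_sum_bigo[OF assms(2), of j] by (simp add: S_def[abs_def] s_def)
  have s_top: "filterlim s at_top sequentially"
  proof (rule filterlim_at_top_mono[OF r_top], rule always_eventually, rule allI)
    fix k show "r k \<le> s k" using r_ge_1[of k] by (simp add: s_def)
  qed
  have "((\<lambda>k. inverse (sqrt (s k))) \<longlongrightarrow> 0) sequentially"
    by (rule tendsto_inverse_0_at_top[OF filterlim_compose[OF sqrt_at_top s_top]])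
  then have "(\<lambda>k. inverse (sqrt (s k))) \<in> o(\<lambda>_. 1 :: real)" by (intro smalloI_tendsto) auto
  then have "(\<lambda>k. S k * inverse (sqrt (s k))) \<in> o(\<lambda>k. T k * 1)"
    by (rule landau_o.big_small_mult[OF SO])
  then have "(\<lambda>k. C * (S k * inverse (sqrt (s k)))) \<in> o(T)" by (cases "C = 0") auto
  moreover have "eventually (\<lambda>k. 0 \<le> nev_char (\<lambda>z. U (z + \<eta>) / U z) (s k) \<and>
      nev_char (\<lambda>z. U (z + \<eta>) / U z) (s k) \<le> C * (S k * inverse (sqrt (s k)))) sequentially"
  proof -
    have "eventually (\<lambda>k. 2 * cmod \<eta> \<le> s k) sequentially"
      using s_top by (simp add: filterlim_at_top)
    then show ?thesis
    proof eventually_elim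
      case (elim k)
      have "nev_char (\<lambda>z. U (z + \<eta>) / U z) (s k) \<le> C * S k / sqrt (s k)"
        unfolding S_def using clean_circles[OF assms(1), of j k] s1[of k] elim by (intro C(2)) (auto simp: s_def)
      then show ?case
        using nev_char_nonneg[OF cont, of k] s1[of k] by (simp add: field_simps)
    qed
  qed
  ultimately show ?thesis unfolding s_def by (rule eventually_smallo_T_mono)
qed

lemma small_shift_quot:
  assumes "clean U" "dominated U"
  shows "small (\<lambda>z. U (z + \<eta>) / U z)"
  unfolding small_def
proof
  show "\<forall>k. continuous_on (sphere 0 (r k)) (\<lambda>z. U (z + \<eta>) / U z)"
    using clean_nonzero[OF assms(1)] cleanD(1)[OF assms(1)]
    by (intro allI continuous_on_divide continuous_on_entire entire_shift) auto
  show "(\<lambda>k. nev_char (\<lambda>z. U (z + \<eta>) / U z) (r k)) \<in> o(T)"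
    using shift_quot_smallo[OF assms, of \<eta> 0] by simp
qed

lemma dominated_combine:
  assumes U: "dominated U" "dominated V"
    and cont: "\<And>j k. continuous_on (sphere 0 (2 ^ j * r k)) U" "\<And>j k. continuous_on (sphere 0 (2 ^ j * r k)) V"
      "\<And>j k. continuous_on (sphere 0 (2 ^ j * r k)) W"
    and le: "\<And>z j k. cmod z = 2 ^ j * r k \<Longrightarrow> log_plus (cmod (W z)) \<le> log_plus (cmod (U z)) + log_plus (cmod (V z)) + c"
  shows "dominated W"
  unfolding dominated_def
proof
  fix j
  have "(\<lambda>k. nev_char U (2 ^ j * r k) + nev_char V (2 ^ j * r k) + c) \<in> O(T)"
    using U by (intro sum_in_bigo landau_o.small_imp_big[OF const_smallo_T]) (auto simp: dominated_def)
  then show "(\<lambda>k. nev_char W (2 ^ j * r k)) \<in> O(T)"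
  proof (rule bigo_T_mono)
    fix k
    have s: "0 \<le> 2 ^ j * r k" using radius_ge_1[of j k] by linarith
    show "0 \<le> nev_char W (2 ^ j * r k)" by (rule nev_char_nonneg[OF cont(3) s])
    have "nev_char W (2 ^ j * r k) \<le> circle_mean (\<lambda>z. log_plus (cmod (U z)) + log_plus (cmod (V z)) + c) (2 ^ j * r k)"
      unfolding nev_char_eq using le s by (intro circle_mean_mono continuous_intros cont) auto
    also have "\<dots> = nev_char U (2 ^ j * r k) + nev_char V (2 ^ j * r k) + c"
      unfolding nev_char_eq using s
      by (simp add: circle_mean_add continuous_on_add continuous_on_log_plus cont continuous_on_const)
    finally show "nev_char W (2 ^ j * r k) \<le> nev_char U (2 ^ j * r k) + nev_char V (2 ^ j * r k) + c" .
  qed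
qed

lemma dominated_shift:
  assumes "clean U" "dominated U"
  shows "dominated (\<lambda>z. U (z + \<eta>))"
proof (rule dominated_combine[where U = U and V = "\<lambda>z. U (z + \<eta>) / U z" and c = 0])
  show "dominated (\<lambda>z. U (z + \<eta>) / U z)"
    using shift_quot_smallo[OF assms] by (auto simp: dominated_def intro: landau_o.small_imp_big)
  show "continuous_on (sphere 0 (2 ^ j * r k)) (\<lambda>z. U (z + \<eta>) / U z)" for j k
    using cleanD[OF assms(1)] by (intro continuous_intros continuous_on_entire entire_shift) auto
  fix z j k assume "cmod z = 2 ^ j * r k"
  then have "U z \<noteq> 0" using cleanD[OF assms(1)] by blast
  then have "cmod (U (z + \<eta>)) = cmod (U z) * cmod (U (z + \<eta>) / U z)" by (simp flip: norm_mult)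
  then show "log_plus (cmod (U (z + \<eta>))) \<le> log_plus (cmod (U z)) + log_plus (cmod (U (z + \<eta>) / U z)) + 0"
    using log_plus_mult[of "cmod (U z)" "cmod (U (z + \<eta>) / U z)"] by simp
qed (use assms cleanD(1)[OF assms(1)] in \<open>auto intro!: continuous_on_entire entire_shift\<close>)

lemma dominated_const: "dominated (\<lambda>_. c)"
  using landau_o.small_imp_big[OF const_smallo_T] by (auto simp: dominated_def nev_char_eq)

lemma dominated_diff:
  assumes "dominated U" "dominated V" "U holomorphic_on UNIV" "V holomorphic_on UNIV"
  shows "dominated (\<lambda>z. U z - V z)"
proof (rule dominated_combine[where U = U and V = V and c = "ln 2"])
  fix z :: complex
  have "log_plus (cmod (U z - V z)) \<le> log_plus (cmod (U z) + cmod (V z))"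
    by (intro log_plus_mono norm_triangle_ineq4) auto
  also have "\<dots> \<le> log_plus (cmod (U z)) + log_plus (cmod (V z)) + ln 2" by (intro log_plus_add) auto
  finally show "log_plus (cmod (U z - V z)) \<le> log_plus (cmod (U z)) + log_plus (cmod (V z)) + ln 2" .
qed (use assms in \<open>auto intro!: continuous_on_entire holomorphic_intros\<close>)

text \<open>Jensen's inequality with the term \<open>m * ln (r k) \<ge> 0\<close> dropped. An upper
  bound of the form \<open>o(T) - T\<close> for such a mean is thereby impossible.\<close>

lemma clean_circle_mean_lower:
  assumes "clean X"
  obtains C where "\<And>k. C \<le> circle_mean (\<lambda>z. ln (cmod (X z))) (r k)"
proof -
  obtain m h where h: "h holomorphic_on UNIV" "h 0 \<noteq> 0" "\<And>z. X z = (z - 0) ^ m * h z"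
    by (rule entire_factor_zero[OF cleanD(1)[OF assms] clean_nonzero_point[OF assms], of 0]) (rule that)
  have "ln (cmod (h 0)) \<le> circle_mean (\<lambda>z. ln (cmod (X z))) (r k)" for k
  proof -
    have "ln (cmod (h 0)) \<le> m * ln (r k) + ln (cmod (h 0))" using r_ge_1[of k] by simp
    also have "\<dots> \<le> circle_mean (\<lambda>z. ln (cmod (X z))) (r k)"
    proof (rule jensen_lower_bound[OF h(1,2)])
      show "0 \<notin> X ` sphere 0 (r k)" using clean_nonzero[OF assms] by force
    qed (use h(3) r_ge_1[of k] in auto)
    finally show ?thesis .
  qed
  then show ?thesis by (rule that)
qed

end

section \<open>Pointwise bounds in terms of small quotients\<close>

text \<open>Partial fractions control the quotient \<open>Q\<close> itself, and
  \<open>U * Q = U' / (U - d) + c * Q\<close> controls it with the additional factor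
  \<open>U\<close>. This gain of \<open>max 1 (cmod U)\<close> drives the later estimates.\<close>

lemma two_pole_bound:
  fixes U U' c d :: complex and x :: real
  assumes x: "1 \<le> x" and U: "U \<noteq> c" "U \<noteq> d" "c \<noteq> d" "cmod (U' / (U - c)) \<le> x" "cmod (U' / (U - d)) \<le> x"
  shows "cmod (U' / ((U - c) * (U - d))) * max 1 (cmod U) \<le> (1 + 2 * (1 + cmod c) / cmod (c - d)) * x"
proof -
  define Q where "Q = U' / ((U - c) * (U - d))"
  have ne: "U - c \<noteq> 0" "U - d \<noteq> 0" "c - d \<noteq> 0" using U by auto
  have "Q = (U' / (U - c) - U' / (U - d)) / (c - d)"
    using ne unfolding Q_def by (simp add: divide_simps) (simp add: algebra_simps)
  then have "cmod Q = cmod (U' / (U - c) - U' / (U - d)) / cmod (c - d)" by (simp only: norm_divide)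
  also have "\<dots> \<le> (x + x) / cmod (c - d)"
    using norm_triangle_ineq4[of "U' / (U - c)" "U' / (U - d)"] U(4,5)
    by (intro divide_right_mono) auto
  finally have "cmod Q \<le> (x + x) / cmod (c - d)" .
  then have Q: "cmod Q \<le> 2 / cmod (c - d) * x" by simp
  have "U * Q = U' / (U - d) + c * Q"
    using ne unfolding Q_def by (simp add: divide_simps) (simp add: algebra_simps)
  then have "cmod U * cmod Q \<le> cmod (U' / (U - d)) + cmod c * cmod Q"
    by (metis norm_mult norm_triangle_ineq)
  also have "\<dots> \<le> x + cmod c * (2 / cmod (c - d) * x)"
    using U Q by (intro add_mono mult_left_mono) auto
  finally have "cmod U * cmod Q \<le> x + cmod c * (2 / cmod (c - d) * x)" .
  moreover have "0 \<le> cmod c * (2 / cmod (c - d) * x)" "0 \<le> 2 / cmod (c - d) * x" using x by auto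
  moreover define S where "S = x + 2 / cmod (c - d) * x + cmod c * (2 / cmod (c - d) * x)"
  ultimately have "cmod U * cmod Q \<le> S" "cmod Q \<le> S" using Q x by linarith+
  then have "cmod Q * max 1 (cmod U) \<le> S" by (simp add: max_def mult.commute)
  also have "S = (1 + 2 * (1 + cmod c) / cmod (c - d)) * x" using ne by (simp add: S_def field_simps)
  finally show ?thesis by (simp add: Q_def)
qed

text \<open>With \<open>G / F = (F + G) / F - 1\<close> and partial fractions for
  \<open>\<beta> / (F * (F - 1))\<close>, \<open>\<phi>\<close> becomes a polynomial in two
  logarithmic derivatives and a shift quotient.\<close>

lemma phi_bound:
  fixes F F' G \<phi> \<kappa> \<beta> :: complex and x :: real
  assumes x: "1 \<le> x" and F: "F \<noteq> 0" "F \<noteq> 1" and \<phi>: "F' * (\<kappa> * F + \<beta> - G) = \<phi> * ((F - 1) * (F - 0))"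
    and b: "cmod (F' / F) \<le> x" "cmod (F' / (F - 1)) \<le> x" "cmod ((F + G) / F) \<le> x"
  shows "cmod \<phi> \<le> 2 * (cmod \<kappa> + cmod \<beta> + 2) * x ^ 2"
proof -
  have ne: "F - 1 \<noteq> 0" using F by auto
  have "\<phi> = F' * (\<kappa> * F + \<beta> - G) / ((F - 1) * F)" using \<phi> F ne by (simp add: field_simps)
  also have "\<dots> = F' / (F - 1) * (\<kappa> + 1 - (F + G) / F) + \<beta> * (F' / (F - 1) - F' / F)"
    using F ne by (simp add: divide_simps) (simp add: algebra_simps)
  also have "cmod \<dots> \<le> cmod (F' / (F - 1)) * cmod (\<kappa> + 1 - (F + G) / F) + cmod \<beta> * cmod (F' / (F - 1) - F' / F)"
    by (metis norm_mult norm_triangle_ineq)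
  also have "\<dots> \<le> x * (cmod \<kappa> + 1 + x) + cmod \<beta> * (x + x)"
  proof (intro add_mono mult_mono mult_left_mono)
    show "cmod (\<kappa> + 1 - (F + G) / F) \<le> cmod \<kappa> + 1 + x"
      using norm_triangle_ineq4[of "\<kappa> + 1" "(F + G) / F"] norm_triangle_ineq[of \<kappa> 1] b(3) by simp
    show "cmod (F' / (F - 1) - F' / F) \<le> x + x"
      using norm_triangle_ineq4[of "F' / (F - 1)" "F' / F"] b by linarith
  qed (use x b in auto)
  also have "\<dots> = (cmod \<kappa> + 2 * cmod \<beta> + 1) * x + x^2" by (simp add: algebra_simps power2_eq_square)
  also have "\<dots> \<le> (cmod \<kappa> + 2 * cmod \<beta> + 1) * x^2 + x^2"
    using x by (intro add_mono mult_left_mono) (auto simp: power2_eq_square)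
  also have "\<dots> = (cmod \<kappa> + 2 * cmod \<beta> + 2) * x^2" by (simp add: algebra_simps)
  also have "\<dots> \<le> 2 * (cmod \<kappa> + cmod \<beta> + 2) * x ^ 2" by (intro mult_right_mono) auto
  finally show ?thesis .
qed

text \<open>Both \<open>\<phi>\<close> and its shift are close to \<open>\<kappa>\<close> times a logarithmic derivative where \<open>F\<close> is
  much larger than \<open>G\<close>, and there the two logarithmic derivatives are close to each other.\<close>

lemma phi_shift_bound:
  fixes F F' G G' G2 \<phi> \<phi>2 \<kappa> \<beta> :: complex and x :: real
  assumes x: "1 \<le> x" and ne: "F \<noteq> 0" "F \<noteq> 1" "F + G \<noteq> 0" "F + G \<noteq> 1" "G \<noteq> 0"
    and \<phi>: "F' * (\<kappa> * F + \<beta> - G) = \<phi> * ((F - 1) * (F - 0))"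
    and \<phi>2: "(F' + G') * (\<kappa> * (F + G) + \<beta> - G2) = \<phi>2 * ((F + G - 1) * (F + G - 0))"
    and b: "cmod (F' / F) \<le> x" "cmod (F' / (F - 1)) \<le> x" "cmod ((F' + G') / (F + G)) \<le> x"
      "cmod ((F' + G') / (F + G - 1)) \<le> x" "cmod (G' / G) \<le> x" "cmod ((F + G) / F) \<le> x"
      "cmod (F / (F + G)) \<le> x" "cmod (G2 / G) \<le> x" "cmod ((F + G + G2) / (F + G)) \<le> x"
  shows "cmod (\<phi>2 - \<phi>) * max 1 (cmod F) \<le> 4 * (cmod \<kappa> + cmod \<beta> + 2) * x ^ 3 * max 1 (cmod G)"
proof -
  define M where "M = cmod \<kappa> + cmod \<beta> + 2"
  define g where "g = max 1 (cmod G)"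
  have M: "1 \<le> M" by (simp add: M_def)
  have g: "1 \<le> g" "cmod G \<le> g" by (auto simp: g_def)
  have x2: "x \<le> x^2" "x^2 \<le> x^3" "x \<le> x^3"
    using x power_increasing[of 1 2 x] power_increasing[of 2 3 x] power_increasing[of 1 3 x] by auto
  have F1: "F - 1 \<noteq> 0" "F + G - 1 \<noteq> 0" using ne by auto
  \<comment> \<open>This crude bound serves where \<open>cmod F \<le> 1\<close>, the maximum being 1
    there.\<close>
  have "cmod (\<phi>2 - \<phi>) \<le> cmod \<phi>2 + cmod \<phi>" by (rule norm_triangle_ineq4)
  also have "\<dots> \<le> 2 * M * x^2 + 2 * M * x^2"
    unfolding M_def using phi_bound[OF x ne(1,2) \<phi>] phi_bound[OF x ne(3,4) \<phi>2] b by (intro add_mono) auto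
  also have "\<dots> \<le> 4 * M * x^3 * 1" using x2 M by simp
  also have "\<dots> \<le> 4 * M * x^3 * g" using g x M by (intro mult_left_mono) auto
  finally have le1: "cmod (\<phi>2 - \<phi>) \<le> 4 * M * x^3 * g" .
  \<comment> \<open>\<open>A\<close> and \<open>B\<close> are the errors in replacing
    \<open>\<phi> * F\<close> and \<open>\<phi>2 * F\<close> by \<open>\<kappa>\<close> times a
    logarithmic derivative times \<open>F\<close>; \<open>D\<close> is the difference of these main
    terms. Each is at most \<open>max 1 (cmod G)\<close> up to powers of \<open>x\<close>.\<close>
  define A where "A = F' / (F - 1) * (\<kappa> + \<beta> - G)"
  define B where "B = (F' + G') / (F + G - 1) * (F / (F + G)) * (\<kappa> + \<beta> - G2 / G * G)"
  define D where "D = \<kappa> * G * (G' / G - F' / F) * (F / (F + G))"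
  have A: "\<phi> * F = \<kappa> * F' + A"
  proof -
    have "\<phi> * F = F' * (\<kappa> * F + \<beta> - G) / (F - 1)" using \<phi> F1 by (simp add: field_simps)
    also have "\<dots> = \<kappa> * F' + A" unfolding A_def using F1 by (simp add: divide_simps) (simp add: algebra_simps)
    finally show ?thesis .
  qed
  have B: "\<phi>2 * F = \<kappa> * (F' + G') * F / (F + G) + B"
  proof -
    have "\<phi>2 * F = (F' + G') * (\<kappa> * (F + G) + \<beta> - G2) / ((F + G - 1) * (F + G)) * F"
    proof -
      have "\<phi>2 = (F' + G') * (\<kappa> * (F + G) + \<beta> - G2) / ((F + G - 1) * (F + G))"
        using \<phi>2 F1 ne by (simp add: eq_divide_eq)
      then show ?thesis by simp
    qed
    also have "\<dots> = \<kappa> * (F' + G') * F / (F + G) + B"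
      unfolding B_def using F1 ne by (simp add: divide_simps) (simp add: algebra_simps)
    finally show ?thesis .
  qed
  have D: "\<kappa> * (F' + G') * F / (F + G) - \<kappa> * F' = D"
    unfolding D_def using ne by (simp add: divide_simps) (simp add: algebra_simps)
  have "(\<phi>2 - \<phi>) * F = D + B - A" using A B D by (simp add: algebra_simps)
  then have sum: "cmod (\<phi>2 - \<phi>) * cmod F \<le> cmod D + cmod B + cmod A"
    by (metis norm_mult norm_triangle_le_diff norm_triangle_ineq add_right_mono)
  have "cmod A \<le> x * (M * g)"
    unfolding A_def norm_mult
  proof (intro mult_mono)
    have "cmod (\<kappa> + \<beta> - G) \<le> cmod \<kappa> + cmod \<beta> + cmod G"
      by (metis norm_triangle_ineq norm_triangle_ineq4 order_trans add_right_mono)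
    also have "\<dots> \<le> cmod \<kappa> * g + cmod \<beta> * g + 2 * g"
      using g mult_left_mono[of 1 g "cmod \<kappa>"] mult_left_mono[of 1 g "cmod \<beta>"] by simp
    finally show "cmod (\<kappa> + \<beta> - G) \<le> M * g" by (simp add: M_def algebra_simps)
  qed (use x b in auto)
  also have "x * (M * g) \<le> x^3 * (M * g)" using x2(3) M g by (intro mult_right_mono) auto
  finally have A_le: "cmod A \<le> M * x^3 * g" by (simp add: mult_ac)
  have "cmod B \<le> x * x * (M * x * g)"
    unfolding B_def norm_mult
  proof (intro mult_mono)
    have "cmod (\<kappa> + \<beta> - G2 / G * G) \<le> cmod \<kappa> + cmod \<beta> + cmod (G2 / G) * cmod G"
      by (metis norm_triangle_ineq norm_triangle_ineq4 order_trans add_right_mono norm_mult)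
    also have "\<dots> \<le> cmod \<kappa> * (x * g) + cmod \<beta> * (x * g) + x * g"
    proof (intro add_mono mult_mono)
      have "1 * 1 \<le> x * g" using x g by (intro mult_mono) auto
      then show "cmod \<kappa> \<le> cmod \<kappa> * (x * g)" "cmod \<beta> \<le> cmod \<beta> * (x * g)"
        using mult_left_mono[of 1 "x * g" "cmod \<kappa>"] mult_left_mono[of 1 "x * g" "cmod \<beta>"] by auto
    qed (use b x g in auto)
    also have "\<dots> \<le> M * x * g" using x g by (simp add: M_def algebra_simps)
    finally show "cmod (\<kappa> + \<beta> - G2 / G * G) \<le> M * x * g" .
  qed (use x b in auto)
  then have B_le: "cmod B \<le> M * x^3 * g" by (simp add: power3_eq_cube mult_ac)
  have "cmod D \<le> M * g * (x + x) * x"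
    unfolding D_def norm_mult
  proof (intro mult_mono)
    show "cmod (G' / G - F' / F) \<le> x + x"
      using norm_triangle_ineq4[of "G' / G" "F' / F"] b by linarith
  qed (use x b M g in \<open>auto simp: M_def\<close>)
  also have "M * g * (x + x) * x = (2 * M * g) * x^2" by (simp add: power2_eq_square)
  also have "\<dots> \<le> (2 * M * g) * x^3" using x2(2) M g by (intro mult_left_mono) auto
  finally have "cmod D \<le> 2 * M * x^3 * g" by (simp add: mult_ac)
  then have "cmod (\<phi>2 - \<phi>) * cmod F \<le> 4 * M * x^3 * g" using sum A_le B_le by linarith
  then show ?thesis using le1 by (auto simp: max_def M_def g_def)
qed

text \<open>Vanishing of the Wronskian makes \<open>N / D\<close> constant on a disc around
  \<open>a\<close> where \<open>D\<close> has no zero; analytic continuation carries the relation to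
  the plane.\<close>

lemma entire_linear_combination_constant:
  assumes "N holomorphic_on UNIV" "D holomorphic_on UNIV" "N a \<noteq> 0" "D a \<noteq> 0"
    and "\<And>z. deriv N z * D z = N z * deriv D z"
  obtains c where "c \<noteq> 0" "\<And>z. N z = c * D z"
proof -
  have cont: "open {z. D z \<noteq> 0}"
    using assms by (intro open_Collect_neq continuous_on_const continuous_on_entire)
  then obtain e where e: "0 < e" "ball a e \<subseteq> {z. D z \<noteq> 0}"
    using assms(4) by (auto simp: open_contains_ball)
  have "\<exists>c. \<forall>z\<in>ball a e. N z / D z = c"
  proof (rule has_field_derivative_zero_constant)
    fix z assume "z \<in> ball a e"
    then have Dz: "D z \<noteq> 0" using e by auto
    have "((\<lambda>z. N z / D z) has_field_derivative (deriv N z * D z - N z * deriv D z) / (D z * D z)) (at z)"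
      using holomorphic_derivI[OF assms(1) open_UNIV, of z] holomorphic_derivI[OF assms(2) open_UNIV, of z] Dz
      by (auto intro!: derivative_eq_intros)
    then show "((\<lambda>z. N z / D z) has_field_derivative 0) (at z within ball a e)"
      by (simp add: assms(5) has_field_derivative_at_within)
  qed simp
  then obtain c where c: "\<And>z. z \<in> ball a e \<Longrightarrow> N z / D z = c" by blast
  have eq: "N z = c * D z" for z
  proof (rule analytic_continuation_open[of "ball a e" UNIV N "\<lambda>z. c * D z"])
    show "(\<lambda>z. c * D z) holomorphic_on UNIV" by (intro holomorphic_intros assms)
    show "N z = c * D z" if "z \<in> ball a e" for z
      using c[OF that] e that by (auto simp: field_simps)
  qed (use e assms in auto)
  moreover have "c \<noteq> 0" using eq[of a] assms(3) by auto
  ultimately show ?thesis using that by blast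
qed

lemma entire_prod_nonzero:
  assumes "finite I" "\<And>i. i \<in> I \<Longrightarrow> f i holomorphic_on UNIV" "\<And>i. i \<in> I \<Longrightarrow> \<exists>z. f i z \<noteq> 0"
  shows "\<exists>z. (\<Prod>i\<in>I. f i z) \<noteq> (0::complex)"
  using assms
proof (induction I rule: finite_induct)
  case (insert i I)
  obtain a b where "f i a \<noteq> 0" "(\<Prod>i\<in>I. f i b) \<noteq> 0"
    using insert.IH insert.prems by (metis insertCI)
  then have "\<exists>z. f i z * (\<Prod>i\<in>I. f i z) \<noteq> 0"
    using insert.prems by (intro entire_mult_nonzero[of _ a _ b] holomorphic_intros) auto
  then show ?case using insert.hyps by simp
qed simp

text \<open>\<open>F - F 0\<close> vanishes at 0 to some order \<open>m \<ge> 1\<close>, for which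
  Jensen's inequality credits \<open>m * ln r\<close>. This makes the characteristic unbounded even
  for polynomials.\<close>

lemma nev_char_lower_growth:
  assumes F: "F holomorphic_on UNIV" and nc: "F a \<noteq> F 0"
  obtains C where "\<And>r. 1 \<le> r \<Longrightarrow> 0 \<notin> (\<lambda>z. F z - F 0) ` sphere 0 r \<Longrightarrow> ln r - C \<le> nev_char F r"
proof -
  have hol: "(\<lambda>z. F z - F 0) holomorphic_on UNIV" by (intro holomorphic_intros F)
  have "F a - F 0 \<noteq> 0" using nc by simp
  obtain m h where h: "h holomorphic_on UNIV" "h 0 \<noteq> 0" "\<And>z. F z - F 0 = (z - 0) ^ m * h z"
    by (rule entire_factor_zero[OF hol \<open>F a - F 0 \<noteq> 0\<close>, of 0]) (rule that)
  have m: "1 \<le> m" using h(2) h(3)[of 0] by (cases m) auto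
  define C where "C = log_plus (cmod (F 0)) + ln 2 - ln (cmod (h 0))"
  have "ln r - C \<le> nev_char F r" if r: "1 \<le> r" "0 \<notin> (\<lambda>z. F z - F 0) ` sphere 0 r" for r
  proof -
    have "ln r + ln (cmod (h 0)) \<le> m * ln r + ln (cmod (h 0))"
      using m r mult_right_mono[of 1 "real m" "ln r"] by simp
    also have "\<dots> \<le> circle_mean (\<lambda>z. ln (cmod (F z - F 0))) r"
      using r h by (intro jensen_lower_bound[where F = "\<lambda>z. F z - F 0"]) auto
    also have "\<dots> \<le> circle_mean (\<lambda>z. log_plus (cmod (F z)) + (log_plus (cmod (F 0)) + ln 2)) r"
    proof (rule circle_mean_mono)
      fix z
      have "ln (cmod (F z - F 0)) \<le> log_plus (cmod (F z - F 0))" by (rule ln_le_log_plus)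
      also have "\<dots> \<le> log_plus (cmod (F z) + cmod (F 0))" by (intro log_plus_mono norm_triangle_ineq4) auto
      also have "\<dots> \<le> log_plus (cmod (F z)) + log_plus (cmod (F 0)) + ln 2" by (intro log_plus_add) auto
      finally show "ln (cmod (F z - F 0)) \<le> log_plus (cmod (F z)) + (log_plus (cmod (F 0)) + ln 2)" by simp
    qed (use r hol F in \<open>auto intro!: continuous_on_ln_cmod continuous_on_add continuous_on_log_plus continuous_on_entire\<close>)
    also have "\<dots> = nev_char F r + (log_plus (cmod (F 0)) + ln 2)"
      unfolding nev_char_eq using r F
      by (subst circle_mean_add) (auto intro!: continuous_on_log_plus continuous_on_entire)
    finally show ?thesis by (simp add: C_def)
  qed
  then show ?thesis by (rule that)
qed

text \<open>The zeros of a nonzero entire function have countably many moduli, so finitely many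
  functions can be avoided on all dyadic circles at once.\<close>

lemma clean_radii:
  assumes F: "F holomorphic_on UNIV" "F a \<noteq> F 0"
    and growth: "eventually (\<lambda>r. nev_char F r \<le> r ^ K) at_top"
    and Xs: "finite Xs" "\<And>X. X \<in> Xs \<Longrightarrow> X holomorphic_on UNIV" "\<And>X. X \<in> Xs \<Longrightarrow> \<exists>z. X z \<noteq> 0"
  obtains r where "growth_radii r (\<lambda>k. nev_char F (r k))"
    "growth_radii.dominated r (\<lambda>k. nev_char F (r k)) F" "\<And>X. X \<in> Xs \<Longrightarrow> growth_radii.clean r X"
proof -
  \<comment> \<open>\<open>F - F 0\<close> is added because the lower bound for the characteristic
    holds on circles free of its zeros.\<close>
  define B where "B = (\<Union>X\<in>insert (\<lambda>z. F z - F 0) Xs. cmod ` {z. X z = 0})"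
  have B: "countable B"
    unfolding B_def
  proof (intro countable_UN countable_image)
    show "countable (insert (\<lambda>z. F z - F 0) Xs)" using Xs(1) by (simp add: countable_finite)
    fix X assume "X \<in> insert (\<lambda>z. F z - F 0) Xs"
    then have "X holomorphic_on UNIV" "\<exists>z. X z \<noteq> 0"
      using F Xs by (auto intro!: holomorphic_intros)
    then show "countable {z. X z = 0}" using entire_countable_zeros by blast
  qed
  obtain C where C: "\<And>r. 1 \<le> r \<Longrightarrow> 0 \<notin> (\<lambda>z. F z - F 0) ` sphere 0 r \<Longrightarrow> ln r - C \<le> nev_char F r"
    by (rule nev_char_lower_growth[OF F]) (rule that)
  have lower: "ln r - C \<le> nev_char F r" if "1 \<le> r" "r \<notin> B" for r
    using that by (intro C) (auto simp: B_def image_iff)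
  obtain r :: "nat \<Rightarrow> real" and D where r: "filterlim r at_top sequentially" "\<And>k. 1 \<le> r k"
    "\<And>j k. 2 ^ j * r k \<notin> B" "\<And>j k. nev_char F (2 ^ j * r k) \<le> D ^ j * nev_char F (r k)"
    "filterlim (\<lambda>k. nev_char F (r k)) at_top sequentially" "\<And>k. 0 < nev_char F (r k)"
    by (rule polya_radii[OF growth lower B]) (assumption+, rule that)
  interpret growth_radii r "\<lambda>k. nev_char F (r k)"
    using r by unfold_locales auto
  have "dominated F"
    unfolding dominated_def
  proof
    fix j
    show "(\<lambda>k. nev_char F (2 ^ j * r k)) \<in> O(\<lambda>k. nev_char F (r k))"
    proof (rule landau_o.bigI[of "\<bar>D ^ j\<bar> + 1"])
      show "eventually (\<lambda>k. norm (nev_char F (2 ^ j * r k)) \<le> (\<bar>D ^ j\<bar> + 1) * norm (nev_char F (r k))) sequentially"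
      proof (rule always_eventually, rule allI)
        fix k
        have "0 \<le> nev_char F (2 ^ j * r k)"
          using radius_ge_1[of j k] by (intro nev_char_nonneg continuous_on_entire F) linarith
        moreover have "D ^ j * nev_char F (r k) \<le> (\<bar>D ^ j\<bar> + 1) * nev_char F (r k)"
          using r(6)[of k] by (intro mult_right_mono) auto
        ultimately show "norm (nev_char F (2 ^ j * r k)) \<le> (\<bar>D ^ j\<bar> + 1) * norm (nev_char F (r k))"
          using order_trans[OF r(4)[of j k]] r(6)[of k] by simp
      qed
    qed auto
  qed
  moreover have "clean X" if "X \<in> Xs" for X
    unfolding clean_def using r(3) Xs(2)[OF that] that by (fastforce simp: B_def image_iff)
  ultimately show ?thesis using that growth_radii_axioms by blast
qed

section \<open>Functions sharing two pairs of values\<close>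

lemma deriv_diff_const: "deriv (\<lambda>z. U z - c) = deriv (U :: complex \<Rightarrow> complex)"
proof
  fix z
  have "((\<lambda>z. U z - c) has_field_derivative D) (at z) \<longleftrightarrow> (U has_field_derivative D) (at z)" for D
    using DERIV_diff[of "\<lambda>z. U z - c" D z UNIV "\<lambda>_. - c" 0] DERIV_diff[of U D z UNIV "\<lambda>_. c" 0] by auto
  then show "deriv (\<lambda>z. U z - c) z = deriv U z" by (simp add: deriv_def)
qed

lemma deriv_shift:
  assumes "U holomorphic_on UNIV"
  shows "deriv (\<lambda>z. U (z + \<eta>)) z = deriv U (z + \<eta>)"
proof -
  have "(U has_field_derivative deriv U (z + \<eta>)) (at (z + \<eta>))"
    using assms by (rule holomorphic_derivI) auto
  then show ?thesis by (intro DERIV_imp_deriv) (simp add: DERIV_shift)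
qed

lemma (in growth_radii) small_log_deriv_value:
  assumes "U holomorphic_on UNIV" "dominated U" "clean (\<lambda>z. U z - c)"
  shows "small (\<lambda>z. deriv U z / (U z - c))"
proof -
  have "dominated (\<lambda>z. U z - c)"
    using assms by (intro dominated_diff dominated_const) auto
  from small_log_deriv[OF assms(3) this] show ?thesis by (simp add: deriv_diff_const)
qed

locale shared_pairs =
  fixes F :: "complex \<Rightarrow> complex" and \<eta> \<alpha> \<beta> :: complex
  assumes F: "F holomorphic_on UNIV"
    and F_nonconst: "\<exists>z. F z \<noteq> e"
    and \<alpha>\<beta>: "\<alpha> \<noteq> \<beta>"
    and shared1: "F z = 1 \<longleftrightarrow> F (z + \<eta>) - F z = \<alpha>"
    and shared0: "F z = 0 \<longleftrightarrow> F (z + \<eta>) - F z = \<beta>"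
begin

definition G :: "complex \<Rightarrow> complex" where "G z = F (z + \<eta>) - F z"

definition L :: "complex \<Rightarrow> complex" where "L z = (\<alpha> - \<beta>) * F z + \<beta> - G z"

lemma G: "G holomorphic_on UNIV"
  unfolding G_def by (intro holomorphic_intros F entire_shift)

lemma L: "L holomorphic_on UNIV"
  unfolding L_def by (intro holomorphic_intros F G)

lemma shared: "F z = 1 \<longleftrightarrow> G z = \<alpha>" "F z = 0 \<longleftrightarrow> G z = \<beta>"
  using shared1 shared0 by (auto simp: G_def)

text \<open>For constant \<open>G\<close>, sharing would make \<open>F\<close> take each of 0 and 1
  everywhere or nowhere. Being nonconstant, \<open>F\<close> would omit both, against Picard's
  theorem.\<close>

lemma G_nonconst: "\<exists>z. G z \<noteq> e"
proof (rule ccontr)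
  assume "\<not> (\<exists>z. G z \<noteq> e)"
  then have G_eq: "G z = e" for z by blast
  have "F z \<noteq> 1" "F z \<noteq> 0" for z
    using shared[of z] F_nonconst[of 1] F_nonconst[of 0] shared G_eq by metis+
  then have "range F \<inter> {0, 1} = {}" by auto
  then obtain c where "F = (\<lambda>x. c)" by (rule little_Picard[OF F, of 0 1, rotated]) auto
  then show False using F_nonconst[of c] by auto
qed

lemma deriv_G: "deriv G z = deriv F (z + \<eta>) - deriv F z"
proof -
  have "deriv G z = deriv (\<lambda>z. F (z + \<eta>)) z - deriv F z"
    unfolding G_def[abs_def] using F entire_shift[OF F]
    by (intro deriv_diff) (auto intro: holomorphic_on_imp_differentiable_at)
  then show ?thesis by (simp add: deriv_shift[OF F])
qed

lemma quotients_exist: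
  obtains \<phi> \<psi> where "\<phi> holomorphic_on UNIV" "\<psi> holomorphic_on UNIV"
    "\<And>z. deriv F z * L z = \<phi> z * ((F z - 1) * (F z - 0))"
    "\<And>z. deriv G z * L z = \<psi> z * ((G z - \<alpha>) * (G z - \<beta>))"
proof -
  have L0: "L z = 0" if "F z = 1 \<or> F z = 0" for z
    using that shared[of z] by (auto simp: L_def)
  obtain \<phi> where \<phi>: "\<phi> holomorphic_on UNIV" "\<And>z. deriv F z * L z = \<phi> z * ((F z - 1) * (F z - 0))"
    by (rule entire_log_deriv_quotient[OF F F_nonconst _ L, of 1 0]) (use L0 in auto)
  obtain \<psi> where \<psi>: "\<psi> holomorphic_on UNIV" "\<And>z. deriv G z * L z = \<psi> z * ((G z - \<alpha>) * (G z - \<beta>))"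
    by (rule entire_log_deriv_quotient[OF G G_nonconst \<alpha>\<beta> L]) (use L0 shared in auto)
  show ?thesis using that \<phi> \<psi> by blast
qed

end

text \<open>The assumptions negate both alternatives of the theorem; the locale is to be shown
  inconsistent.\<close>

locale shared_pairs_nonperiodic = shared_pairs +
  fixes \<phi> \<psi> :: "complex \<Rightarrow> complex" and K :: nat
  assumes \<phi>: "\<phi> holomorphic_on UNIV" and \<psi>: "\<psi> holomorphic_on UNIV"
    and \<phi>_eq: "deriv F z * L z = \<phi> z * ((F z - 1) * (F z - 0))"
    and \<psi>_eq: "deriv G z * L z = \<psi> z * ((G z - \<alpha>) * (G z - \<beta>))"
    and L_nonzero: "\<exists>z. L z \<noteq> 0"
    and nonperiodic: "\<exists>z. \<phi> (z + \<eta>) - \<phi> z \<noteq> 0"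
    and growth: "eventually (\<lambda>r. nev_char F r \<le> r ^ K) at_top"
begin

definition base_zeros :: "(complex \<Rightarrow> complex) set" where
  "base_zeros = {F, \<lambda>z. F z - 1, \<lambda>z. F (z + \<eta>), \<lambda>z. F (z + \<eta>) - 1, G, \<lambda>z. G z - \<alpha>, \<lambda>z. G z - \<beta>,
     \<lambda>z. \<phi> (z + \<eta>) - \<phi> z}"

lemma base_zeros_entire: "X \<in> base_zeros \<Longrightarrow> X holomorphic_on UNIV"
  unfolding base_zeros_def
  by (elim insertE emptyE; simp only:; intro holomorphic_intros F G \<phi> entire_shift)

lemma base_zeros_nonzero: "X \<in> base_zeros \<Longrightarrow> \<exists>z. X z \<noteq> 0"
proof -
  have "\<exists>z. F (z + \<eta>) \<noteq> e" for e
    using F_nonconst[of e] by (metis diff_add_cancel)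
  then show "X \<in> base_zeros \<Longrightarrow> \<exists>z. X z \<noteq> 0"
    unfolding base_zeros_def
    using F_nonconst G_nonconst nonperiodic by auto
qed

lemma F_differs: obtains a where "F a \<noteq> F 0"
  using F_nonconst by blast

end

section \<open>Comparison of the characteristics of \<open>F\<close> and \<open>G\<close>\<close>

text \<open>The radii form a separate layer since they are chosen twice, the first time with the
  zeros of the auxiliary function avoided as well.\<close>

locale shared_pairs_radii = shared_pairs_nonperiodic + growth_radii r "\<lambda>k. nev_char F (r k)" for r +
  assumes dom_F: "dominated F" and clean_base: "X \<in> base_zeros \<Longrightarrow> clean X"
begin

lemma clean_all:
  "clean F" "clean (\<lambda>z. F z - 1)" "clean (\<lambda>z. F (z + \<eta>))" "clean (\<lambda>z. F (z + \<eta>) - 1)"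
  "clean G" "clean (\<lambda>z. G z - \<alpha>)" "clean (\<lambda>z. G z - \<beta>)" "clean (\<lambda>z. \<phi> (z + \<eta>) - \<phi> z)"
  by (rule clean_base; simp add: base_zeros_def)+

lemma circle_nonzero:
  assumes "cmod z = r k"
  shows "F z \<noteq> 0" "F z \<noteq> 1" "F (z + \<eta>) \<noteq> 0" "F (z + \<eta>) \<noteq> 1" "G z \<noteq> 0" "G z \<noteq> \<alpha>" "G z \<noteq> \<beta>"
    "\<phi> (z + \<eta>) - \<phi> z \<noteq> 0"
  using clean_all[THEN clean_nonzero, OF assms] by auto

lemma dom_shift: "dominated (\<lambda>z. F (z + \<eta>))"
  by (rule dominated_shift[OF clean_all(1) dom_F])

lemma dom_G: "dominated G"
  unfolding G_def[abs_def] by (intro dominated_diff dom_shift dom_F F entire_shift)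

text \<open>The quotients that enter the pointwise bounds for \<open>\<phi>\<close>, its difference
  and \<open>\<psi>\<close>.\<close>

definition base :: "(complex \<Rightarrow> complex) list" where
  "base = [\<lambda>z. deriv F z / F z, \<lambda>z. deriv F z / (F z - 1), \<lambda>z. deriv F (z + \<eta>) / F (z + \<eta>),
     \<lambda>z. deriv F (z + \<eta>) / (F (z + \<eta>) - 1), \<lambda>z. deriv G z / G z, \<lambda>z. F (z + \<eta>) / F z,
     \<lambda>z. F z / F (z + \<eta>), \<lambda>z. G (z + \<eta>) / G z, \<lambda>z. F (z + \<eta> + \<eta>) / F (z + \<eta>),
     \<lambda>z. deriv G z / (G z - \<alpha>), \<lambda>z. deriv G z / (G z - \<beta>)]"

lemma small_base:
  assumes "h \<in> set base"
  shows "small h"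
proof -
  note shiftF = entire_shift[OF F, of \<eta>]
  have s1: "small (\<lambda>z. deriv F z / F z)" by (rule small_log_deriv[OF clean_all(1) dom_F])
  have s2: "small (\<lambda>z. deriv F z / (F z - 1))" by (rule small_log_deriv_value[OF F dom_F clean_all(2)])
  have s3: "small (\<lambda>z. deriv F (z + \<eta>) / F (z + \<eta>))"
    using small_log_deriv[OF clean_all(3) dom_shift] by (simp add: deriv_shift[OF F])
  have s4: "small (\<lambda>z. deriv F (z + \<eta>) / (F (z + \<eta>) - 1))"
    using small_log_deriv_value[OF shiftF dom_shift clean_all(4)] by (simp add: deriv_shift[OF F])
  have s5: "small (\<lambda>z. deriv G z / G z)" by (rule small_log_deriv[OF clean_all(5) dom_G])
  have s6: "small (\<lambda>z. F (z + \<eta>) / F z)" by (rule small_shift_quot[OF clean_all(1) dom_F])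
  \<comment> \<open>The inverse quotient is the shift quotient of \<open>F (z + \<eta>)\<close> by
    \<open>- \<eta>\<close>.\<close>
  have s7: "small (\<lambda>z. F z / F (z + \<eta>))"
    using small_shift_quot[OF clean_all(3) dom_shift, of "- \<eta>"] by simp
  have s8: "small (\<lambda>z. G (z + \<eta>) / G z)" by (rule small_shift_quot[OF clean_all(5) dom_G])
  have s9: "small (\<lambda>z. F (z + \<eta> + \<eta>) / F (z + \<eta>))" by (rule small_shift_quot[OF clean_all(3) dom_shift])
  have s10: "small (\<lambda>z. deriv G z / (G z - \<alpha>))" by (rule small_log_deriv_value[OF G dom_G clean_all(6)])
  have s11: "small (\<lambda>z. deriv G z / (G z - \<beta>))" by (rule small_log_deriv_value[OF G dom_G clean_all(7)])
  have "\<forall>h\<in>set base. small h"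
    by (simp only: base_def list.set ball_simps s1 s2 s3 s4 s5 s6 s7 s8 s9 s10 s11 simp_thms)
  then show ?thesis using assms by blast
qed

lemma base_bounds:
  assumes "\<And>h. h \<in> set base \<Longrightarrow> cmod (h z) \<le> x"
  shows "cmod (deriv F z / F z) \<le> x" "cmod (deriv F z / (F z - 1)) \<le> x"
    "cmod (deriv F (z + \<eta>) / F (z + \<eta>)) \<le> x" "cmod (deriv F (z + \<eta>) / (F (z + \<eta>) - 1)) \<le> x"
    "cmod (deriv G z / G z) \<le> x" "cmod (F (z + \<eta>) / F z) \<le> x" "cmod (F z / F (z + \<eta>)) \<le> x"
    "cmod (G (z + \<eta>) / G z) \<le> x" "cmod (F (z + \<eta> + \<eta>) / F (z + \<eta>)) \<le> x"
    "cmod (deriv G z / (G z - \<alpha>)) \<le> x" "cmod (deriv G z / (G z - \<beta>)) \<le> x"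
  by (rule assms; simp add: base_def)+

lemma small_\<phi>: "small \<phi>"
proof (rule small_polynomial_bound[OF small_base])
  show "continuous_on (sphere 0 (r k)) \<phi>" for k by (rule continuous_on_entire[OF \<phi>])
  show "1 \<le> 2 * (cmod (\<alpha> - \<beta>) + cmod \<beta> + 2)" by (simp add: add_nonneg_nonneg add_increasing)
  fix k z x assume z: "cmod z = r k" and x: "1 \<le> x" "\<And>h. h \<in> set base \<Longrightarrow> cmod (h z) \<le> x"
  show "cmod (\<phi> z) \<le> 2 * (cmod (\<alpha> - \<beta>) + cmod \<beta> + 2) * x ^ 2"
    using circle_nonzero[OF z] base_bounds[OF x(2)] \<phi>_eq[of z]
    by (intro phi_bound[OF x(1), of "F z" "deriv F z" _ _ "G z"]) (auto simp: L_def G_def)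
qed

lemma max_G_le:
  assumes "F z \<noteq> 0" "cmod (F (z + \<eta>) / F z) \<le> x" "1 \<le> x"
  shows "max 1 (cmod (G z)) \<le> 2 * x * max 1 (cmod (F z))"
proof -
  have "G z = (F (z + \<eta>) / F z - 1) * F z" using assms(1) by (simp add: G_def left_diff_distrib)
  then have "cmod (G z) = cmod (F (z + \<eta>) / F z - 1) * cmod (F z)" by (simp only: norm_mult)
  also have "\<dots> \<le> (x + 1) * max 1 (cmod (F z))"
    using norm_triangle_ineq4[of "F (z + \<eta>) / F z" 1] assms by (intro mult_mono) auto
  also have "\<dots> \<le> 2 * x * max 1 (cmod (F z))" using assms by (intro mult_right_mono) auto
  finally have "cmod (G z) \<le> 2 * x * max 1 (cmod (F z))" .
  moreover have "1 * 1 \<le> 2 * x * max 1 (cmod (F z))" using assms by (intro mult_mono) auto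
  ultimately show ?thesis by simp
qed

text \<open>Here nonperiodicity enters. By \<open>phi_shift_bound\<close>, a large ratio of
  \<open>max 1 (cmod F)\<close> to \<open>max 1 (cmod G)\<close> makes
  \<open>\<phi> (z + \<eta>) - \<phi> z\<close> small, whereas Jensen's inequality bounds the mean
  of its logarithm from below.\<close>

lemma T_minus_TG:
  obtains e where "e \<in> o(\<lambda>k. nev_char F (r k))" "\<And>k. nev_char F (r k) - nev_char G (r k) \<le> e k"
proof -
  define g where "g z = ln (cmod (\<phi> (z + \<eta>) - \<phi> z)) + log_plus (cmod (F z)) - log_plus (cmod (G z))" for z
  define C where "C = 4 * (cmod (\<alpha> - \<beta>) + cmod \<beta> + 2)"
  have C: "1 \<le> C" by (simp add: C_def add_nonneg_nonneg add_increasing)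
  have cont\<phi>: "continuous_on (sphere 0 (r k)) (\<lambda>z. ln (cmod (\<phi> (z + \<eta>) - \<phi> z)))" for k
    using circle_nonzero(8) cleanD(1)[OF clean_all(8)] by (intro continuous_on_ln_cmod) force+
  have contF: "continuous_on (sphere 0 (r k)) (\<lambda>z. log_plus (cmod (F z)))"
    and contG: "continuous_on (sphere 0 (r k)) (\<lambda>z. log_plus (cmod (G z)))" for k
    by (intro continuous_on_log_plus continuous_on_entire F G)+
  obtain e where e: "e \<in> o(\<lambda>k. nev_char F (r k))" "\<And>k. circle_mean g (r k) \<le> e k"
  proof (rule circle_mean_small_bound[OF small_base])
    show "continuous_on (sphere 0 (r k)) g" for k
      unfolding g_def by (intro continuous_on_diff continuous_on_add cont\<phi> contF contG)
    fix k z x assume z: "cmod z = r k" and x: "1 \<le> x" "\<And>h. h \<in> set base \<Longrightarrow> cmod (h z) \<le> x"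
    have FG: "F z + G z = F (z + \<eta>)" "deriv F z + deriv G z = deriv F (z + \<eta>)"
      by (auto simp: G_def deriv_G)
    have "cmod (\<phi> (z + \<eta>) - \<phi> z) * max 1 (cmod (F z)) \<le> 4 * (cmod (\<alpha> - \<beta>) + cmod \<beta> + 2) * x ^ 3 * max 1 (cmod (G z))"
    proof (rule phi_shift_bound[OF x(1), of "F z" "G z" "deriv F z" _ _ _ "deriv G z" "G (z + \<eta>)"], unfold FG)
      show "deriv F z * ((\<alpha> - \<beta>) * F z + \<beta> - G z) = \<phi> z * ((F z - 1) * (F z - 0))"
        using \<phi>_eq[of z] by (simp add: L_def)
      show "deriv F (z + \<eta>) * ((\<alpha> - \<beta>) * F (z + \<eta>) + \<beta> - G (z + \<eta>)) = \<phi> (z + \<eta>) * ((F (z + \<eta>) - 1) * (F (z + \<eta>) - 0))"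
        using \<phi>_eq[of "z + \<eta>"] by (simp add: L_def)
      show "cmod ((F (z + \<eta>) + G (z + \<eta>)) / F (z + \<eta>)) \<le> x"
        using base_bounds(9)[OF x(2)] by (simp add: G_def)
    qed (use circle_nonzero[OF z] base_bounds[OF x(2)] in auto)
    then have le: "cmod (\<phi> (z + \<eta>) - \<phi> z) * max 1 (cmod (F z)) \<le> C * x ^ 3 * max 1 (cmod (G z))"
      by (simp add: C_def)
    have "0 < cmod (\<phi> (z + \<eta>) - \<phi> z) * max 1 (cmod (F z))" using circle_nonzero(8)[OF z] by simp
    with le have "ln (cmod (\<phi> (z + \<eta>) - \<phi> z) * max 1 (cmod (F z))) \<le> ln (C * x ^ 3 * max 1 (cmod (G z)))"
      by (intro ln_mono)
    then show "g z \<le> ln C + 3 * ln x"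
      using circle_nonzero(8)[OF z] C x(1)
      by (simp add: g_def log_plus_eq_ln_max ln_mult ln_realpow max_def split: if_splits)
  qed (assumption, rule that)
  obtain c where c: "\<And>k. c \<le> circle_mean (\<lambda>z. ln (cmod (\<phi> (z + \<eta>) - \<phi> z))) (r k)"
    by (rule clean_circle_mean_lower[OF clean_all(8)]) (rule that)
  show ?thesis
  proof (rule that)
    show "(\<lambda>k. e k - c) \<in> o(\<lambda>k. nev_char F (r k))" by (intro sum_in_smallo e const_smallo_T)
    fix k
    have "circle_mean g (r k) = circle_mean (\<lambda>z. ln (cmod (\<phi> (z + \<eta>) - \<phi> z))) (r k) + nev_char F (r k) - nev_char G (r k)"
      unfolding g_def nev_char_eq using r_ge_1[of k] cont\<phi> contF contG
      by (simp add: circle_mean_diff circle_mean_add continuous_on_add)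
    then show "nev_char F (r k) - nev_char G (r k) \<le> e k - c" using e(2)[of k] c[of k] by linarith
  qed
qed

lemma TG_minus_T:
  obtains e where "e \<in> o(\<lambda>k. nev_char F (r k))" "\<And>k. nev_char G (r k) - nev_char F (r k) \<le> e k"
proof -
  have contF: "continuous_on (sphere 0 (r k)) (\<lambda>z. log_plus (cmod (F z)))"
    and contG: "continuous_on (sphere 0 (r k)) (\<lambda>z. log_plus (cmod (G z)))" for k
    by (intro continuous_on_log_plus continuous_on_entire F G)+
  obtain e where e: "e \<in> o(\<lambda>k. nev_char F (r k))" "\<And>k. circle_mean (\<lambda>z. log_plus (cmod (G z)) - log_plus (cmod (F z))) (r k) \<le> e k"
  proof (rule circle_mean_small_bound[OF small_base])
    show "continuous_on (sphere 0 (r k)) (\<lambda>z. log_plus (cmod (G z)) - log_plus (cmod (F z)))" for k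
      by (intro continuous_on_diff contF contG)
    fix k z x assume z: "cmod z = r k" and x: "1 \<le> x" "\<And>h. h \<in> set base \<Longrightarrow> cmod (h z) \<le> x"
    have "max 1 (cmod (G z)) \<le> 2 * x * max 1 (cmod (F z))"
      using circle_nonzero(1)[OF z] base_bounds(6)[OF x(2)] x(1) by (rule max_G_le)
    then have "ln (max 1 (cmod (G z))) \<le> ln (2 * x * max 1 (cmod (F z)))" by (intro ln_mono) auto
    moreover have "ln (2 * x * m) = ln 2 + ln x + ln m" if "1 \<le> m" for m
      using that x(1) by (simp add: ln_mult)
    ultimately show "log_plus (cmod (G z)) - log_plus (cmod (F z)) \<le> ln 2 + 1 * ln x"
      by (simp add: log_plus_eq_ln_max)
  qed (assumption, rule that)
  show ?thesis
    using that[OF e(1)] e(2) r_ge_1 contF contG order_trans[OF zero_le_one r_ge_1]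
    by (simp add: circle_mean_diff nev_char_eq)
qed

text \<open>In \<open>\<psi> = q * L\<close> the factor \<open>q\<close> gains
  \<open>1 / max 1 (cmod G)\<close> by \<open>two_pole_bound\<close>, while \<open>L\<close> costs
  \<open>max 1 (cmod F)\<close>. The mean of the logarithmic loss is the difference of the
  characteristics, which \<open>T_minus_TG\<close> controls.\<close>

lemma small_\<psi>: "small \<psi>"
proof -
  define A where "A = 1 + 2 * (1 + cmod \<alpha>) / cmod (\<alpha> - \<beta>)"
  define C where "C = 2 + A * (cmod (\<alpha> - \<beta>) + cmod \<beta> + 2)"
  have A: "0 \<le> A" by (simp add: A_def)
  have C: "2 \<le> C" using A by (simp add: C_def)
  have contF: "continuous_on (sphere 0 (r k)) (\<lambda>z. log_plus (cmod (F z)))"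
    and contG: "continuous_on (sphere 0 (r k)) (\<lambda>z. log_plus (cmod (G z)))"
    and cont\<psi>: "continuous_on (sphere 0 (r k)) (\<lambda>z. log_plus (cmod (\<psi> z)))" for k
    by (intro continuous_on_log_plus continuous_on_entire F G \<psi>)+
  define g where "g z = log_plus (cmod (\<psi> z)) - (log_plus (cmod (F z)) - log_plus (cmod (G z)))" for z
  obtain e where e: "e \<in> o(\<lambda>k. nev_char F (r k))" "\<And>k. circle_mean g (r k) \<le> e k"
  proof (rule circle_mean_small_bound[OF small_base])
    show "continuous_on (sphere 0 (r k)) g" for k
      unfolding g_def by (intro continuous_on_diff contF contG cont\<psi>)
    fix k z x assume z: "cmod z = r k" and x: "1 \<le> x" "\<And>h. h \<in> set base \<Longrightarrow> cmod (h z) \<le> x"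
    define f where "f = max 1 (cmod (F z))"
    define g' where "g' = max 1 (cmod (G z))"
    have f: "1 \<le> f" "cmod (F z) \<le> f" and g': "1 \<le> g'" "cmod (G z) \<le> g'" by (auto simp: f_def g'_def)
    have G_le: "g' \<le> 2 * x * f"
      unfolding f_def g'_def using circle_nonzero(1)[OF z] base_bounds(6)[OF x(2)] x(1) by (rule max_G_le)
    define q where "q = deriv G z / ((G z - \<alpha>) * (G z - \<beta>))"
    have q: "cmod q * g' \<le> A * x"
      unfolding q_def g'_def A_def using circle_nonzero[OF z] base_bounds[OF x(2)] \<alpha>\<beta>
      by (intro two_pole_bound[OF x(1)]) auto
    have "cmod (L z) \<le> cmod (\<alpha> - \<beta>) * cmod (F z) + cmod \<beta> + cmod (G z)"
      unfolding L_def by (metis norm_mult norm_triangle_ineq norm_triangle_ineq4 order_trans add_right_mono)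
    also have "\<dots> \<le> cmod (\<alpha> - \<beta>) * (x * f) + cmod \<beta> * (x * f) + 2 * x * f"
    proof (intro add_mono mult_left_mono)
      have "1 * 1 \<le> x * f" using x(1) f(1) by (intro mult_mono) auto
      moreover have "1 * f \<le> x * f" using x(1) f(1) by (intro mult_right_mono) auto
      ultimately have xf: "1 \<le> x * f" "f \<le> x * f" by simp_all
      show "cmod (F z) \<le> x * f" using f(2) xf(2) by (rule order_trans)
      show "cmod \<beta> \<le> cmod \<beta> * (x * f)" using mult_left_mono[OF xf(1) norm_ge_zero[of \<beta>]] by simp
    qed (use g' G_le in auto)
    also have "\<dots> = (cmod (\<alpha> - \<beta>) + cmod \<beta> + 2) * (x * f)" by (simp add: algebra_simps)
    finally have L_le: "cmod (L z) \<le> (cmod (\<alpha> - \<beta>) + cmod \<beta> + 2) * (x * f)" .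
    have "\<psi> z = q * L z"
    proof -
      have "(G z - \<alpha>) * (G z - \<beta>) \<noteq> 0" using circle_nonzero[OF z] by simp
      then show ?thesis by (simp add: q_def \<psi>_eq[of z])
    qed
    then have "cmod (\<psi> z) * g' = (cmod q * g') * cmod (L z)" by (simp add: norm_mult)
    also have "\<dots> \<le> (A * x) * ((cmod (\<alpha> - \<beta>) + cmod \<beta> + 2) * (x * f))"
      using A x(1) by (intro mult_mono[OF q L_le]) auto
    also have "\<dots> = A * (cmod (\<alpha> - \<beta>) + cmod \<beta> + 2) * (x^2 * f)" by (simp add: power2_eq_square)
    also have "\<dots> \<le> C * (x^2 * f)" using f x by (intro mult_right_mono) (auto simp: C_def)
    finally have "cmod (\<psi> z) * g' \<le> C * (x^2 * f)" .
    \<comment> \<open>This covers the points where \<open>cmod (\<psi> z) < 1\<close>, so that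
      \<open>log_plus\<close> is bounded and not merely \<open>ln\<close>.\<close>
    moreover have "1 * g' \<le> C * (x^2 * f)"
    proof -
      have "2 * (x * f) \<le> C * (x^2 * f)"
        using C x f by (intro mult_mono) (auto simp: power2_eq_square)
      then show ?thesis using G_le by simp
    qed
    ultimately have "max 1 (cmod (\<psi> z)) * g' \<le> C * (x^2 * f)" by (simp add: max_def)
    moreover have "0 < max 1 (cmod (\<psi> z)) * g'" using g' by simp
    ultimately have "ln (max 1 (cmod (\<psi> z)) * g') \<le> ln (C * (x^2 * f))" by (intro ln_mono)
    moreover have "ln (max 1 (cmod (\<psi> z)) * g') = log_plus (cmod (\<psi> z)) + log_plus (cmod (G z))"
      using g' by (subst ln_mult_pos) (auto simp: g'_def log_plus_eq_ln_max max_def)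
    moreover have "ln (C * (x^2 * f)) = ln C + 2 * ln x + log_plus (cmod (F z))"
      using C x f by (simp add: ln_mult ln_realpow log_plus_eq_ln_max flip: f_def)
    ultimately show "g z \<le> ln C + 2 * ln x" by (simp add: g_def)
  qed (assumption, rule that)
  obtain e' where e': "e' \<in> o(\<lambda>k. nev_char F (r k))" "\<And>k. nev_char F (r k) - nev_char G (r k) \<le> e' k"
    by (rule T_minus_TG) (rule that)
  have "(\<lambda>k. nev_char \<psi> (r k)) \<in> o(\<lambda>k. nev_char F (r k))"
  proof (rule smallo_T_mono)
    show "(\<lambda>k. e k + e' k) \<in> o(\<lambda>k. nev_char F (r k))" by (intro sum_in_smallo e e')
    fix k
    show "0 \<le> nev_char \<psi> (r k)" using r_ge_1[of k] by (intro nev_char_nonneg continuous_on_entire \<psi>) auto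
    have "circle_mean g (r k) = nev_char \<psi> (r k) - (nev_char F (r k) - nev_char G (r k))"
      unfolding g_def nev_char_eq using r_ge_1[of k] contF contG cont\<psi>
      by (simp add: circle_mean_diff continuous_on_diff)
    then show "nev_char \<psi> (r k) \<le> e k + e' k" using e(2)[of k] e'(2)[of k] by linarith
  qed
  then show ?thesis by (auto simp: small_def intro!: continuous_on_entire \<psi>)
qed

end

section \<open>The auxiliary function and proportionality of the quotients\<close>

definition (in shared_pairs_nonperiodic) indices :: "(nat \<times> nat) set" where
  "indices = {1..5} \<times> {1..5}"

text \<open>At a shared point whose two multiplicities are at most 5 the factor belonging to that
  pair vanishes, so one function covers all small multiplicities.\<close>

definition (in shared_pairs_nonperiodic) W :: "complex \<Rightarrow> complex" where
  "W z = (\<Prod>i\<in>indices. of_nat (snd i) * \<phi> z - of_nat (fst i) * (\<alpha> - \<beta>) * \<psi> z)"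

context shared_pairs_radii
begin

lemma norm_W_le:
  assumes "cmod (\<phi> z) \<le> x" "cmod (\<psi> z) \<le> x"
  shows "cmod (W z) \<le> (5 * (1 + cmod (\<alpha> - \<beta>)) * x) ^ 25"
proof -
  have "cmod (W z) = (\<Prod>i\<in>indices. cmod (of_nat (snd i) * \<phi> z - of_nat (fst i) * (\<alpha> - \<beta>) * \<psi> z))"
    unfolding W_def by (simp add: prod_norm)
  also have "\<dots> \<le> (\<Prod>i\<in>indices. 5 * (1 + cmod (\<alpha> - \<beta>)) * x)"
  proof (intro prod_mono conjI)
    fix i assume "i \<in> indices"
    then have i: "fst i \<le> 5" "snd i \<le> 5" by (auto simp: indices_def)
    have "cmod (of_nat (snd i) * \<phi> z - of_nat (fst i) * (\<alpha> - \<beta>) * \<psi> z)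
        \<le> snd i * cmod (\<phi> z) + fst i * cmod (\<alpha> - \<beta>) * cmod (\<psi> z)"
      using norm_triangle_ineq4[of "of_nat (snd i) * \<phi> z" "of_nat (fst i) * (\<alpha> - \<beta>) * \<psi> z"]
      by (simp add: norm_mult)
    also have "\<dots> \<le> 5 * x + 5 * cmod (\<alpha> - \<beta>) * x"
      using i assms by (intro add_mono mult_mono) auto
    finally show "cmod (of_nat (snd i) * \<phi> z - of_nat (fst i) * (\<alpha> - \<beta>) * \<psi> z) \<le> 5 * (1 + cmod (\<alpha> - \<beta>)) * x"
      by (simp add: algebra_simps)
  qed simp
  also have "\<dots> = (5 * (1 + cmod (\<alpha> - \<beta>)) * x) ^ 25"
    by (simp add: indices_def)
  finally show ?thesis .
qed

text \<open>Put \<open>f = max 1 (cmod F)\<close> and \<open>P = F * (F - 1)\<close>. Then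
  \<open>u = F' / P\<close> is of size \<open>1 / f\<close>, and
  \<open>X = W^5 u^5 P (G - \<alpha>) (G - \<beta>)\<close>, where \<open>P\<close> and the product
  with \<open>G\<close> are each at most of size \<open>f^2\<close>. Hence \<open>X\<close> is at
  most of size \<open>1 / f\<close>, and Jensen's lower bound for \<open>X\<close> gives
  \<open>T = o(T)\<close>.\<close>

lemma auxiliary_quotient_contradiction:
  assumes X: "clean X" and X_eq: "\<And>z. W z ^ 5 * deriv F z ^ 5 * ((G z - \<alpha>) * (G z - \<beta>)) = X z * ((F z - 1) * (F z - 0)) ^ 4"
  shows False
proof -
  define A where "A = 1 + 2 * (1 + cmod (1::complex)) / cmod (1 - 0 :: complex)"
  define w where "w = 5 * (1 + cmod (\<alpha> - \<beta>))"
  define B where "B = (1 + cmod \<alpha>) * (1 + cmod \<beta>)"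
  define C where "C = (w ^ 25) ^ 5 * A ^ 5 * 8 * B"
  have pos: "0 < A" "0 < w" "1 \<le> B" unfolding A_def w_def B_def
    by (auto intro: add_pos_nonneg simp: field_simps add_nonneg_nonneg)
  then have C: "0 < C" by (simp add: C_def)
  have contX: "continuous_on (sphere 0 (r k)) (\<lambda>z. ln (cmod (X z)))" for k
    using clean_nonzero[OF X] cleanD(1)[OF X] by (intro continuous_on_ln_cmod) force+
  have contF: "continuous_on (sphere 0 (r k)) (\<lambda>z. log_plus (cmod (F z)))" for k
    by (intro continuous_on_log_plus continuous_on_entire F)
  define hs where "hs = \<phi> # \<psi> # base"
  have hs: "small h" if "h \<in> set hs" for h
    using that small_\<phi> small_\<psi> small_base by (auto simp: hs_def)
  obtain e where e: "e \<in> o(\<lambda>k. nev_char F (r k))" "\<And>k. circle_mean (\<lambda>z. ln (cmod (X z)) + log_plus (cmod (F z))) (r k) \<le> e k"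
  proof (rule circle_mean_small_bound[OF hs])
    show "continuous_on (sphere 0 (r k)) (\<lambda>z. ln (cmod (X z)) + log_plus (cmod (F z)))" for k
      by (intro continuous_on_add contX contF)
    fix k z x assume z: "cmod z = r k" and x: "1 \<le> x" "\<And>h. h \<in> set hs \<Longrightarrow> cmod (h z) \<le> x"
    have b: "cmod (\<phi> z) \<le> x" "cmod (\<psi> z) \<le> x" "\<And>h. h \<in> set base \<Longrightarrow> cmod (h z) \<le> x"
      using x(2) by (auto simp: hs_def)
    define f where "f = max 1 (cmod (F z))"
    define g where "g = max 1 (cmod (G z))"
    have f: "1 \<le> f" "cmod (F z) \<le> f" and g: "1 \<le> g" "cmod (G z) \<le> g" by (auto simp: f_def g_def)
    have G_le: "g \<le> 2 * x * f"
      unfolding f_def g_def using circle_nonzero(1)[OF z] base_bounds(6)[OF b(3)] x(1) by (rule max_G_le)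
    define u where "u = deriv F z / ((F z - 1) * (F z - 0))"
    have u: "cmod u * f \<le> A * x"
      unfolding u_def f_def A_def using circle_nonzero[OF z] base_bounds[OF b(3)]
      by (intro two_pole_bound[OF x(1)]) auto
    define P where "P = (F z - 1) * (F z - 0)"
    have P: "P \<noteq> 0" using circle_nonzero[OF z] by (simp add: P_def)
    have P_le: "cmod P \<le> 2 * f * f"
      unfolding P_def norm_mult using f norm_triangle_ineq4[of "F z" 1] by (intro mult_mono) auto
    have GG: "cmod ((G z - \<alpha>) * (G z - \<beta>)) \<le> B * (g * g)"
    proof -
      have "cmod (G z - c) \<le> (1 + cmod c) * g" for c
        using norm_triangle_ineq4[of "G z" c] g mult_left_mono[of 1 g "cmod c"] by (simp add: algebra_simps)
      then have "cmod (G z - \<alpha>) * cmod (G z - \<beta>) \<le> ((1 + cmod \<alpha>) * g) * ((1 + cmod \<beta>) * g)"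
        using g by (intro mult_mono) auto
      then show ?thesis by (simp add: norm_mult B_def mult_ac)
    qed
    have dF: "deriv F z = u * P" using P by (simp add: u_def P_def)
    have "X z * P ^ 4 = W z ^ 5 * (u * P) ^ 5 * ((G z - \<alpha>) * (G z - \<beta>))"
      using X_eq[of z] by (simp only: P_def[symmetric] dF)
    also have "(u * P) ^ 5 = u ^ 5 * P * P ^ 4" by (simp add: power_mult_distrib eval_nat_numeral)
    finally have "X z * P ^ 4 = W z ^ 5 * u ^ 5 * P * ((G z - \<alpha>) * (G z - \<beta>)) * P ^ 4"
      by (simp only: mult_ac)
    then have "X z = W z ^ 5 * u ^ 5 * P * ((G z - \<alpha>) * (G z - \<beta>))" using P by simp
    then have "cmod (X z) * f ^ 5 = cmod (W z) ^ 5 * (cmod u * f) ^ 5 * cmod P * cmod ((G z - \<alpha>) * (G z - \<beta>))"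
      by (simp only: norm_mult norm_power power_mult_distrib mult_ac)
    also have "\<dots> \<le> ((w * x) ^ 25) ^ 5 * (A * x) ^ 5 * (2 * f * f) * (B * (g * g))"
    proof -
      have W5: "cmod (W z) ^ 5 \<le> ((w * x) ^ 25) ^ 5"
        using norm_W_le[OF b(1,2)] by (intro power_mono) (auto simp: w_def)
      have u5: "(cmod u * f) ^ 5 \<le> (A * x) ^ 5" using u f by (intro power_mono) auto
      show ?thesis
        using f pos x(1) by (intro mult_mono[OF mult_mono[OF mult_mono[OF W5 u5] P_le] GG]) auto
    qed
    also have "\<dots> \<le> ((w * x) ^ 25) ^ 5 * (A * x) ^ 5 * (2 * f * f) * (B * ((2 * x * f) * (2 * x * f)))"
      using pos x(1) f g by (intro mult_left_mono mult_mono[OF G_le G_le]) auto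
    \<comment> \<open>The exponent is 125 from \<open>W\<close>, 5 from \<open>u\<close> and 2 from
      replacing \<open>g\<close> by \<open>2 * x * f\<close> twice; that replacement also makes the
      constant \<open>2 * 4 = 8\<close>.\<close>
    also have "\<dots> = C * x ^ 132 * f ^ 4"
      by (simp add: C_def power_mult_distrib eval_nat_numeral mult_ac)
    finally have "cmod (X z) * f * f ^ 4 \<le> C * x ^ 132 * f ^ 4" by (simp add: eval_nat_numeral mult_ac)
    then have le: "cmod (X z) * f \<le> C * x ^ 132" using f by simp
    have X0: "0 < cmod (X z)" using clean_nonzero[OF X z] by simp
    have "ln (cmod (X z) * f) \<le> ln (C * x ^ 132)" using le X0 f by (intro ln_mono) auto
    moreover have "ln (cmod (X z) * f) = ln (cmod (X z)) + log_plus (cmod (F z))"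
      using X0 f by (subst ln_mult_pos) (auto simp: f_def log_plus_eq_ln_max)
    moreover have "ln (C * x ^ 132) = ln C + 132 * ln x" using C x by (simp add: ln_mult ln_realpow)
    ultimately show "ln (cmod (X z)) + log_plus (cmod (F z)) \<le> ln C + 132 * ln x" by simp
  qed (assumption, rule that)
  obtain c where c: "\<And>k. c \<le> circle_mean (\<lambda>z. ln (cmod (X z))) (r k)"
    by (rule clean_circle_mean_lower[OF X]) (rule that)
  show False
  proof (rule T_le_smallo)
    show "(\<lambda>k. e k - c) \<in> o(\<lambda>k. nev_char F (r k))" by (intro sum_in_smallo e const_smallo_T)
    fix k
    have "circle_mean (\<lambda>z. ln (cmod (X z)) + log_plus (cmod (F z))) (r k) = circle_mean (\<lambda>z. ln (cmod (X z))) (r k) + nev_char F (r k)"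
      unfolding nev_char_eq using r_ge_1[of k] contX contF by (simp add: circle_mean_add)
    then show "nev_char F (r k) \<le> e k - c" using e(2)[of k] c[of k] by linarith
  qed
qed

text \<open>The characteristics of \<open>F\<close> and \<open>G\<close> differ by
  \<open>o(T)\<close>, so the assumption bounds \<open>\<bar>q - p\<bar>\<close> times
  \<open>T\<close> by \<open>o(T)\<close>; a nonzero integer is at least 1 in modulus.\<close>

lemma equal_multiplicities:
  assumes "\<And>k. \<bar>real q * nev_char F (r k) - real p * nev_char G (r k)\<bar> \<le> C"
  shows "p = q"
proof -
  obtain e1 where e1: "e1 \<in> o(\<lambda>k. nev_char F (r k))" "\<And>k. nev_char F (r k) - nev_char G (r k) \<le> e1 k"
    by (rule T_minus_TG) (rule that)
  obtain e2 where e2: "e2 \<in> o(\<lambda>k. nev_char F (r k))" "\<And>k. nev_char G (r k) - nev_char F (r k) \<le> e2 k"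
    by (rule TG_minus_T) (rule that)
  have scale: "(\<lambda>k. c * e k) \<in> o(\<lambda>k. nev_char F (r k))" if "e \<in> o(\<lambda>k. nev_char F (r k))" for c e
    using that by (cases "c = 0") auto
  have T0: "0 \<le> nev_char F (r k)" for k
    using r_ge_1[of k] by (intro nev_char_nonneg continuous_on_entire F) auto
  show ?thesis
  proof (rule ccontr)
    assume "p \<noteq> q"
    then consider "p < q" | "q < p" by linarith
    then show False
    proof cases
      case 1
      show False
      proof (rule T_le_smallo)
        show "(\<lambda>k. C + real p * e2 k) \<in> o(\<lambda>k. nev_char F (r k))"
          by (intro sum_in_smallo const_smallo_T scale e2)
        fix k
        have "1 * nev_char F (r k) \<le> (real q - real p) * nev_char F (r k)"
          using 1 T0[of k] by (intro mult_right_mono) auto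
        also have "\<dots> = (real q * nev_char F (r k) - real p * nev_char G (r k)) + real p * (nev_char G (r k) - nev_char F (r k))"
          by (simp add: algebra_simps)
        also have "\<dots> \<le> C + real p * e2 k"
          using assms[of k] e2(2)[of k] by (intro add_mono mult_left_mono) auto
        finally show "nev_char F (r k) \<le> C + real p * e2 k" by simp
      qed
    next
      case 2
      show False
      proof (rule T_le_smallo)
        show "(\<lambda>k. C + real p * e1 k) \<in> o(\<lambda>k. nev_char F (r k))"
          by (intro sum_in_smallo const_smallo_T scale e1)
        fix k
        have "1 * nev_char F (r k) \<le> (real p - real q) * nev_char F (r k)"
          using 2 T0[of k] by (intro mult_right_mono) auto
        also have "\<dots> = (real p * nev_char G (r k) - real q * nev_char F (r k)) + real p * (nev_char F (r k) - nev_char G (r k))"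
          by (simp add: algebra_simps)
        also have "\<dots> \<le> C + real p * e1 k"
          using assms[of k] e1(2)[of k] by (intro add_mono mult_left_mono) auto
        finally show "nev_char F (r k) \<le> C + real p * e1 k" by simp
      qed
    qed
  qed
qed

end

context shared_pairs_nonperiodic
begin

text \<open>Both sides equal the same multiple of \<open>deriv L a\<close>. At the pair with
  \<open>e = 0\<close> the roles of the two values are exchanged, which changes both signs.\<close>

lemma quotient_values:
  assumes e: "(e = 1 \<and> \<gamma> = \<alpha>) \<or> (e = 0 \<and> \<gamma> = \<beta>)"
    and h: "h holomorphic_on UNIV" "h a \<noteq> 0" "\<And>z. F z - e = (z - a) ^ p * h z" "0 < p"
    and k: "k holomorphic_on UNIV" "k a \<noteq> 0" "\<And>z. G z - \<gamma> = (z - a) ^ q * k z" "0 < q"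
  shows "of_nat q * \<phi> a = of_nat p * (\<alpha> - \<beta>) * \<psi> a"
proof -
  have Fa: "F a = e" using h(3)[of a] h(4) by (simp add: power_0_left)
  then have La: "L a = 0" using e shared[of a] by (auto simp: L_def)
  from e show ?thesis
  proof
    assume e1: "e = 1 \<and> \<gamma> = \<alpha>"
    have "(1 - 0) * \<phi> a = of_nat p * deriv L a"
      using e1 h by (intro log_deriv_quotient_value[OF F L La \<phi> \<phi>_eq]) auto
    moreover have "(\<alpha> - \<beta>) * \<psi> a = of_nat q * deriv L a"
      using e1 k by (intro log_deriv_quotient_value[OF G L La \<psi> \<psi>_eq]) auto
    ultimately show ?thesis by (simp add: mult_ac)
  next
    assume e0: "e = 0 \<and> \<gamma> = \<beta>"
    have "(0 - 1) * \<phi> a = of_nat p * deriv L a"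
    proof (rule log_deriv_quotient_value[OF F L La \<phi>])
      show "deriv F z * L z = \<phi> z * ((F z - 0) * (F z - 1))" for z using \<phi>_eq[of z] by (simp add: mult.commute)
    qed (use e0 h in auto)
    moreover have "(\<beta> - \<alpha>) * \<psi> a = of_nat q * deriv L a"
    proof (rule log_deriv_quotient_value[OF G L La \<psi>])
      show "deriv G z * L z = \<psi> z * ((G z - \<beta>) * (G z - \<alpha>))" for z using \<psi>_eq[of z] by (simp add: mult.commute)
    qed (use e0 k in auto)
    ultimately have "of_nat q * (- \<phi> a) = of_nat p * ((\<beta> - \<alpha>) * \<psi> a)" by simp
    then show ?thesis by (simp add: algebra_simps)
  qed
qed

lemma W: "W holomorphic_on UNIV"
  unfolding W_def[abs_def] by (intro holomorphic_intros \<phi> \<psi>)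

text \<open>The exponents are chosen so that \<open>5 (p - 1) + q \<ge> 4 p\<close> as soon as \<open>p > 5\<close> or \<open>q > 5\<close>; for smaller
  multiplicities the zero of \<open>W\<close> makes up the difference.\<close>

lemma auxiliary_numerator_vanishes:
  assumes e: "(e = 1 \<and> \<gamma> = \<alpha>) \<or> (e = 0 \<and> \<gamma> = \<beta>)"
    and h: "h holomorphic_on UNIV" "h a \<noteq> 0" "\<And>z. F z - e = (z - a) ^ p * h z" "0 < p"
  shows "vanishes (\<lambda>z. W z ^ 5 * deriv F z ^ 5 * ((G z - \<alpha>) * (G z - \<beta>))) a (4 * p)"
proof -
  obtain b where b: "G b - \<gamma> \<noteq> 0" using G_nonconst[of \<gamma>] by auto
  have "(\<lambda>z. G z - \<gamma>) holomorphic_on UNIV" by (intro holomorphic_intros G)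
  then obtain q k where k: "k holomorphic_on UNIV" "k a \<noteq> 0" "\<And>z. G z - \<gamma> = (z - a) ^ q * k z"
    by (rule entire_factor_zero[where a = a and b = b]) (use b that in auto)
  have Fa: "F a = e" using h(3)[of a] h(4) by (simp add: power_0_left)
  then have Ga: "G a = \<gamma>" using e shared[of a] by auto
  then have q: "0 < q" using k(2) k(3)[of a] by (cases q) auto
  have "vanishes (\<lambda>z. F z - e) a p" using h by (auto simp: vanishes_def)
  then have dF: "vanishes (\<lambda>z. deriv F z ^ 5) a (5 * (p - 1))"
    by (intro vanishes_power vanishes_deriv[OF F])
  have van_G: "vanishes (\<lambda>z. G z - \<gamma>) a q" using k by (auto simp: vanishes_def)
  have GG: "vanishes (\<lambda>z. (G z - \<alpha>) * (G z - \<beta>)) a q"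
    using e
  proof
    assume "e = 1 \<and> \<gamma> = \<alpha>"
    then have "vanishes (\<lambda>z. (G z - \<alpha>) * (G z - \<beta>)) a (q + 0)"
      using van_G by (intro vanishes_mult vanishes_0 holomorphic_intros G) auto
    then show ?thesis by simp
  next
    assume "e = 0 \<and> \<gamma> = \<beta>"
    then have "vanishes (\<lambda>z. (G z - \<alpha>) * (G z - \<beta>)) a (0 + q)"
      using van_G by (intro vanishes_mult vanishes_0 holomorphic_intros G) auto
    then show ?thesis by simp
  qed
  define m :: nat where "m = (if p \<le> 5 \<and> q \<le> 5 then 1 else 0)"
  have "vanishes W a m"
  proof (cases "p \<le> 5 \<and> q \<le> 5")
    case True
    then have "(p, q) \<in> indices" using h(4) q by (auto simp: indices_def)
    moreover have "of_nat q * \<phi> a - of_nat p * (\<alpha> - \<beta>) * \<psi> a = 0"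
      using quotient_values[OF e h k q] by simp
    ultimately have "\<exists>i\<in>indices. of_nat (snd i) * \<phi> a - of_nat (fst i) * (\<alpha> - \<beta>) * \<psi> a = 0"
      by (intro bexI[of _ "(p, q)"]) auto
    moreover have "finite indices" by (simp add: indices_def)
    ultimately have "W a = 0" unfolding W_def by (intro prod_zero)
    then show ?thesis using True W by (simp add: m_def vanishes_1[unfolded One_nat_def])
  next
    case False
    then show ?thesis using W by (auto simp: m_def intro: vanishes_0)
  qed
  then have "vanishes (\<lambda>z. W z ^ 5 * deriv F z ^ 5 * ((G z - \<alpha>) * (G z - \<beta>))) a (5 * m + 5 * (p - 1) + q)"
    by (intro vanishes_mult vanishes_power dF GG)
  then show ?thesis
    by (rule vanishes_mono) (use h(4) q in \<open>auto simp: m_def\<close>)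
qed

text \<open>If each of the finitely many relations failed somewhere, \<open>W\<close> would not
  vanish identically; neither would the entire quotient \<open>X\<close>, and radii avoiding its
  zeros would lead to \<open>auxiliary_quotient_contradiction\<close>.\<close>

lemma proportional_quotients:
  obtains p q where "0 < p" "0 < q" "\<And>z. of_nat q * \<phi> z = of_nat p * (\<alpha> - \<beta>) * \<psi> z"
proof -
  have "\<exists>i\<in>indices. \<forall>z. of_nat (snd i) * \<phi> z - of_nat (fst i) * (\<alpha> - \<beta>) * \<psi> z = 0"
  proof (rule ccontr)
    assume no: "\<not> ?thesis"
    have "\<exists>z. W z \<noteq> 0"
      unfolding W_def
      by (intro entire_prod_nonzero holomorphic_intros \<phi> \<psi>) (use no in \<open>auto simp: indices_def\<close>)
    then obtain w where w: "W w \<noteq> 0" by blast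
    have dF: "deriv F holomorphic_on UNIV" by (intro holomorphic_deriv F) auto
    have hol: "(\<lambda>z. W z ^ 5 * deriv F z ^ 5 * ((G z - \<alpha>) * (G z - \<beta>))) holomorphic_on UNIV"
      by (intro holomorphic_intros W dF G)
    obtain X where X: "X holomorphic_on UNIV"
      "\<And>z. W z ^ 5 * deriv F z ^ 5 * ((G z - \<alpha>) * (G z - \<beta>)) = X z * ((F z - 1) * (F z - 0)) ^ 4"
    proof (rule entire_quotient_two_values[OF F F_nonconst _ hol, of 1 0 4])
      show "vanishes (\<lambda>z. W z ^ 5 * deriv F z ^ 5 * ((G z - \<alpha>) * (G z - \<beta>))) a (4 * p)"
        if "h holomorphic_on UNIV" "h a \<noteq> 0" "\<And>z. F z - 1 = (z - a) ^ p * h z" "0 < p" for a p h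
        by (rule auxiliary_numerator_vanishes[OF _ that, of \<alpha>]) simp
      show "vanishes (\<lambda>z. W z ^ 5 * deriv F z ^ 5 * ((G z - \<alpha>) * (G z - \<beta>))) a (4 * p)"
        if "h holomorphic_on UNIV" "h a \<noteq> 0" "\<And>z. F z - 0 = (z - a) ^ p * h z" "0 < p" for a p h
        by (rule auxiliary_numerator_vanishes[OF _ that, of \<beta>]) simp
    qed (simp, rule that)
    obtain d where d: "deriv F d \<noteq> 0"
    proof (rule ccontr)
      assume "\<not> thesis"
      then have "deriv F z = 0" for z using that by blast
      then have "(F has_field_derivative 0) (at z)" for z
        using holomorphic_derivI[OF F open_UNIV, of z] by simp
      then have "\<exists>c. \<forall>z\<in>UNIV. F z = c" by (intro has_field_derivative_zero_constant) auto
      then show False using F_nonconst by blast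
    qed
    obtain a b where ab: "G a \<noteq> \<alpha>" "G b \<noteq> \<beta>" using G_nonconst by blast
    obtain z1 where z1: "W z1 ^ 5 * deriv F z1 ^ 5 \<noteq> 0"
      using entire_mult_nonzero[of "\<lambda>z. W z ^ 5" w "\<lambda>z. deriv F z ^ 5" d] w d
      by (auto intro!: holomorphic_intros W dF)
    have "\<exists>z. (G z - \<alpha>) * (G z - \<beta>) \<noteq> 0"
      by (rule entire_mult_nonzero[of "\<lambda>z. G z - \<alpha>" a "\<lambda>z. G z - \<beta>" b])
         (use ab in \<open>auto intro!: holomorphic_intros G\<close>)
    then obtain z2 where z2: "(G z2 - \<alpha>) * (G z2 - \<beta>) \<noteq> 0" by blast
    have "\<exists>z. W z ^ 5 * deriv F z ^ 5 * ((G z - \<alpha>) * (G z - \<beta>)) \<noteq> 0"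
      by (rule entire_mult_nonzero[of "\<lambda>z. W z ^ 5 * deriv F z ^ 5" z1 "\<lambda>z. (G z - \<alpha>) * (G z - \<beta>)" z2])
         (use z1 z2 in \<open>auto intro!: holomorphic_intros W dF G\<close>)
    then obtain z3 where "W z3 ^ 5 * deriv F z3 ^ 5 * ((G z3 - \<alpha>) * (G z3 - \<beta>)) \<noteq> 0" by blast
    then have "X z3 \<noteq> 0" using X(2)[of z3] by auto
    obtain a where a: "F a \<noteq> F 0" by (rule F_differs)
    obtain r where r: "growth_radii r (\<lambda>k. nev_char F (r k))"
      "growth_radii.dominated r (\<lambda>k. nev_char F (r k)) F" "\<And>Y. Y \<in> insert X base_zeros \<Longrightarrow> growth_radii.clean r Y"
    proof (rule clean_radii[OF F a growth, of "insert X base_zeros"])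
      show "finite (insert X base_zeros)" by (simp add: base_zeros_def)
    qed (use X(1) \<open>X z3 \<noteq> 0\<close> base_zeros_entire base_zeros_nonzero that in auto)
    interpret growth_radii r "\<lambda>k. nev_char F (r k)" by (rule r(1))
    interpret shared_pairs_radii F \<eta> \<alpha> \<beta> \<phi> \<psi> K r
      by unfold_locales (use r in auto)
    show False by (rule auxiliary_quotient_contradiction[OF _ X(2)]) (use r(3) in auto)
  qed
  then obtain i where "i \<in> indices" "\<And>z. of_nat (snd i) * \<phi> z - of_nat (fst i) * (\<alpha> - \<beta>) * \<psi> z = 0"
    by blast
  then show ?thesis using that[of "fst i" "snd i"] by (auto simp: indices_def)
qed

end

section \<open>Integration of the proportionality and Picard's theorem\<close>

context shared_pairs_nonperiodic
begin

text \<open>After cancelling \<open>L\<close>, the relation equates the logarithmic derivatives of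
  \<open>((F - 1) / F) ^ q\<close> and \<open>((G - \<alpha>) / (G - \<beta>)) ^ p\<close>. The
  conclusion is their proportionality, cross-multiplied so that both sides are entire.\<close>

lemma power_identity:
  assumes pq: "0 < p" "0 < q" "\<And>z. of_nat q * \<phi> z = of_nat p * (\<alpha> - \<beta>) * \<psi> z"
  obtains c where "c \<noteq> 0" "\<And>z. (F z - 1) ^ q * (G z - \<beta>) ^ p = c * (F z ^ q * (G z - \<alpha>) ^ p)"
proof -
  obtain l where l: "L l \<noteq> 0" using L_nonzero by blast
  have dF: "deriv F holomorphic_on UNIV" and dG: "deriv G holomorphic_on UNIV"
    by (intro holomorphic_deriv F G; simp)+
  have ode: "of_nat q * deriv F z * ((G z - \<alpha>) * (G z - \<beta>)) = of_nat p * (\<alpha> - \<beta>) * deriv G z * ((F z - 1) * F z)" for z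
  proof (rule entire_mult_cancel[of "\<lambda>z. of_nat q * deriv F z * ((G z - \<alpha>) * (G z - \<beta>))"
        "\<lambda>z. of_nat p * (\<alpha> - \<beta>) * deriv G z * ((F z - 1) * F z)", OF _ _ L l])
    fix z
    have "of_nat q * deriv F z * ((G z - \<alpha>) * (G z - \<beta>)) * L z
        = of_nat q * (deriv F z * L z) * ((G z - \<alpha>) * (G z - \<beta>))" by (simp add: mult_ac)
    also have "\<dots> = (of_nat q * \<phi> z) * ((F z - 1) * F z) * ((G z - \<alpha>) * (G z - \<beta>))"
      by (simp add: \<phi>_eq mult_ac)
    also have "\<dots> = of_nat p * (\<alpha> - \<beta>) * (deriv G z * L z) * ((F z - 1) * F z)"
      by (simp add: pq \<psi>_eq mult_ac)
    finally show "of_nat q * deriv F z * ((G z - \<alpha>) * (G z - \<beta>)) * L z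
        = of_nat p * (\<alpha> - \<beta>) * deriv G z * ((F z - 1) * F z) * L z" by (simp add: mult_ac)
  qed (intro holomorphic_intros F G dF dG)+
  define N where "N z = (F z - 1) ^ q * (G z - \<beta>) ^ p" for z
  define D where "D z = F z ^ q * (G z - \<alpha>) ^ p" for z
  have N: "N holomorphic_on UNIV" and D: "D holomorphic_on UNIV"
    unfolding N_def D_def by (intro holomorphic_intros F G)+
  \<comment> \<open>Successor exponents turn the Wronskian computation into an identity of
    polynomials.\<close>
  define p' q' where p'q'_def: "p' = p - 1" "q' = q - 1"
  have p': "p = Suc p'" "q = Suc q'" using pq(1,2) by (auto simp: p'q'_def)
  have "deriv N z * D z = N z * deriv D z" for z
  proof -
    have F': "(F has_field_derivative deriv F z) (at z)" and G': "(G has_field_derivative deriv G z) (at z)"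
      by (rule holomorphic_derivI[OF F open_UNIV UNIV_I] holomorphic_derivI[OF G open_UNIV UNIV_I])+
    have "(N has_field_derivative of_nat q * (F z - 1) ^ q' * deriv F z * (G z - \<beta>) ^ p
        + (F z - 1) ^ q * (of_nat p * (G z - \<beta>) ^ p' * deriv G z)) (at z)"
      unfolding N_def using F' G' by (auto intro!: derivative_eq_intros simp: p'q'_def mult_ac)
    moreover have "(D has_field_derivative of_nat q * F z ^ q' * deriv F z * (G z - \<alpha>) ^ p
        + F z ^ q * (of_nat p * (G z - \<alpha>) ^ p' * deriv G z)) (at z)"
      unfolding D_def using F' G' by (auto intro!: derivative_eq_intros simp: p'q'_def mult_ac)
    ultimately have "deriv N z * D z - N z * deriv D z
        = (of_nat q * (F z - 1) ^ q' * deriv F z * (G z - \<beta>) ^ p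
            + (F z - 1) ^ q * (of_nat p * (G z - \<beta>) ^ p' * deriv G z)) * (F z ^ q * (G z - \<alpha>) ^ p)
         - ((F z - 1) ^ q * (G z - \<beta>) ^ p) * (of_nat q * F z ^ q' * deriv F z * (G z - \<alpha>) ^ p
            + F z ^ q * (of_nat p * (G z - \<alpha>) ^ p' * deriv G z))"
      by (simp only: DERIV_imp_deriv N_def D_def)
    also have "\<dots> = (F z - 1) ^ q' * F z ^ q' * (G z - \<alpha>) ^ p' * (G z - \<beta>) ^ p'
        * (of_nat q * deriv F z * ((G z - \<alpha>) * (G z - \<beta>)) - of_nat p * (\<alpha> - \<beta>) * deriv G z * ((F z - 1) * F z))"
      unfolding p' power_Suc by algebra
    also have "\<dots> = 0" by (simp add: ode)
    finally show ?thesis by simp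
  qed
  moreover obtain a where a: "N a * D a \<noteq> 0"
  proof -
    obtain a1 a2 a3 a4 where "F a1 \<noteq> 1" "F a2 \<noteq> 0" "G a3 \<noteq> \<alpha>" "G a4 \<noteq> \<beta>"
      using F_nonconst G_nonconst by metis
    then obtain b c where b: "N b \<noteq> 0" and c: "D c \<noteq> 0"
      using entire_mult_nonzero[of "\<lambda>z. (F z - 1) ^ q" a1 "\<lambda>z. (G z - \<beta>) ^ p" a4]
        entire_mult_nonzero[of "\<lambda>z. F z ^ q" a2 "\<lambda>z. (G z - \<alpha>) ^ p" a3]
        holomorphic_on_power[OF holomorphic_on_diff[OF F holomorphic_on_const]]
        holomorphic_on_power[OF holomorphic_on_diff[OF G holomorphic_on_const]] holomorphic_on_power[OF F]
      by (auto simp: N_def D_def)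
    show ?thesis using entire_mult_nonzero[OF N b D c] that by blast
  qed
  ultimately obtain c where "c \<noteq> 0" "\<And>z. N z = c * D z"
    using entire_linear_combination_constant[OF N D, of a] by (metis mult_eq_0_iff)
  then show ?thesis using that by (simp add: N_def D_def)
qed

text \<open>The quotient \<open>E = F ^ q / (G - \<beta>) ^ p\<close> extends by the power identity
  to an entire function without zeros, and the mean of \<open>ln (cmod E)\<close> is the constant
  \<open>ln (cmod (E 0))\<close>. Pointwise,
  \<open>q * log_plus (cmod F) - p * log_plus (cmod G)\<close> differs from
  \<open>ln (cmod E)\<close> by a bounded amount.\<close>

lemma characteristic_proportional:
  assumes c: "c \<noteq> 0" "\<And>z. (F z - 1) ^ q * (G z - \<beta>) ^ p = c * (F z ^ q * (G z - \<alpha>) ^ p)"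
    and pq: "0 < p" "0 < q"
  obtains C where "\<And>r. 0 < r \<Longrightarrow> \<bar>real q * nev_char F r - real p * nev_char G r\<bar> \<le> C"
proof -
  define E where "E z = (if F z \<noteq> 0 then F z ^ q / (G z - \<beta>) ^ p else (F z - 1) ^ q / (c * (G z - \<alpha>) ^ p))" for z
  have E0: "E z = F z ^ q / (G z - \<beta>) ^ p" if "F z \<noteq> 0" for z using that by (simp add: E_def)
  have E1: "E z = (F z - 1) ^ q / (c * (G z - \<alpha>) ^ p)" if "F z \<noteq> 1" for z
    using that c(2)[of z] c(1) shared[of z] by (simp add: E_def field_simps)
  have open_ne: "open {z. F z \<noteq> e}" for e
    by (intro open_Collect_neq continuous_on_const continuous_on_entire F)
  have sub: "F holomorphic_on S" "G holomorphic_on S" for S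
    using F G holomorphic_on_subset by blast+
  have "(\<lambda>z. F z ^ q / (G z - \<beta>) ^ p) holomorphic_on {z. F z \<noteq> 0}"
    using shared by (intro holomorphic_intros sub) auto
  then have h0: "E holomorphic_on {z. F z \<noteq> 0}" by (rule holomorphic_transform) (simp add: E0)
  have "(\<lambda>z. (F z - 1) ^ q / (c * (G z - \<alpha>) ^ p)) holomorphic_on {z. F z \<noteq> 1}"
    using shared c(1) by (intro holomorphic_intros sub) auto
  then have h1: "E holomorphic_on {z. F z \<noteq> 1}" by (rule holomorphic_transform) (simp add: E1)
  have "{z. F z \<noteq> 0} \<union> {z. F z \<noteq> 1} = UNIV" by auto
  then have E: "E holomorphic_on UNIV" using holomorphic_on_Un[OF h0 h1 open_ne open_ne] by simp
  have E_nz: "E z \<noteq> 0" for z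
  proof (cases "F z = 0")
    case True
    then show ?thesis using shared[of z] \<alpha>\<beta> c(1) E1[of z] by auto
  next
    case False
    then show ?thesis using shared[of z] E0[of z] by auto
  qed
  have FE: "F z ^ q = E z * (G z - \<beta>) ^ p" for z
    using E0[of z] shared[of z] pq by (cases "F z = 0") (auto simp: power_0_left)
  have FE1: "(F z - 1) ^ q = c * E z * (G z - \<alpha>) ^ p" for z
    using E1[of z] shared[of z] pq c(1) by (cases "F z = 1") (auto simp: power_0_left)
  define A where "A = 1 + cmod \<alpha> + cmod \<beta>"
  define B where "B = 1 + (2 + 2 * cmod \<alpha>) / cmod (\<alpha> - \<beta>)"
  define C where "C = q * ln 2 + \<bar>ln (cmod c)\<bar> + p * (ln A + ln B) + \<bar>ln (cmod (E 0))\<bar>"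
  have AB: "1 \<le> A" "1 \<le> B" by (auto simp: A_def B_def)
  have ptw: "\<bar>q * log_plus (cmod (F z)) - p * log_plus (cmod (G z)) - ln (cmod (E z))\<bar>
      \<le> q * ln 2 + \<bar>ln (cmod c)\<bar> + p * (ln A + ln B)" for z
  proof -
    define f where "f = max 1 (cmod (F z))"
    define g where "g = max 1 (cmod (G z))"
    \<comment> \<open>\<open>F\<close> and \<open>F - 1\<close> are not both small, nor are
      \<open>G - \<alpha>\<close> and \<open>G - \<beta>\<close>, so these maxima are comparable
      with \<open>f\<close> and \<open>g\<close> and avoid the singularities of the logarithm at
      shared points.\<close>
    define mf where "mf = max (cmod (F z)) (cmod (F z - 1))"
    define mg where "mg = max (cmod (G z - \<beta>)) (cmod (G z - \<alpha>))"
    have "1 \<le> cmod (F z) + cmod (F z - 1)"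
      using norm_triangle_ineq4[of "F z" "F z - 1"] by simp
    moreover have "cmod (F z - 1) \<le> cmod (F z) + 1"
      using norm_triangle_ineq4[of "F z" 1] by simp
    ultimately have mf: "f \<le> 2 * mf" "mf \<le> 2 * f" "0 < mf" "1 \<le> f"
      by (auto simp: f_def mf_def max_def)
    have k: "0 < cmod (\<alpha> - \<beta>)" using \<alpha>\<beta> by simp
    have "\<alpha> - \<beta> = (G z - \<beta>) - (G z - \<alpha>)" by simp
    then have "cmod (\<alpha> - \<beta>) \<le> cmod (G z - \<beta>) + cmod (G z - \<alpha>)" by (metis norm_triangle_ineq4)
    then have m2: "cmod (\<alpha> - \<beta>) \<le> 2 * mg" by (auto simp: mg_def)
    then have mg0: "0 < mg" using k by linarith
    have mg1: "mg \<le> A * g"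
    proof -
      have "mg \<le> cmod (G z) + cmod \<alpha> + cmod \<beta>"
        using norm_triangle_ineq4[of "G z" \<alpha>] norm_triangle_ineq4[of "G z" \<beta>] by (auto simp: mg_def intro: order_trans)
      also have "\<dots> \<le> g + cmod \<alpha> * g + cmod \<beta> * g"
        by (intro add_mono mult_le_cancel_left1[THEN iffD2]) (auto simp: g_def)
      finally show ?thesis by (simp add: A_def algebra_simps)
    qed
    have mg2: "g \<le> B * mg"
    proof -
      have one: "1 \<le> 2 / cmod (\<alpha> - \<beta>) * mg" using m2 k by (simp add: field_simps)
      have "cmod (G z) \<le> cmod (G z - \<alpha>) + cmod \<alpha> * 1"
        using norm_triangle_ineq[of "G z - \<alpha>" \<alpha>] by simp
      also have "\<dots> \<le> mg + cmod \<alpha> * (2 / cmod (\<alpha> - \<beta>) * mg)"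
        using one by (intro add_mono mult_left_mono) (auto simp: mg_def)
      finally have "cmod (G z) \<le> mg + cmod \<alpha> * (2 / cmod (\<alpha> - \<beta>) * mg)" .
      moreover have "0 \<le> cmod \<alpha> * (2 / cmod (\<alpha> - \<beta>) * mg)" using mg0 by simp
      ultimately have "g \<le> mg + cmod \<alpha> * (2 / cmod (\<alpha> - \<beta>) * mg) + 2 / cmod (\<alpha> - \<beta>) * mg"
        unfolding g_def using one mg0 by (intro max.boundedI) linarith+
      also have "\<dots> = B * mg" using k by (simp add: B_def field_simps)
      finally show ?thesis .
    qed
    define e where "e = cmod (E z)"
    have e: "0 < e" using E_nz by (simp add: e_def)
    have n0: "cmod (F z) ^ q = e * cmod (G z - \<beta>) ^ p"
      by (metis FE e_def norm_mult norm_power)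
    have n1: "cmod (F z - 1) ^ q = cmod c * e * cmod (G z - \<alpha>) ^ p"
      by (metis FE1 e_def norm_mult norm_power)
    \<comment> \<open>The two expressions for \<open>E\<close> differ by the factor
      \<open>c\<close>; \<open>c0\<close> and \<open>c1\<close> bound the constants 1 and
      \<open>cmod c\<close> in both of them.\<close>
    define c1 where "c1 = max 1 (cmod c)"
    define c0 where "c0 = min 1 (cmod c)"
    have c01: "0 < c0" "0 < c1" "c0 \<le> 1" "1 \<le> c1" "c0 \<le> cmod c" "cmod c \<le> c1" using c(1) by (auto simp: c0_def c1_def)
    have up: "mf ^ q \<le> c1 * e * mg ^ p"
    proof (cases "cmod (F z - 1) \<le> cmod (F z)")
      case True
      then have "mf ^ q = 1 * e * cmod (G z - \<beta>) ^ p" by (simp add: mf_def max_def n0)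
      also have "\<dots> \<le> c1 * e * mg ^ p" using c01 e by (intro mult_mono power_mono) (auto simp: mg_def)
      finally show ?thesis .
    next
      case False
      then have "mf ^ q = cmod c * e * cmod (G z - \<alpha>) ^ p" by (simp add: mf_def max_def n1)
      also have "\<dots> \<le> c1 * e * mg ^ p" using c01 e by (intro mult_mono power_mono) (auto simp: mg_def)
      finally show ?thesis .
    qed
    have lo: "c0 * e * mg ^ p \<le> mf ^ q"
    proof (cases "cmod (G z - \<alpha>) \<le> cmod (G z - \<beta>)")
      case True
      then have "c0 * e * mg ^ p \<le> 1 * e * cmod (G z - \<beta>) ^ p"
        using c01 e by (intro mult_mono) (auto simp: mg_def max_def)
      also have "\<dots> = cmod (F z) ^ q" by (simp add: n0)
      also have "\<dots> \<le> mf ^ q" by (intro power_mono) (auto simp: mf_def)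
      finally show ?thesis .
    next
      case False
      then have "c0 * e * mg ^ p \<le> cmod c * e * cmod (G z - \<alpha>) ^ p"
        using c01 e by (intro mult_mono) (auto simp: mg_def max_def)
      also have "\<dots> = cmod (F z - 1) ^ q" by (simp add: n1)
      also have "\<dots> \<le> mf ^ q" by (intro power_mono) (auto simp: mf_def)
      finally show ?thesis .
    qed
    have ln_up: "q * ln mf \<le> ln c1 + ln e + p * ln mg"
    proof -
      have "ln (mf ^ q) \<le> ln (c1 * e * mg ^ p)" using up mf by (intro ln_mono) auto
      then show ?thesis using c01 e mg0 mf by (simp add: ln_mult ln_realpow)
    qed
    have ln_lo: "ln c0 + ln e + p * ln mg \<le> q * ln mf"
    proof -
      have "ln (c0 * e * mg ^ p) \<le> ln (mf ^ q)" using lo mg0 c01 e by (intro ln_mono) auto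
      then show ?thesis using c01 e mg0 mf by (simp add: ln_mult ln_realpow)
    qed
    have lf: "ln f \<le> ln 2 + ln mf" "ln mf \<le> ln 2 + ln f"
      using mf ln_mono[of f "2 * mf"] ln_mono[of mf "2 * f"] by (auto simp: ln_mult)
    have "1 \<le> g" by (simp add: g_def)
    have lg: "ln mg \<le> ln A + ln g" "ln g \<le> ln B + ln mg"
      using mg0 mg1 mg2 AB ln_mono[of mg "A * g"] ln_mono[of g "B * mg"] \<open>1 \<le> g\<close> by (auto simp: ln_mult)
    have lA: "0 \<le> ln A" "0 \<le> ln B" using AB by auto
    have lc: "ln c1 \<le> \<bar>ln (cmod c)\<bar>" "- \<bar>ln (cmod c)\<bar> \<le> ln c0"
      using c(1) by (auto simp: c0_def c1_def max_def min_def)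
    have "q * ln f \<le> q * (ln 2 + ln mf)" "q * ln mf \<le> q * (ln 2 + ln f)"
      using lf by (intro mult_left_mono; simp)+
    moreover have "p * ln mg \<le> p * (ln A + ln g)" "p * ln g \<le> p * (ln B + ln mg)" "0 \<le> p * ln A" "0 \<le> p * ln B"
      using lg lA by (auto intro!: mult_left_mono)
    ultimately have "\<bar>q * ln f - p * ln g - ln e\<bar> \<le> q * ln 2 + \<bar>ln (cmod c)\<bar> + p * (ln A + ln B)"
      using ln_up ln_lo lc unfolding distrib_left by (simp only: abs_le_iff) linarith
    then show ?thesis by (simp add: f_def g_def e_def log_plus_eq_ln_max)
  qed
  have "\<bar>real q * nev_char F r - real p * nev_char G r\<bar> \<le> C" if r: "0 < r" for r
  proof -
    have contF: "continuous_on (sphere 0 r) (\<lambda>z. log_plus (cmod (F z)))"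
      and contG: "continuous_on (sphere 0 r) (\<lambda>z. log_plus (cmod (G z)))"
      by (intro continuous_on_log_plus continuous_on_entire F G)+
    have contE: "continuous_on (sphere 0 r) (\<lambda>z. ln (cmod (E z)))"
      using E_nz by (intro continuous_on_ln_cmod E) auto
    define u where "u z = q * log_plus (cmod (F z)) - p * log_plus (cmod (G z)) - ln (cmod (E z))" for z
    have contu: "continuous_on (sphere 0 r) u"
      unfolding u_def by (intro continuous_on_diff continuous_on_mult continuous_on_const contF contG contE)
    define M where "M = q * ln 2 + \<bar>ln (cmod c)\<bar> + p * (ln A + ln B)"
    have u: "u z \<le> M" "- M \<le> u z" for z
      using ptw[of z] unfolding u_def M_def abs_le_iff by linarith+
    have "circle_mean u r \<le> circle_mean (\<lambda>_. M) r"
      using r by (intro circle_mean_mono contu continuous_on_const u) auto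
    moreover have "circle_mean (\<lambda>_. - M) r \<le> circle_mean u r"
      using r by (intro circle_mean_mono contu continuous_on_const u) auto
    moreover have "circle_mean u r = q * nev_char F r - p * nev_char G r - ln (cmod (E 0))"
    proof -
      have "circle_mean u r = q * nev_char F r - p * nev_char G r - circle_mean (\<lambda>z. ln (cmod (E z))) r"
        unfolding u_def nev_char_eq using r contF contG contE
        by (simp add: circle_mean_diff continuous_on_diff continuous_on_mult continuous_on_const)
      then show ?thesis using circle_mean_ln_zero_free[OF E E_nz r] by simp
    qed
    ultimately show ?thesis unfolding C_def M_def[symmetric] by simp
  qed
  then show ?thesis by (rule that)
qed

text \<open>For \<open>c = 1\<close> the relation says \<open>L = 0\<close>. Otherwise
  \<open>F\<close> is a Moebius transform of \<open>G\<close>, so \<open>G\<close> omits the value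
  \<open>\<gamma>\<close> sent to infinity, and the difference equation for \<open>F\<close> forces
  a second omitted value.\<close>

lemma not_proportional:
  assumes c: "c \<noteq> 0" "\<And>z. (F z - 1) * (G z - \<beta>) = c * (F z * (G z - \<alpha>))"
  shows False
proof (cases "c = 1")
  case True
  have "L z = 0" for z using c(2)[of z] by (simp add: True L_def algebra_simps)
  then show False using L_nonzero by blast
next
  case False
  \<comment> \<open>Solving for \<open>F\<close> gives \<open>F = a + k / (G - \<gamma>)\<close>:
    \<open>\<gamma>\<close> is the pole of this Moebius map, \<open>a\<close> its value at
    infinity.\<close>
  define \<gamma> where "\<gamma> = (\<beta> - c * \<alpha>) / (1 - c)"
  define a where "a = 1 / (1 - c)"
  define k where "k = (\<gamma> - \<beta>) / (1 - c)"
  define E where "E z = G z - \<gamma>" for z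
  have c1: "1 - c \<noteq> 0" using False by simp
  have k0: "k \<noteq> 0"
  proof
    assume "k = 0"
    then have "\<beta> - c * \<alpha> = \<beta> * (1 - c)" using c1 by (simp add: k_def \<gamma>_def field_simps)
    then have "c * \<beta> = c * \<alpha>" by (simp add: algebra_simps)
    then show False using c(1) \<alpha>\<beta> by auto
  qed
  have FE: "F z * (1 - c) * E z = G z - \<beta>" for z
  proof -
    have "F z * (1 - c) * E z = F z * ((1 - c) * G z - (1 - c) * \<gamma>)"
      by (simp add: E_def algebra_simps)
    also have "(1 - c) * \<gamma> = \<beta> - c * \<alpha>" using c1 by (simp add: \<gamma>_def)
    finally have "F z * (1 - c) * E z = F z * ((1 - c) * G z - (\<beta> - c * \<alpha>))" .
    also have "\<dots> = (G z - \<beta>)"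
      using c(2)[of z] by (simp add: algebra_simps)
    finally show ?thesis .
  qed
  have E0: "E z \<noteq> 0" for z
  proof
    assume "E z = 0"
    then have "G z = \<beta>" "G z = \<gamma>" using FE[of z] by (auto simp: E_def)
    then show False using k0 by (simp add: k_def)
  qed
  have F_eq: "F z = a + k / E z" for z
  proof -
    have "G z - \<beta> = E z + (\<gamma> - \<beta>)" by (simp add: E_def)
    then have "F z = (E z + (\<gamma> - \<beta>)) / ((1 - c) * E z)"
      using FE[of z] E0[of z] c1 by (simp add: eq_divide_eq mult_ac)
    then show ?thesis using E0[of z] c1 by (simp add: a_def k_def add_divide_distrib)
  qed
  \<comment> \<open>The quadratic comes from \<open>G z = k / E (z + \<eta>) - k / E z\<close>:
    multiplied out, it reads \<open>E (z + \<eta>) * (E^2 + \<gamma> * E + k) = k * E\<close> with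
    \<open>E\<close> taken at \<open>z\<close>, so \<open>E\<close> cannot equal a root.\<close>
  define w where "w = (- \<gamma> + csqrt (\<gamma>\<^sup>2 - 4 * k)) / 2"
  have w: "w\<^sup>2 + \<gamma> * w + k = 0"
  proof -
    have "csqrt (\<gamma>\<^sup>2 - 4 * k) = 2 * w + \<gamma>" by (simp add: w_def field_simps)
    then have "(2 * w + \<gamma>)\<^sup>2 = \<gamma>\<^sup>2 - 4 * k" by (metis power2_csqrt)
    then have "4 * (w\<^sup>2 + \<gamma> * w + k) = 0" by (simp add: power2_eq_square algebra_simps)
    then show ?thesis unfolding mult_eq_0_iff by simp
  qed
  have w0: "w \<noteq> 0" using w k0 by auto
  have Ew: "E z \<noteq> w" for z
  proof
    assume "E z = w"
    then have zero: "(E z)\<^sup>2 + \<gamma> * E z + k = 0" using w by simp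
    have "G z = k / E (z + \<eta>) - k / E z"
      unfolding G_def by (simp add: F_eq)
    then have "E z + \<gamma> = k / E (z + \<eta>) - k / E z" by (simp add: E_def)
    then have "(E z + \<gamma>) * E (z + \<eta>) * E z = k * E z - k * E (z + \<eta>)"
      using E0[of z] E0[of "z + \<eta>"] by (simp add: field_simps)
    then have "E (z + \<eta>) * ((E z)\<^sup>2 + \<gamma> * E z + k) = k * E z"
      by (simp add: power2_eq_square algebra_simps)
    then show False using zero k0 E0[of z] by simp
  qed
  have "E holomorphic_on UNIV" unfolding E_def by (intro holomorphic_intros G)
  moreover have "range E \<inter> {0, w} = {}" using E0 Ew by auto
  ultimately obtain e where "E = (\<lambda>z. e)" using little_Picard[of E 0 w] w0 by metis
  then show False using F_nonconst[of "a + k / e"] F_eq by simp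
qed

lemma contradiction: False
proof -
  obtain p q where pq: "0 < p" "0 < q" "\<And>z. of_nat q * \<phi> z = of_nat p * (\<alpha> - \<beta>) * \<psi> z"
    by (rule proportional_quotients) (rule that)
  obtain c where c: "c \<noteq> 0" "\<And>z. (F z - 1) ^ q * (G z - \<beta>) ^ p = c * (F z ^ q * (G z - \<alpha>) ^ p)"
    by (rule power_identity[OF pq]) (rule that)
  obtain C where C: "\<And>r. 0 < r \<Longrightarrow> \<bar>real q * nev_char F r - real p * nev_char G r\<bar> \<le> C"
    by (rule characteristic_proportional[OF c pq(1,2)]) (rule that)
  obtain a where a: "F a \<noteq> F 0" by (rule F_differs)
  have "p = q"
  proof -
    obtain r where r: "growth_radii r (\<lambda>k. nev_char F (r k))"
      "growth_radii.dominated r (\<lambda>k. nev_char F (r k)) F" "\<And>Y. Y \<in> base_zeros \<Longrightarrow> growth_radii.clean r Y"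
    proof (rule clean_radii[OF F a growth, of "base_zeros"])
      show "finite base_zeros" by (simp add: base_zeros_def)
    qed (use base_zeros_entire base_zeros_nonzero that in auto)
    interpret growth_radii r "\<lambda>k. nev_char F (r k)" by (rule r(1))
    interpret shared_pairs_radii F \<eta> \<alpha> \<beta> \<phi> \<psi> K r
      by unfold_locales (use r in auto)
    show ?thesis
    proof (rule equal_multiplicities)
      fix k show "\<bar>real q * nev_char F (r k) - real p * nev_char G (r k)\<bar> \<le> C"
        using r_ge_1[of k] by (intro C) auto
    qed
  qed
  \<comment> \<open>The common factor is cancelled before integrating again: exponents 1 avoid
    extracting a root from the identity with exponents \<open>q\<close>.\<close>
  then have "of_nat 1 * \<phi> z = of_nat 1 * (\<alpha> - \<beta>) * \<psi> z" for z
    using pq(2) pq(3)[of z] by (simp add: mult.assoc)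
  then obtain d where "d \<noteq> 0" "\<And>z. (F z - 1) ^ 1 * (G z - \<beta>) ^ 1 = d * (F z ^ 1 * (G z - \<alpha>) ^ 1)"
    using power_identity[of 1 1] by (metis less_numeral_extra(1))
  then show False using not_proportional[of d] by simp
qed

end

context shared_pairs
begin

lemma periodic_quotient:
  assumes growth: "eventually (\<lambda>r. nev_char F r \<le> r ^ K) at_top"
  shows "(\<forall>z. L z = 0) \<or> (\<exists>\<phi>. \<phi> holomorphic_on UNIV \<and> (\<forall>z. \<phi> (z + \<eta>) = \<phi> z) \<and>
           (\<forall>z. deriv F z * L z = \<phi> z * ((F z - 1) * F z)))"
proof (rule ccontr)
  assume no: "\<not> ?thesis"
  obtain \<phi> \<psi> where q: "\<phi> holomorphic_on UNIV" "\<psi> holomorphic_on UNIV"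
    "\<And>z. deriv F z * L z = \<phi> z * ((F z - 1) * (F z - 0))"
    "\<And>z. deriv G z * L z = \<psi> z * ((G z - \<alpha>) * (G z - \<beta>))"
    by (rule quotients_exist) (rule that)
  interpret shared_pairs_nonperiodic F \<eta> \<alpha> \<beta> \<phi> \<psi> K
    by unfold_locales (use q no growth in \<open>auto\<close>)
  show False by (rule contradiction)
qed

end

section \<open>From finite order and arbitrary pairs to the normalised situation\<close>

lemma finite_order_growth:
  assumes "order_of f < \<infinity>"
  obtains n where "eventually (\<lambda>r. nev_char f r \<le> r ^ n) at_top"
proof -
  obtain n :: nat where n: "order_of f < ereal (real n)"
    using assms less_PInf_Ex_of_nat[of "order_of f"] by auto
  have "eventually (\<lambda>r. ereal (log_plus (nev_char f r) / ln r) < ereal (real n)) at_top"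
    using n unfolding order_of_def by (rule Limsup_lessD)
  then have "eventually (\<lambda>r. nev_char f r \<le> r ^ n) at_top"
    using eventually_gt_at_top[of 1]
  proof eventually_elim
    case (elim r)
    show ?case
    proof (cases "0 < nev_char f r")
      case True
      have "ln (nev_char f r) \<le> log_plus (nev_char f r)" by (rule ln_le_log_plus)
      also have "\<dots> \<le> n * ln r" using elim by (simp add: divide_less_eq)
      also have "\<dots> = ln (r ^ n)" using elim by (simp add: ln_realpow)
      finally show ?thesis using True elim by simp
    next
      case False
      then show ?thesis using elim zero_le_power[of r n] by linarith
    qed
  qed
  then show ?thesis by (rule that)
qed

text \<open>One extra power of \<open>r\<close> absorbs the additive constant \<open>c\<close> as
  soon as \<open>r \<ge> 1 + c\<close>.\<close>

lemma growth_affine: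
  assumes f: "f holomorphic_on UNIV" and growth: "eventually (\<lambda>r. nev_char f r \<le> r ^ n) at_top"
  shows "eventually (\<lambda>r. nev_char (\<lambda>z. (f z - b) / a) r \<le> r ^ Suc n) at_top"
proof -
  define c where "c = log_plus (cmod (1 / a)) + log_plus (cmod b) + ln 2"
  have c: "0 \<le> c" by (simp add: c_def)
  have le: "nev_char (\<lambda>z. (f z - b) / a) r \<le> nev_char f r + c" if r: "0 \<le> r" for r
  proof -
    have "nev_char (\<lambda>z. (f z - b) / a) r \<le> circle_mean (\<lambda>z. log_plus (cmod (f z)) + c) r"
      unfolding nev_char_eq
    proof (rule circle_mean_mono)
      show "continuous_on (sphere 0 r) (\<lambda>z. log_plus (cmod ((f z - b) / a)))"
        unfolding divide_inverse
        by (intro continuous_on_log_plus continuous_on_mult continuous_on_diff continuous_on_const continuous_on_entire f)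
      show "continuous_on (sphere 0 r) (\<lambda>z. log_plus (cmod (f z)) + c)"
        by (intro continuous_on_add continuous_on_const continuous_on_log_plus continuous_on_entire f)
      fix z
      have "cmod ((f z - b) / a) = cmod (1 / a) * cmod (f z - b)" by (simp add: norm_divide)
      also have "log_plus \<dots> \<le> log_plus (cmod (1 / a)) + log_plus (cmod (f z - b))"
        by (intro log_plus_mult) auto
      also have "log_plus (cmod (f z - b)) \<le> log_plus (cmod (f z) + cmod b)"
        by (intro log_plus_mono norm_triangle_ineq4) auto
      also have "\<dots> \<le> log_plus (cmod (f z)) + log_plus (cmod b) + ln 2" by (intro log_plus_add) auto
      finally show "log_plus (cmod ((f z - b) / a)) \<le> log_plus (cmod (f z)) + c" by (simp add: c_def)
    qed (rule r)
    also have "\<dots> = nev_char f r + c"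
      unfolding nev_char_eq using r
      by (subst circle_mean_add) (auto intro!: continuous_on_log_plus continuous_on_entire f)
    finally show ?thesis .
  qed
  from growth eventually_ge_at_top[of "1 + c"] show ?thesis
  proof eventually_elim
    case (elim r)
    have r1: "1 \<le> r ^ n" using elim c by (intro one_le_power) auto
    have "nev_char (\<lambda>z. (f z - b) / a) r \<le> r ^ n + c * 1" using le[of r] elim c by simp
    also have "\<dots> \<le> r ^ n + c * r ^ n" using r1 c by (intro add_mono mult_left_mono) auto
    also have "\<dots> = (1 + c) * r ^ n" by (simp add: algebra_simps)
    also have "\<dots> \<le> r * r ^ n" using elim r1 by (intro mult_right_mono) auto
    finally show ?case by simp
  qed
qed

text \<open>The formula for the quotient has removable singularities at the points with value
  \<open>a1\<close> or \<open>b1\<close>; hence the second alternative speaks of an entire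
  \<open>g\<close> that agrees with it elsewhere.\<close>

theorem theorem8:
  fixes f :: "complex \<Rightarrow> complex" and \<eta> a1 a2 b1 b2 :: complex
  assumes entire: "f holomorphic_on UNIV"
    and nonconst: "\<not> (\<exists>c. \<forall>z. f z = c)"
    and fin_order: "order_of f < \<infinity>"
    and eta: "\<eta> \<noteq> 0"
    and ab1: "a1 \<noteq> b1" and ab2: "a2 \<noteq> b2"
    and shA: "share_pair_IM f (\<lambda>z. f (z + \<eta>) - f z) a1 a2"
    and shB: "share_pair_IM f (\<lambda>z. f (z + \<eta>) - f z) b1 b2"
  shows "(\<forall>z. (a2 - b2) * f z - (a1 - b1) * (f (z + \<eta>) - f z) = a2 * b1 - a1 * b2)
       \<or> (\<exists>g. g holomorphic_on UNIV \<and> (\<forall>z. g (z + \<eta>) = g z) \<and>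
            (\<forall>z. (f z - a1) * (f z - b1) \<noteq> 0 \<longrightarrow>
               g z = deriv f z * ((a2 - b2) * f z - (a1 - b1) * (f (z + \<eta>) - f z) - a2 * b1 + a1 * b2)
                     / ((f z - a1) * (f z - b1))))"
proof -
  define A where "A = a1 - b1"
  define F where "F z = (f z - b1) / A" for z
  have A: "A \<noteq> 0" using ab1 by (simp add: A_def)
  have f_eq: "f z = b1 + A * F z" for z using A by (simp add: F_def)
  have shift: "F (z + \<eta>) - F z = (f (z + \<eta>) - f z) / A" for z
    by (simp add: F_def flip: diff_divide_distrib)
  interpret shared_pairs F \<eta> "a2 / A" "b2 / A"
  proof
    show "F holomorphic_on UNIV" unfolding F_def using A by (intro holomorphic_intros entire) auto
    show "\<exists>z. F z \<noteq> e" for e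
      using nonconst A f_eq by metis
    show "a2 / A \<noteq> b2 / A" using A ab2 by simp
    fix z
    have "F z = 1 \<longleftrightarrow> f z = a1" using A by (auto simp: F_def A_def field_simps)
    also have "\<dots> \<longleftrightarrow> f (z + \<eta>) - f z = a2" using shA unfolding share_pair_IM_def by blast
    finally show "F z = 1 \<longleftrightarrow> F (z + \<eta>) - F z = a2 / A" using A by (simp add: shift)
    have "F z = 0 \<longleftrightarrow> f z = b1" using A by (simp add: F_def)
    also have "\<dots> \<longleftrightarrow> f (z + \<eta>) - f z = b2" using shB unfolding share_pair_IM_def by blast
    finally show "F z = 0 \<longleftrightarrow> F (z + \<eta>) - F z = b2 / A" using A by (simp add: shift)
  qed
  define l where "l z = (a2 - b2) * f z - (a1 - b1) * (f (z + \<eta>) - f z) - a2 * b1 + a1 * b2" for z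
  \<comment> \<open>Together with \<open>deriv f = A * deriv F\<close> and the factor
    \<open>A^2\<close> in the denominator, this leaves \<open>A * \<phi>\<close> as the quotient for
    \<open>f\<close>.\<close>
  have l: "l z = A\<^sup>2 * L z" for z
  proof -
    have "L z = ((a2 - b2) * F z + b2 - (f (z + \<eta>) - f z)) / A"
      unfolding L_def G_def shift by (simp add: add_divide_distrib diff_divide_distrib left_diff_distrib)
    then have AL: "A * L z = (a2 - b2) * F z + b2 - (f (z + \<eta>) - f z)" using A by simp
    have "A\<^sup>2 * L z = A * (A * L z)" by (simp add: power2_eq_square)
    also have "\<dots> = (a2 - b2) * (A * F z) + A * b2 - A * (f (z + \<eta>) - f z)"
      unfolding AL by (simp add: algebra_simps)
    finally have "A\<^sup>2 * L z = (a2 - b2) * (A * F z) + A * b2 - A * (f (z + \<eta>) - f z)" .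
    then show ?thesis by (simp add: l_def f_eq[of z] A_def algebra_simps)
  qed
  obtain n where n: "eventually (\<lambda>r. nev_char f r \<le> r ^ n) at_top"
    by (rule finite_order_growth[OF fin_order]) (rule that)
  have "eventually (\<lambda>r. nev_char F r \<le> r ^ Suc n) at_top"
    using growth_affine[OF entire n] by (simp add: F_def[abs_def])
  from periodic_quotient[OF this] show ?thesis
  proof
    assume "\<forall>z. L z = 0"
    then have "l z = 0" for z by (simp add: l)
    then have "\<forall>z. (a2 - b2) * f z - (a1 - b1) * (f (z + \<eta>) - f z) = a2 * b1 - a1 * b2"
      by (simp add: l_def algebra_simps)
    then show ?thesis ..
  next
    assume "\<exists>\<phi>. \<phi> holomorphic_on UNIV \<and> (\<forall>z. \<phi> (z + \<eta>) = \<phi> z) \<and> (\<forall>z. deriv F z * L z = \<phi> z * ((F z - 1) * F z))"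
    then obtain \<phi> where \<phi>: "\<phi> holomorphic_on UNIV" "\<And>z. \<phi> (z + \<eta>) = \<phi> z"
      "\<And>z. deriv F z * L z = \<phi> z * ((F z - 1) * F z)" by blast
    have "A * \<phi> z = deriv f z * l z / ((f z - a1) * (f z - b1))" if "(f z - a1) * (f z - b1) \<noteq> 0" for z
    proof -
      have "(f has_field_derivative A * deriv F z) (at z)"
        using holomorphic_derivI[OF F open_UNIV, of z] unfolding f_eq[abs_def]
        by (auto intro!: derivative_eq_intros)
      then have "deriv f z * l z = A ^ 3 * (deriv F z * L z)"
        by (simp add: DERIV_imp_deriv l power2_eq_square power3_eq_cube)
      also have "\<dots> = A * \<phi> z * ((A * F z - A) * (A * F z))"
        by (simp add: \<phi>(3) power3_eq_cube algebra_simps)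
      also have "(A * F z - A) * (A * F z) = (f z - a1) * (f z - b1)"
        by (simp add: f_eq A_def)
      finally show ?thesis using that by simp
    qed
    moreover have "(\<lambda>z. A * \<phi> z) holomorphic_on UNIV" by (intro holomorphic_intros \<phi>)
    ultimately show ?thesis using \<phi>(2) unfolding l_def by (intro disjI2 exI[of _ "\<lambda>z. A * \<phi> z"]) auto
  qed
qed

end
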